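(* Let $(\mathcal A,\varphi)$ be a $C^*$-noncommutative probability space and let $(a_1,b_1),(a_2,b_2)\in\mathcal A^2$ be two-faced pairs of self-adjoint random variables with $a_jb_j=b_ja_j$, $j=1,2$, which are bi-free with respect to $\varphi$. Let $\eta_j$ be the distribution of $(a_j,b_j)$, a compactly supported probability measure on $\mathbb R^2$. Then for all $z,w\in\mathbb C^+$ and $j\in\{1,2\}$, $$\Im G_{a_j}(z)\,\Im G_{b_j}(w)\ge\Im z\,\Im w\,|G_{(a_j,b_j)}(z,w)|^2,$$ and $$\Im\omega_{a_j}(z)\,\Im\omega_{b_j}(w)\,|G_{\eta_j}(\omega_{a_j}(z),\omega_{b_j}(w))|^2\ge\Im z\,\Im w\,|G_{\eta_1\boxplus\boxplus\eta_2}(z,w)|^2.$$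
   Context: A $C^*$-noncommutative probability space $(\mathcal A,\varphi)$ is a unital $C^*$-algebra with a faithful state. $\mathbb C^+$ is the open upper half-plane. Bi-freeness: given vector spaces with state vectors $\mathcal X_j=\mathbb C\xi_j\oplus\mathcal X_j^\circ$, $j=1,2$, their free product is $\mathcal X=\mathbb C\xi\oplus\bigoplus_{n\ge1}\bigoplus_{i_1\ne i_2\ne\cdots\ne i_n}\mathcal X^\circ_{i_1}\otimes\cdots\otimes\mathcal X^\circ_{i_n}$. Let $\mathcal X(\ell,j)$ (resp. $\mathcal X(r,j)$) be the sum of $\mathbb C\xi$ and the summands with $i_1\ne j$ (resp. $i_n\neq j$), with natural isomorphisms $V_j:\mathcal X_j\otimes\mathcal X(\ell,j)\to\mathcal X$ and $W_j:\mathcal X(r,j)\otimes\mathcal X_j\to\mathcal X$, and $\lambda_j(T)=V_j(T\otimes I)V_j^{-1}$, $\rho_j(T)=W_j(I\otimes T)W_j^{-1}$ for linear $T$ on $\mathcal X_j$. Let $\varphi_\xi(T)$ be the $\xi$-coefficient of $T\xi$. Pairs $(a_1,b_1),(a_2,b_2)$ are bi-free with respect to $\varphi$ if there exist such $\mathcal X_1,\mathcal X_2$ and linear operators $T_j,S_j$ on $\mathcal X_j$ such that the joint moments of $a_1,a_2,b_1,b_2$ under $\varphi$ equal those of $\lambda_1(T_1),\lambda_2(T_2),\rho_1(S_1),\rho_2(S_2)$ under $\varphi_\xi$. The distribution $\eta_j$ satisfies $\varphi(a_j^mb_j^n)=\int_{\mathbb R^2}t^ms^n\,d\eta_j(t,s)$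 for all $m,n\geq 0$; $\eta_1\boxplus\boxplus\eta_2$ (bi-free additive convolution) is the distribution of the commuting self-adjoint pair $(a_1+a_2,b_1+b_2)$. Cauchy transforms: $G_{a_j}(z)=\varphi((z-a_j)^{-1})$, $G_{b_j}(w)=\varphi((w-b_j)^{-1})$, $G_\eta(z,w)=\int_{\mathbb R^2}\frac{d\eta(t,s)}{(z-t)(w-s)}$, and $G_{(a_j,b_j)}=G_{\eta_j}$, i.e. $G_{(a_j,b_j)}(z,w)=\varphi((z-a_j)^{-1}(w-b_j)^{-1})$. Subordination functions: $\omega_{a_1},\omega_{a_2}:\mathbb C^+\to\mathbb C^+$ are the analytic functions satisfying $\omega_{a_1}(z)+\omega_{a_2}(z)-z=\frac1{G_{a_1+a_2}(z)}=\frac{1}{G_{a_1}(\omega_{a_1}(z))}=\frac1{G_{a_2}(\omega_{a_2}(z))}$ (near infinity $\omega_{a_j}$ is the compositional inverse of $G_{a_j}$ composed with $G_{a_1+a_2}$); $\omega_{b_1},\omega_{b_2}$ are defined in the same way from $b_1,b_2$. *)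

theory Defs
  imports
    "HOL-Probability.Probability"
    "HOL-Complex_Analysis.Complex_Analysis"
    "HOL-Library.Poly_Mapping"
begin

section \<open>Complex vector spaces\<close>

class complex_vector = ab_group_add +
  fixes scaleC :: "complex \<Rightarrow> 'a \<Rightarrow> 'a"  (infixr "*\<^sub>C" 75)
  assumes scaleC_add_right: "c *\<^sub>C (x + y) = c *\<^sub>C x + c *\<^sub>C y"
    and scaleC_add_left: "(c + d) *\<^sub>C x = c *\<^sub>C x + d *\<^sub>C x"
    and scaleC_scaleC: "c *\<^sub>C d *\<^sub>C x = (c * d) *\<^sub>C x"
    and scaleC_one: "1 *\<^sub>C x = x"

global_interpretation complex_vector: vector_space "scaleC :: complex \<Rightarrow> 'a \<Rightarrow> 'a::complex_vector"
  by unfold_locales (rule scaleC_add_right scaleC_add_left scaleC_scaleC scaleC_one)+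

abbreviation complex_span :: "'a::complex_vector set \<Rightarrow> 'a set" where
  "complex_span \<equiv> module.span scaleC"

abbreviation complex_linear :: "('a::complex_vector \<Rightarrow> 'b::complex_vector) \<Rightarrow> bool" where
  "complex_linear \<equiv> Vector_Spaces.linear scaleC scaleC"

lemma complex_linearI:
  fixes L :: "'a::complex_vector \<Rightarrow> 'b::complex_vector"
  assumes "\<And>x y. L (x + y) = L x + L y" "\<And>c x. L (c *\<^sub>C x) = c *\<^sub>C L x"
  shows "complex_linear L"
  by unfold_locales (rule assms)+

lemma complex_linear_add: "complex_linear L \<Longrightarrow> L (x + y) = L x + L y"
  and complex_linear_scale: "complex_linear L \<Longrightarrow> L (c *\<^sub>C x) = c *\<^sub>C L x"
  by (simp_all add: Vector_Spaces.linear_iff)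

instantiation complex :: complex_vector
begin
definition scaleC_complex :: "complex \<Rightarrow> complex \<Rightarrow> complex" where
  "scaleC_complex c x = c * x"
instance by standard (auto simp: scaleC_complex_def algebra_simps)
end

instantiation prod :: (complex_vector, complex_vector) complex_vector
begin
definition scaleC_prod :: "complex \<Rightarrow> 'a \<times> 'b \<Rightarrow> 'a \<times> 'b" where
  "scaleC_prod c p = (c *\<^sub>C fst p, c *\<^sub>C snd p)"
instance
  by standard (auto simp: scaleC_prod_def scaleC_add_right scaleC_add_left scaleC_scaleC scaleC_one)
end

instantiation poly_mapping :: (type, complex_vector) complex_vector
begin
lift_definition scaleC_poly_mapping :: "complex \<Rightarrow> ('a \<Rightarrow>\<^sub>0 'b) \<Rightarrow> ('a \<Rightarrow>\<^sub>0 'b)"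
  is "\<lambda>c f k. c *\<^sub>C f k"
  by (rule finite_subset[rotated], assumption) auto
instance
  by standard (transfer; auto simp: scaleC_add_right scaleC_add_left scaleC_scaleC scaleC_one)+
end


section \<open>C*-probability spaces\<close>

class cstar_algebra = complex_vector + real_normed_algebra_1 + banach +
  fixes star :: "'a \<Rightarrow> 'a"
  assumes scaleR_eq_scaleC: "r *\<^sub>R x = complex_of_real r *\<^sub>C x"
    and norm_scaleC: "norm (c *\<^sub>C x) = cmod c * norm x"
    and scaleC_mult_left: "(c *\<^sub>C x) * y = c *\<^sub>C (x * y)"
    and scaleC_mult_right: "x * (c *\<^sub>C y) = c *\<^sub>C (x * y)"
    and star_add: "star (x + y) = star x + star y"
    and star_scaleC: "star (c *\<^sub>C x) = cnj c *\<^sub>C star x"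
    and star_mult: "star (x * y) = star y * star x"
    and star_star: "star (star x) = x"
    and cstar_identity: "norm (star x * x) = (norm x)\<^sup>2"

definition faithful_state :: "('a::cstar_algebra \<Rightarrow> complex) \<Rightarrow> bool" where
  "faithful_state \<phi> \<longleftrightarrow>
     complex_linear \<phi> \<and> \<phi> 1 = 1 \<and> (\<forall>x. \<phi> (star x * x) \<in> \<real>\<^sub>\<ge>\<^sub>0) \<and>
     (\<forall>x. \<phi> (star x * x) = 0 \<longrightarrow> x = 0)"

definition self_adjoint :: "'a::cstar_algebra \<Rightarrow> bool" where
  "self_adjoint a \<longleftrightarrow> star a = a"

definition alg_inverse :: "'a::cstar_algebra \<Rightarrow> 'a" where
  "alg_inverse x = (THE y. x * y = 1 \<and> y * x = 1)"

definition resolvent :: "'a::cstar_algebra \<Rightarrow> complex \<Rightarrow> 'a" where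
  "resolvent a z = alg_inverse (z *\<^sub>C 1 - a)"


section \<open>Distributions and Cauchy transforms\<close>

definition cauchy1 :: "('a::cstar_algebra \<Rightarrow> complex) \<Rightarrow> 'a \<Rightarrow> complex \<Rightarrow> complex" where
  "cauchy1 \<phi> a z = \<phi> (resolvent a z)"

definition cauchy2 ::
    "('a::cstar_algebra \<Rightarrow> complex) \<Rightarrow> 'a \<times> 'a \<Rightarrow> complex \<Rightarrow> complex \<Rightarrow> complex" where
  "cauchy2 \<phi> p z w = \<phi> (resolvent (fst p) z * resolvent (snd p) w)"

definition cauchy_measure :: "(real \<times> real) measure \<Rightarrow> complex \<Rightarrow> complex \<Rightarrow> complex" where
  "cauchy_measure \<eta> z w =
     (\<integral>p. 1 / ((z - complex_of_real (fst p)) * (w - complex_of_real (snd p))) \<partial>\<eta>)"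

text \<open>A compactly supported measure is determined by its moments, so at most one \<open>\<eta>\<close>
  satisfies the following.\<close>

definition is_distribution ::
    "('a::cstar_algebra \<Rightarrow> complex) \<Rightarrow> 'a \<times> 'a \<Rightarrow> (real \<times> real) measure \<Rightarrow> bool" where
  "is_distribution \<phi> p \<eta> \<longleftrightarrow>
     prob_space \<eta> \<and> sets \<eta> = sets borel \<and> (\<exists>K. compact K \<and> (AE x in \<eta>. x \<in> K)) \<and>
     (\<forall>m n. \<phi> (fst p ^ m * snd p ^ n) = complex_of_real (\<integral>x. fst x ^ m * snd x ^ n \<partial>\<eta>))"

definition upper_half_plane :: "complex set"  (\<open>\<complex>\<^sup>+\<close>) where
  "\<complex>\<^sup>+ = {z. Im z > 0}"

text \<open>These conditions determine \<open>\<omega>1\<close> and \<open>\<omega>2\<close>: along \<open>z = \<i> y\<close> with \<open>y\<close> tending to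
  infinity they force each \<open>\<omega>j z\<close> to be asymptotic to \<open>z\<close>, where the Cauchy transform of
  \<open>aj\<close> is injective.\<close>

definition subordination_functions ::
    "('a::cstar_algebra \<Rightarrow> complex) \<Rightarrow> 'a \<Rightarrow> 'a \<Rightarrow> (complex \<Rightarrow> complex) \<Rightarrow> (complex \<Rightarrow> complex) \<Rightarrow> bool"
  where
  "subordination_functions \<phi> a1 a2 \<omega>1 \<omega>2 \<longleftrightarrow>
     \<omega>1 holomorphic_on \<complex>\<^sup>+ \<and> \<omega>2 holomorphic_on \<complex>\<^sup>+ \<and>
     \<omega>1 \<in> \<complex>\<^sup>+ \<rightarrow> \<complex>\<^sup>+ \<and> \<omega>2 \<in> \<complex>\<^sup>+ \<rightarrow> \<complex>\<^sup>+ \<and>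
     (\<forall>z\<in>\<complex>\<^sup>+. \<omega>1 z + \<omega>2 z - z = 1 / cauchy1 \<phi> (a1 + a2) z \<and>
        1 / cauchy1 \<phi> (a1 + a2) z = 1 / cauchy1 \<phi> a1 (\<omega>1 z) \<and>
        1 / cauchy1 \<phi> (a1 + a2) z = 1 / cauchy1 \<phi> a2 (\<omega>2 z))"


section \<open>Free products of vector spaces with state vectors\<close>

text \<open>A vector space with a state vector is given as \<open>complex \<times> 'x\<close>, where \<open>'x\<close> is the
  complement and \<open>(1, 0)\<close> the state vector.

  The free product of \<open>complex \<times> 'x\<close> and \<open>complex \<times> 'y\<close> is the free vector space on words
  over \<open>'x + 'y\<close>, modulo the words that do not alternate between \<open>'x\<close> and \<open>'y\<close> and modulo
  multilinearity in the letters. The class of the word \<open>[l1, \<dots>, ln]\<close> is the elementary tensor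
  of its letters, and the class of the empty word is the state vector.\<close>

definition alternating :: "('x + 'y) list \<Rightarrow> bool" where
  "alternating = successively (\<lambda>l l'. isl l \<noteq> isl l')"

inductive_set tensor_relations :: "(('x::complex_vector + 'y::complex_vector) list \<Rightarrow>\<^sub>0 complex) set"
  where
  nonalternating: "\<not> alternating w \<Longrightarrow> Poly_Mapping.single w 1 \<in> tensor_relations"
| add_Inl: "Poly_Mapping.single (us @ Inl (x + x') # vs) 1
     - (Poly_Mapping.single (us @ Inl x # vs) 1 + Poly_Mapping.single (us @ Inl x' # vs) 1)
     \<in> tensor_relations"
| add_Inr: "Poly_Mapping.single (us @ Inr (y + y') # vs) 1
     - (Poly_Mapping.single (us @ Inr y # vs) 1 + Poly_Mapping.single (us @ Inr y' # vs) 1)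
     \<in> tensor_relations"
| scale_Inl: "Poly_Mapping.single (us @ Inl (c *\<^sub>C x) # vs) 1
     - c *\<^sub>C Poly_Mapping.single (us @ Inl x # vs) 1 \<in> tensor_relations"
| scale_Inr: "Poly_Mapping.single (us @ Inr (c *\<^sub>C y) # vs) 1
     - c *\<^sub>C Poly_Mapping.single (us @ Inr y # vs) 1 \<in> tensor_relations"

definition tensor_equiv ::
    "(('x::complex_vector + 'y::complex_vector) list \<Rightarrow>\<^sub>0 complex) \<Rightarrow> (('x + 'y) list \<Rightarrow>\<^sub>0 complex) \<Rightarrow> bool"
  where "tensor_equiv p q \<longleftrightarrow> p - q \<in> complex_span tensor_relations"

lemma equivp_tensor_equiv:
  "equivp (tensor_equiv :: (('x::complex_vector + 'y::complex_vector) list \<Rightarrow>\<^sub>0 complex) \<Rightarrow> _)"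
  (is "equivp ?E")
proof (rule equivpI)
  show "reflp ?E"
    by (auto simp: reflp_def tensor_equiv_def complex_vector.span_zero)
  show "symp ?E"
    unfolding symp_def tensor_equiv_def by (metis complex_vector.span_neg minus_diff_eq)
  show "transp ?E"
  proof (rule transpI)
    fix p q r :: "('x + 'y) list \<Rightarrow>\<^sub>0 complex"
    assume "tensor_equiv p q" "tensor_equiv q r"
    then show "tensor_equiv p r"
      unfolding tensor_equiv_def
      using complex_vector.span_add[of "p - q" _ "q - r"] by simp
  qed
qed

quotient_type (overloaded) ('x, 'y) free_product =
  "('x::complex_vector + 'y::complex_vector) list \<Rightarrow>\<^sub>0 complex" / tensor_equiv
  by (rule equivp_tensor_equiv)

instantiation free_product :: (complex_vector, complex_vector) complex_vector
begin
lift_definition zero_free_product :: "('a, 'b) free_product" is 0 .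
lift_definition plus_free_product :: "('a, 'b) free_product \<Rightarrow> ('a, 'b) free_product \<Rightarrow> ('a, 'b) free_product"
  is "(+)"
  unfolding tensor_equiv_def by (metis complex_vector.span_add add_diff_add)
lift_definition uminus_free_product :: "('a, 'b) free_product \<Rightarrow> ('a, 'b) free_product" is uminus
  unfolding tensor_equiv_def by (metis complex_vector.span_neg minus_diff_minus)
lift_definition minus_free_product :: "('a, 'b) free_product \<Rightarrow> ('a, 'b) free_product \<Rightarrow> ('a, 'b) free_product"
  is "(-)"
proof -
  fix p p' q q' :: "('a + 'b) list \<Rightarrow>\<^sub>0 complex"
  assume "tensor_equiv p p'" "tensor_equiv q q'"
  moreover have "p - q - (p' - q') = (p - p') - (q - q')" by simp
  ultimately show "tensor_equiv (p - q) (p' - q')"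
    unfolding tensor_equiv_def by (metis complex_vector.span_diff)
qed
lift_definition scaleC_free_product :: "complex \<Rightarrow> ('a, 'b) free_product \<Rightarrow> ('a, 'b) free_product"
  is scaleC
  unfolding tensor_equiv_def
  by (metis complex_vector.span_scale complex_vector.scale_right_diff_distrib)
instance
proof
  fix x y z :: "('a, 'b) free_product" and c d :: complex
  note [simp] = tensor_equiv_def complex_vector.span_zero
  show "x + y + z = x + (y + z)" by transfer (simp add: add.assoc)
  show "x + y = y + x" by transfer (simp add: add.commute)
  show "0 + x = x" by transfer simp
  show "- x + x = 0" by transfer simp
  show "x - y = x + - y" by transfer simp
  show "c *\<^sub>C (x + y) = c *\<^sub>C x + c *\<^sub>C y" by transfer (simp add: scaleC_add_right)
  show "(c + d) *\<^sub>C x = c *\<^sub>C x + d *\<^sub>C x" by transfer (simp add: scaleC_add_left)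
  show "c *\<^sub>C d *\<^sub>C x = (c * d) *\<^sub>C x" by transfer (simp add: scaleC_scaleC)
  show "1 *\<^sub>C x = x" by transfer (simp add: scaleC_one)
qed
end

lift_definition tensor_word :: "('x + 'y) list \<Rightarrow> ('x::complex_vector, 'y::complex_vector) free_product"
  is "\<lambda>w. Poly_Mapping.single w 1" .

lemma tensor_word_span:
  "complex_span (range tensor_word) = (UNIV :: ('a::complex_vector, 'b::complex_vector) free_product set)"
proof -
  have "abs_free_product p \<in> complex_span (range tensor_word)" for p :: "('a + 'b) list \<Rightarrow>\<^sub>0 complex"
  proof -
    have sum: "abs_free_product (\<Sum>w\<in>A. q w) = (\<Sum>w\<in>A. abs_free_product (q w))"
      for A and q :: "('a + 'b) list \<Rightarrow> ('a + 'b) list \<Rightarrow>\<^sub>0 complex"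
      by (induction A rule: infinite_finite_induct)
        (simp_all flip: plus_free_product.abs_eq zero_free_product_def)
    have "Poly_Mapping.single w c = c *\<^sub>C Poly_Mapping.single w 1" for w :: "('a + 'b) list" and c
      by (transfer fixing: c) (auto simp: scaleC_complex_def when_def)
    then have single: "abs_free_product (Poly_Mapping.single w c) = c *\<^sub>C tensor_word w"
      for w :: "('a + 'b) list" and c
      by (metis scaleC_free_product.abs_eq tensor_word.abs_eq)
    have "p = (\<Sum>w\<in>Poly_Mapping.keys p. Poly_Mapping.single w (Poly_Mapping.lookup p w))"
      by (rule poly_mapping_eqI)
        (simp add: lookup_sum lookup_single when_def in_keys_iff cong: if_cong)
    then show ?thesis
      by (rule ssubst) (simp add: sum single complex_vector.span_sum complex_vector.span_scale
          complex_vector.span_base)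
  qed
  then have "u \<in> complex_span (range tensor_word)" for u :: "('a, 'b) free_product"
    by (induction u rule: free_product.abs_induct)
  then show ?thesis by blast
qed

definition free_extend :: "('w \<Rightarrow> 'v::complex_vector) \<Rightarrow> ('w \<Rightarrow>\<^sub>0 complex) \<Rightarrow> 'v" where
  "free_extend h p = (\<Sum>w\<in>Poly_Mapping.keys p. Poly_Mapping.lookup p w *\<^sub>C h w)"

text \<open>The linear extension of a map on words. It is independent of the representative if the
  map is multilinear in the letters and vanishes on words that do not alternate.\<close>

definition word_extend ::
    "(('x + 'y) list \<Rightarrow> 'v::complex_vector) \<Rightarrow>
     ('x::complex_vector, 'y::complex_vector) free_product \<Rightarrow> 'v" where
  "word_extend h u = free_extend h (rep_free_product u)"

definition word_multilinear ::
    "(('x::complex_vector + 'y::complex_vector) list \<Rightarrow> 'v::complex_vector) \<Rightarrow> bool" where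
  "word_multilinear h \<longleftrightarrow>
     (\<forall>w. \<not> alternating w \<longrightarrow> h w = 0) \<and>
     (\<forall>us vs. complex_linear (\<lambda>x. h (us @ Inl x # vs)) \<and> complex_linear (\<lambda>y. h (us @ Inr y # vs)))"

lemma free_extend_superset:
  assumes "finite A" "Poly_Mapping.keys p \<subseteq> A"
  shows "free_extend h p = (\<Sum>w\<in>A. Poly_Mapping.lookup p w *\<^sub>C h w)"
  unfolding free_extend_def using assms
  by (intro sum.mono_neutral_left) (auto simp: in_keys_iff)

lemma complex_linear_free_extend: "complex_linear (free_extend h)"
proof (rule complex_linearI)
  fix p q :: "'a \<Rightarrow>\<^sub>0 complex" and c :: complex
  let ?A = "Poly_Mapping.keys p \<union> Poly_Mapping.keys q"
  have "Poly_Mapping.keys (p + q) \<subseteq> ?A"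
    by (rule Poly_Mapping.keys_add)
  then show "free_extend h (p + q) = free_extend h p + free_extend h q"
    by (simp add: free_extend_superset[of ?A] lookup_add scaleC_add_left sum.distrib)
  have "Poly_Mapping.keys (c *\<^sub>C p) \<subseteq> Poly_Mapping.keys p"
    by transfer auto
  then show "free_extend h (c *\<^sub>C p) = c *\<^sub>C free_extend h p"
    by (simp add: free_extend_superset[of "Poly_Mapping.keys p"] scaleC_poly_mapping.rep_eq
        complex_vector.scale_sum_right scaleC_scaleC scaleC_complex_def)
qed

lemma free_extend_single: "free_extend h (Poly_Mapping.single w 1) = h w"
  by (simp add: free_extend_def scaleC_one)

lemma free_extend_relations:
  assumes h: "word_multilinear h" and p: "p \<in> complex_span tensor_relations"
  shows "free_extend h p = 0"
proof -
  interpret L: Vector_Spaces.linear scaleC scaleC "free_extend h"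
    by (rule complex_linear_free_extend)
  have lin: "complex_linear (\<lambda>x. h (us @ Inl x # vs))" "complex_linear (\<lambda>y. h (us @ Inr y # vs))"
    for us vs using h by (auto simp: word_multilinear_def)
  have "free_extend h r = 0" if "r \<in> tensor_relations" for r
    using that
  proof cases
    case nonalternating
    then show ?thesis using h by (auto simp: word_multilinear_def free_extend_single)
  qed (auto simp: L.add L.diff L.scale free_extend_single
      complex_linear_add[OF lin(1)] complex_linear_add[OF lin(2)]
      complex_linear_scale[OF lin(1)] complex_linear_scale[OF lin(2)])
  then show ?thesis
    using L.eq_0_on_span[OF _ p] by blast
qed

lemma word_extend_abs:
  assumes "word_multilinear h"
  shows "word_extend h (abs_free_product p) = free_extend h p"
proof -
  interpret L: Vector_Spaces.linear scaleC scaleC "free_extend h"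
    by (rule complex_linear_free_extend)
  have "tensor_equiv (rep_free_product (abs_free_product p)) p"
    using Quotient_rep_abs[OF Quotient_free_product] by (simp add: tensor_equiv_def complex_vector.span_zero)
  then show ?thesis
    using free_extend_relations[OF assms, of "rep_free_product (abs_free_product p) - p"]
    by (simp add: tensor_equiv_def word_extend_def L.diff)
qed

lemma complex_linear_word_extend:
  assumes "word_multilinear h"
  shows "complex_linear (word_extend h)"
proof (rule complex_linearI)
  interpret L: Vector_Spaces.linear scaleC scaleC "free_extend h"
    by (rule complex_linear_free_extend)
  fix u v and c
  show "word_extend h (u + v) = word_extend h u + word_extend h v"
    by (induction u rule: free_product.abs_induct, induction v rule: free_product.abs_induct)
      (simp add: plus_free_product.abs_eq word_extend_abs[OF assms] L.add)
  show "word_extend h (c *\<^sub>C u) = c *\<^sub>C word_extend h u"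
    by (induction u rule: free_product.abs_induct)
      (simp add: scaleC_free_product.abs_eq word_extend_abs[OF assms] L.scale)
qed

lemma word_extend_tensor_word:
  assumes "word_multilinear h"
  shows "word_extend h (tensor_word w) = h w"
  by (simp add: tensor_word.abs_eq word_extend_abs[OF assms] free_extend_single)

text \<open>In the following definitions \<open>emb\<close> is \<open>Inl\<close> or \<open>Inr\<close> and selects one of the two spaces.
  \<open>left_V\<close> and \<open>right_W\<close> are the bilinear maps whose linearisations are the natural isomorphisms
  \<open>V\<close> and \<open>W\<close>; \<open>left_split\<close> and \<open>right_split\<close> are their inverses on elementary tensors,
  where \<open>(x, w)\<close> and \<open>(w, x)\<close> stand for the tensor of \<open>x\<close> with the class of \<open>w\<close>. For linear
  \<open>T\<close>, \<open>left_op emb T\<close> is \<open>V (T \<otimes> I) V^-1\<close> and \<open>right_op emb T\<close> is \<open>W (I \<otimes> T) W^-1\<close>.\<close>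

definition left_V ::
    "('z \<Rightarrow> 'x + 'y) \<Rightarrow> complex \<times> 'z \<Rightarrow>
     ('x::complex_vector, 'y::complex_vector) free_product \<Rightarrow> ('x, 'y) free_product" where
  "left_V emb x u = fst x *\<^sub>C u + word_extend (\<lambda>w. tensor_word (emb (snd x) # w)) u"

definition left_split :: "('z::zero \<Rightarrow> 'l) \<Rightarrow> 'l list \<Rightarrow> (complex \<times> 'z) \<times> 'l list" where
  "left_split emb w =
     (if w \<noteq> [] \<and> hd w \<in> range emb then ((0, inv emb (hd w)), tl w) else ((1, 0), w))"

definition left_op ::
    "('z::complex_vector \<Rightarrow> 'x + 'y) \<Rightarrow> (complex \<times> 'z \<Rightarrow> complex \<times> 'z) \<Rightarrow>
     ('x::complex_vector, 'y::complex_vector) free_product \<Rightarrow> ('x, 'y) free_product" where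
  "left_op emb T = word_extend (\<lambda>w. if alternating w
     then (case left_split emb w of (x, w') \<Rightarrow> left_V emb (T x) (tensor_word w')) else 0)"

definition right_W ::
    "('z \<Rightarrow> 'x + 'y) \<Rightarrow> ('x::complex_vector, 'y::complex_vector) free_product \<Rightarrow>
     complex \<times> 'z \<Rightarrow> ('x, 'y) free_product" where
  "right_W emb u x = fst x *\<^sub>C u + word_extend (\<lambda>w. tensor_word (w @ [emb (snd x)])) u"

definition right_split :: "('z::zero \<Rightarrow> 'l) \<Rightarrow> 'l list \<Rightarrow> 'l list \<times> (complex \<times> 'z)" where
  "right_split emb w =
     (if w \<noteq> [] \<and> last w \<in> range emb then (butlast w, (0, inv emb (last w))) else (w, (1, 0)))"

definition right_op ::
    "('z::complex_vector \<Rightarrow> 'x + 'y) \<Rightarrow> (complex \<times> 'z \<Rightarrow> complex \<times> 'z) \<Rightarrow>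
     ('x::complex_vector, 'y::complex_vector) free_product \<Rightarrow> ('x, 'y) free_product" where
  "right_op emb T = word_extend (\<lambda>w. if alternating w
     then (case right_split emb w of (w', x) \<Rightarrow> right_W emb (tensor_word w') (T x)) else 0)"

definition vacuum_state ::
    "(('x::complex_vector, 'y::complex_vector) free_product \<Rightarrow> ('x, 'y) free_product) \<Rightarrow> complex" where
  "vacuum_state T = word_extend (\<lambda>w. if w = [] then 1 else 0) (T (tensor_word []))"


section \<open>Bi-freeness\<close>

text \<open>The vector spaces whose existence bi-freeness asserts are parameters, since HOL cannot
  quantify over types. In a theorem that has \<open>bi_free TYPE('x) TYPE('y)\<close> as a hypothesis, the type
  variables are universally quantified outside, which is the existential in the hypothesis.\<close>

definition bi_free ::
    "'x::complex_vector itself \<Rightarrow> 'y::complex_vector itself \<Rightarrow>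
     ('a::cstar_algebra \<Rightarrow> complex) \<Rightarrow> 'a \<times> 'a \<Rightarrow> 'a \<times> 'a \<Rightarrow> bool" where
  "bi_free _ _ \<phi> p1 p2 \<longleftrightarrow>
     (\<exists>(T1 :: complex \<times> 'x \<Rightarrow> complex \<times> 'x) (S1 :: complex \<times> 'x \<Rightarrow> complex \<times> 'x)
       (T2 :: complex \<times> 'y \<Rightarrow> complex \<times> 'y) (S2 :: complex \<times> 'y \<Rightarrow> complex \<times> 'y).
       complex_linear T1 \<and> complex_linear S1 \<and> complex_linear T2 \<and> complex_linear S2 \<and>
       (\<forall>ks. set ks \<subseteq> {..<4} \<longrightarrow>
          \<phi> (prod_list (map ((!) [fst p1, fst p2, snd p1, snd p2]) ks)) =
          vacuum_state (foldr (\<circ>) (map ((!)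
            [left_op Inl T1, left_op Inr T2, right_op Inl S1, right_op Inr S2]) ks) id)))"

end

theory Submission
  imports Defs
begin

text \<open>Write \<open>g\<close>, \<open>h\<close> for the Cauchy transforms of \<open>a1 + a2\<close>, \<open>b1 + b2\<close> at \<open>z\<close>, \<open>w\<close>, and \<open>rj\<close>, \<open>sj\<close>
  for the centred elements \<open>(\<omega>aj z - aj)\<^sup>-\<^sup>1 / g - 1\<close>, \<open>(\<omega>bj w - bj)\<^sup>-\<^sup>1 / h - 1\<close>. Near infinity the resolvent
  of \<open>a1 + a2\<close> is \<open>g\<close> times the sum of all alternating words in \<open>r1\<close>, \<open>r2\<close>, by algebra alone, and
  similarly for \<open>b1 + b2\<close>. Bi-freeness pairs an alternating centred word in the \<open>a\<close>s with one in the
  \<open>b\<close>s letter by letter and gives zero unless the indices agree. Summing the resulting geometric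
  series relates \<open>cj = G\<^sub>\<eta>\<^sub>j(\<omega>aj z, \<omega>bj w) / (g h)\<close> to \<open>c = G(z, w) / (g h)\<close> by
  \<open>c (c1 + c2 - c1 c2) = c1 c2\<close>, which extends to the whole product of half-planes by analytic
  continuation. The inequality follows from this relation and the Cauchy-Schwarz bound for the
  covariance of the two resolvents, which controls \<open>\<bar>cj - 1\<bar>\<close>.\<close>

section \<open>Resolvents in C*-algebras\<close>

text \<open>The word expansion is algebraic because of the equation for the sum of the subordination
  functions: the inverses \<open>g (\<omega>aj z - aj)\<close> of \<open>1 + rj\<close> add up to
  \<open>g (z - (a1 + a2)) + 1\<close>. The letters pair one by one because on the vacuum the right
  operators build a word from left to right, and the left operators must then take it apart from the
  left. The relation between c, c1 and c2 is kept without denominators: away from infinity nothing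
  is known about the zeros of c1, c2 or c1 + c2 - c1 c2. For the inequality let Aj be the square
  root of Im \<omega>aj(z) Im \<omega>bj(w), and \<xi> that of Im z Im w. Since Im (1/g) = Im
  \<omega>a1(z) + Im \<omega>a2(z) - Im z, the variance of r1 is (Im \<omega>a2(z) - Im z) / Im
  \<omega>a1(z). The covariance bound thus becomes A1 |c1 - 1| \<le> A2 - \<xi>, and likewise with 1
  and 2 exchanged; the size of each cj - 1 is controlled by the weight of the other index, which is
  the form that the relation can exploit.\<close>

lemma bounded_linear_scaleC: "bounded_linear (\<lambda>x::'a::cstar_algebra. c *\<^sub>C x)"
  by (rule bounded_linear_intro[where K = "cmod c"])
    (simp_all add: scaleC_add_right scaleR_eq_scaleC norm_scaleC scaleC_scaleC mult.commute)

lemma bounded_linear_scaleC_left: "bounded_linear (\<lambda>c. c *\<^sub>C (x::'a::cstar_algebra))"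
  by (rule bounded_linear_intro[where K = "norm x"])
    (simp_all add: scaleC_add_left scaleR_eq_scaleC norm_scaleC scaleC_scaleC scaleR_conv_of_real)

lemma norm_star [simp]: "norm (star x) = norm (x :: 'a::cstar_algebra)"
proof -
  have le: "norm y \<le> norm (star y)" for y :: 'a
  proof (cases "y = 0")
    case False
    have "norm y * norm y \<le> norm (star y) * norm y"
      using cstar_identity[of y] norm_mult_ineq[of "star y" y] by (simp add: power2_eq_square)
    with False show ?thesis by simp
  qed simp
  from le[of x] le[of "star x"] show ?thesis by (simp add: star_star)
qed

lemma bounded_linear_star: "bounded_linear (star :: 'a::cstar_algebra \<Rightarrow> 'a)"
  by (rule bounded_linear_intro[where K = 1]) (simp_all add: star_add scaleR_eq_scaleC star_scaleC)

lemma star_diff: "star (x - y) = star x - star (y :: 'a::cstar_algebra)"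
  using bounded_linear.linear[OF bounded_linear_star] by (rule linear_diff)

lemma star_minus: "star (- x) = - star (x :: 'a::cstar_algebra)"
  using bounded_linear.linear[OF bounded_linear_star] by (rule linear_neg)

lemma star_one [simp]: "star (1 :: 'a::cstar_algebra) = 1"
  by (metis mult.left_neutral mult.right_neutral star_mult star_star)

lemma star_power: "star (x ^ n) = star x ^ n" for x :: "'a::cstar_algebra"
  by (induction n) (simp_all add: star_mult power_commutes)

lemma norm_mult_star: "norm (x * star x) = (norm x)\<^sup>2" for x :: "'a::cstar_algebra"
  using cstar_identity[of "star x"] by (simp add: star_star)

lemma scaleC_power: "(c *\<^sub>C x) ^ n = c ^ n *\<^sub>C x ^ n" for x :: "'a::cstar_algebra"
  by (induction n) (simp_all add: scaleC_one scaleC_mult_left scaleC_mult_right scaleC_scaleC)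

lemma alg_inverse_eqI:
  assumes "x * y = 1" "y * x = 1"
  shows "alg_inverse x = y"
  unfolding alg_inverse_def
proof (rule the_equality)
  show "y' = y" if "x * y' = 1 \<and> y' * x = 1" for y'
    by (metis assms(2) mult.assoc mult.left_neutral mult.right_neutral that)
qed (use assms in blast)

lemma geometric_sums_algebra:
  fixes x :: "'a::{real_normed_algebra_1, banach}"
  assumes "norm x < 1"
  obtains s where "(\<lambda>n. x ^ n) sums s" "(1 - x) * s = 1" "s * (1 - x) = 1"
proof -
  have "summable (\<lambda>n. x ^ n)"
    by (rule summable_comparison_test[where g = "\<lambda>n. norm x ^ n"])
      (use assms in \<open>auto simp: norm_power_ineq intro!: summable_geometric\<close>)
  then obtain s where s: "(\<lambda>n. x ^ n) sums s" by blast
  have "(\<lambda>n. x ^ Suc n) sums (s - 1)"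
    using s by (simp add: sums_Suc_iff[of "\<lambda>n. x ^ n"] del: power_Suc)
  moreover have "(\<lambda>n. x ^ Suc n) sums (x * s)"
    using sums_mult[OF s, of x] by simp
  moreover have "(\<lambda>n. x ^ Suc n) sums (s * x)"
    using sums_mult2[OF s, of x] by (simp only: power_Suc2)
  ultimately have "x * s = s - 1" "s * x = s - 1"
    by (metis sums_unique2)+
  then show thesis using that[OF s] by (simp add: algebra_simps)
qed

lemma neumann_series:
  fixes a :: "'a::cstar_algebra"
  assumes z: "norm a < cmod z"
  shows "(\<lambda>n. (1 / z ^ Suc n) *\<^sub>C a ^ n) sums resolvent a z"
    and "(z *\<^sub>C 1 - a) * resolvent a z = 1" "resolvent a z * (z *\<^sub>C 1 - a) = 1"
proof -
  have [simp]: "z \<noteq> 0" using z by auto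
  have "norm ((1 / z) *\<^sub>C a) < 1"
    using z by (simp add: norm_scaleC norm_divide field_simps)
  then obtain s where s: "(\<lambda>n. ((1 / z) *\<^sub>C a) ^ n) sums s"
    and inv: "(1 - (1 / z) *\<^sub>C a) * s = 1" "s * (1 - (1 / z) *\<^sub>C a) = 1"
    by (rule geometric_sums_algebra)
  have *: "z *\<^sub>C 1 - a = z *\<^sub>C (1 - (1 / z) *\<^sub>C a)"
    by (simp add: complex_vector.scale_right_diff_distrib scaleC_scaleC scaleC_one)
  have inv': "(z *\<^sub>C 1 - a) * ((1 / z) *\<^sub>C s) = 1" "((1 / z) *\<^sub>C s) * (z *\<^sub>C 1 - a) = 1"
    unfolding * by (simp_all only: scaleC_mult_left scaleC_mult_right inv scaleC_scaleC)
      (simp_all add: scaleC_one)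
  have eq: "resolvent a z = (1 / z) *\<^sub>C s"
    unfolding resolvent_def by (rule alg_inverse_eqI[OF inv'])
  show "(z *\<^sub>C 1 - a) * resolvent a z = 1" "resolvent a z * (z *\<^sub>C 1 - a) = 1"
    unfolding eq by (fact inv')+
  have "(\<lambda>n. (1 / z) *\<^sub>C ((1 / z) *\<^sub>C a) ^ n) sums ((1 / z) *\<^sub>C s)"
    by (rule bounded_linear.sums[OF bounded_linear_scaleC s])
  then show "(\<lambda>n. (1 / z ^ Suc n) *\<^sub>C a ^ n) sums resolvent a z"
    unfolding eq by (simp add: scaleC_power scaleC_scaleC power_divide)
qed

text \<open>A purely imaginary shift by \<open>t\<close> adds at most \<open>t\<^sup>2\<close> to \<open>\<parallel>a\<parallel>\<^sup>2\<close>, but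
  \<open>2 t Im z + t\<^sup>2\<close> or more to \<open>\<bar>z\<bar>\<^sup>2\<close>, so a suitable shift brings \<open>z\<close> into the domain of the
  Neumann series.\<close>

lemma resolvent_inverse:
  fixes a :: "'a::cstar_algebra"
  assumes a: "self_adjoint a" and z: "Im z \<noteq> 0"
  shows "(z *\<^sub>C 1 - a) * resolvent a z = 1" "resolvent a z * (z *\<^sub>C 1 - a) = 1"
proof -
  define t where "t = ((norm a)\<^sup>2 + 1) / Im z"
  define u where "u = \<i> * complex_of_real t"
  have "star (a + u *\<^sub>C 1) * (a + u *\<^sub>C 1) = a * a + (t\<^sup>2) *\<^sub>R 1"
    using a by (simp add: self_adjoint_def star_add star_scaleC algebra_simps scaleC_mult_left
        scaleC_mult_right scaleC_scaleC u_def scaleR_eq_scaleC power2_eq_square)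
  then have "(norm (a + u *\<^sub>C 1))\<^sup>2 \<le> (norm a)\<^sup>2 + t\<^sup>2"
    using cstar_identity[of "a + u *\<^sub>C 1"] norm_triangle_ineq[of "a * a" "(t\<^sup>2) *\<^sub>R 1"]
      norm_mult_ineq[of a a] by (simp add: power2_eq_square)
  also have "\<dots> < (norm a)\<^sup>2 + t\<^sup>2 + ((Re z)\<^sup>2 + (Im z)\<^sup>2 + (norm a)\<^sup>2 + 2)"
    using zero_le_power2[of "Re z"] zero_le_power2[of "Im z"] zero_le_power2[of "norm a"]
    by linarith
  also have "\<dots> = (Re z)\<^sup>2 + (Im z + t)\<^sup>2"
    using z by (simp add: t_def power2_sum)
  also have "\<dots> = (cmod (z + u))\<^sup>2"
    by (simp add: cmod_power2 u_def)
  finally have "norm (a + u *\<^sub>C 1) < cmod (z + u)"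
    by (rule power_less_imp_less_base) simp
  note shifted = neumann_series(2,3)[OF this]
  have "(z + u) *\<^sub>C 1 - (a + u *\<^sub>C 1) = z *\<^sub>C 1 - a"
    by (simp add: scaleC_add_left)
  then show "(z *\<^sub>C 1 - a) * resolvent a z = 1" "resolvent a z * (z *\<^sub>C 1 - a) = 1"
    using shifted unfolding resolvent_def by (simp_all only:)
qed

lemma resolvent_identity:
  fixes a :: "'a::cstar_algebra"
  assumes "self_adjoint a" "Im z \<noteq> 0" "Im w \<noteq> 0"
  shows "resolvent a z - resolvent a w = (w - z) *\<^sub>C (resolvent a z * resolvent a w)"
proof -
  have "resolvent a z - resolvent a w =
      resolvent a z * ((w *\<^sub>C 1 - a) - (z *\<^sub>C 1 - a)) * resolvent a w"
    using resolvent_inverse[OF assms(1,2)] resolvent_inverse[OF assms(1,3)]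
    by (simp add: algebra_simps flip: mult.assoc)
      (simp add: algebra_simps mult.assoc)
  also have "(w *\<^sub>C 1 - a) - (z *\<^sub>C 1 - a) = (w - z) *\<^sub>C 1"
    by (simp add: complex_vector.scale_left_diff_distrib)
  finally show ?thesis
    by (simp add: scaleC_mult_left scaleC_mult_right)
qed

lemma star_resolvent:
  fixes a :: "'a::cstar_algebra"
  assumes "self_adjoint a" "Im z \<noteq> 0"
  shows "star (resolvent a z) = resolvent a (cnj z)"
proof -
  have *: "star (z *\<^sub>C 1 - a) = cnj z *\<^sub>C 1 - a"
    using assms(1) by (simp add: star_diff star_scaleC self_adjoint_def)
  show ?thesis
    unfolding resolvent_def[of a "cnj z"]
    by (rule alg_inverse_eqI[symmetric])
      (simp_all add: * [symmetric] star_mult[symmetric] resolvent_inverse[OF assms])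
qed

text \<open>The resolvent identity at \<open>z\<close> and \<open>cnj z\<close> makes
  \<open>?R * star ?R\<close> a multiple of \<open>?R - star ?R\<close>. The C*-identity then bounds
  a square of the norm by the norm itself, without spectral theory.\<close>

lemma norm_resolvent_le:
  fixes a :: "'a::cstar_algebra"
  assumes "self_adjoint a" "Im z > 0"
  shows "norm (resolvent a z) \<le> 1 / Im z"
proof -
  let ?R = "resolvent a z"
  have "?R - star ?R = (cnj z - z) *\<^sub>C (?R * star ?R)"
    using assms by (simp add: star_resolvent resolvent_identity)
  then have "2 * Im z * (norm ?R)\<^sup>2 = norm (?R - star ?R)"
    using assms by (simp add: norm_scaleC norm_mult_star norm_minus_commute complex_diff_cnj norm_mult)
  also have "\<dots> \<le> 2 * norm ?R"
    using norm_triangle_ineq4[of ?R "star ?R"] by simp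
  finally have *: "norm ?R * (norm ?R * Im z) \<le> norm ?R * 1"
    by (simp add: power2_eq_square algebra_simps)
  show ?thesis
  proof (cases "norm ?R = 0")
    case False
    then have "norm ?R * Im z \<le> 1" using * by simp
    then show ?thesis using assms by (simp add: field_simps)
  qed (use assms in simp)
qed


section \<open>Positive functionals\<close>

locale cstar_state =
  fixes \<phi> :: "'a::cstar_algebra \<Rightarrow> complex"
  assumes state: "faithful_state \<phi>"
begin

lemma linear_state: "complex_linear \<phi>"
  and state_one [simp]: "\<phi> 1 = 1"
  and positive: "\<phi> (star x * x) \<in> \<real>\<^sub>\<ge>\<^sub>0"
  and faithful: "\<phi> (star x * x) = 0 \<Longrightarrow> x = 0"
  using state by (auto simp: faithful_state_def)

lemma state_add: "\<phi> (x + y) = \<phi> x + \<phi> y"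
  and state_scale: "\<phi> (c *\<^sub>C x) = c * \<phi> x"
  using linear_state by (simp_all add: complex_linear_add complex_linear_scale scaleC_complex_def)

lemma state_diff: "\<phi> (x - y) = \<phi> x - \<phi> y"
  using state_add[of "x - y" y] by simp

lemma state_zero [simp]: "\<phi> 0 = 0"
  using state_diff[of 0 0] by simp

lemma Re_positive: "Re (\<phi> (star x * x)) \<ge> 0" and Im_positive: "Im (\<phi> (star x * x)) = 0"
  using positive[of x] by (auto simp: complex_nonneg_Reals_iff)

lemma expand_square:
  "\<phi> (star (x + c *\<^sub>C y) * (x + c *\<^sub>C y)) =
    \<phi> (star x * x) + c * \<phi> (star x * y) + cnj c * \<phi> (star y * x)
      + complex_of_real ((cmod c)\<^sup>2) * \<phi> (star y * y)"
  unfolding complex_norm_square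
  by (simp add: star_add star_scaleC distrib_left distrib_right scaleC_mult_left scaleC_mult_right
      state_add state_scale algebra_simps)

text \<open>Polarisation: positivity makes the cross terms of \<open>expand_square\<close> real for
  every \<open>c\<close>; \<open>c = 1\<close> compares the imaginary parts and
  \<open>c = \<i>\<close> the real parts.\<close>

lemma star_swap: "\<phi> (star y * x) = cnj (\<phi> (star x * y))"
proof -
  have im: "Im (c * \<phi> (star x * y) + cnj c * \<phi> (star y * x)) = 0" for c
    using Im_positive[of "x + c *\<^sub>C y"] Im_positive[of x] Im_positive[of y]
    unfolding expand_square by simp
  show ?thesis
    using im[of 1] im[of \<i>] by (simp add: complex_eq_iff)
qed

lemma state_star: "\<phi> (star x) = cnj (\<phi> x)"
  using star_swap[of x 1] by simp

lemma Cauchy_Schwarz: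
  "(cmod (\<phi> (star x * y)))\<^sup>2 \<le> Re (\<phi> (star x * x)) * Re (\<phi> (star y * y))"
proof -
  let ?p = "\<phi> (star x * y)" and ?A = "Re (\<phi> (star x * x))" and ?B = "Re (\<phi> (star y * y))"
  have quad: "0 \<le> ?A - 2 * t * (cmod ?p)\<^sup>2 + t\<^sup>2 * (cmod ?p)\<^sup>2 * ?B" for t :: real
  proof -
    \<comment> \<open>The phase of \<open>c\<close> makes \<open>c * ?p\<close> real, which leaves a
      quadratic in the real \<open>t\<close>. Its minimiser is \<open>1 / ?B\<close>, the value
      inserted below.\<close>
    define c where "c = - (complex_of_real t * cnj ?p)"
    have "0 \<le> Re (\<phi> (star (x + c *\<^sub>C y) * (x + c *\<^sub>C y)))" by (rule Re_positive)
    also have "\<dots> = ?A + 2 * Re (c * ?p) + (cmod c)\<^sup>2 * ?B"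
      unfolding expand_square by (simp add: star_swap[of y x])
    also have "c * ?p = complex_of_real (- (t * (cmod ?p)\<^sup>2))"
      unfolding c_def of_real_minus of_real_mult complex_norm_square by simp
    also have "(cmod c)\<^sup>2 = t\<^sup>2 * (cmod ?p)\<^sup>2"
      by (simp add: c_def norm_mult power_mult_distrib)
    finally show ?thesis by simp
  qed
  show ?thesis
  proof (cases "?B = 0")
    case True
    have "y = 0" using faithful[of y] True Im_positive[of y] by (simp add: complex_eq_iff)
    then show ?thesis by simp
  next
    case False
    then have B: "?B > 0" using Re_positive[of y] by simp
    have "1 / ?B * ?B = 1" using B by simp
    then have "(1 / ?B)\<^sup>2 * (cmod ?p)\<^sup>2 * ?B = 1 / ?B * (cmod ?p)\<^sup>2"
      by (simp add: power2_eq_square)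
    then have "0 \<le> ?A - (cmod ?p)\<^sup>2 / ?B"
      using quad[of "1 / ?B"] by simp
    then show ?thesis using B by (simp add: field_simps)
  qed
qed

lemma covariance_bound:
  "(cmod (\<phi> (star x * y) - \<phi> (star x) * \<phi> y))\<^sup>2
    \<le> (Re (\<phi> (star x * x)) - (cmod (\<phi> x))\<^sup>2) * (Re (\<phi> (star y * y)) - (cmod (\<phi> y))\<^sup>2)"
proof -
  have cov: "\<phi> (star (u - \<phi> u *\<^sub>C 1) * (v - \<phi> v *\<^sub>C 1)) = \<phi> (star u * v) - \<phi> (star u) * \<phi> v"
    for u v
    by (simp add: star_diff star_scaleC algebra_simps scaleC_mult_left scaleC_mult_right
        state_diff state_scale state_add scaleC_scaleC state_star)
  have "\<phi> (star u) * \<phi> u = complex_of_real ((cmod (\<phi> u))\<^sup>2)" for u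
    unfolding complex_norm_square by (simp add: state_star)
  then have "Re (\<phi> (star u * u) - \<phi> (star u) * \<phi> u) = Re (\<phi> (star u * u)) - (cmod (\<phi> u))\<^sup>2" for u
    by simp
  then show ?thesis
    using Cauchy_Schwarz[of "x - \<phi> x *\<^sub>C 1" "y - \<phi> y *\<^sub>C 1"] by (simp only: cov)
qed

end

text \<open>The square root is the binomial series of \<open>(1 - y)\<^sup>1\<^sup>/\<^sup>2\<close>. It makes positive functionals
  bounded.\<close>

lemma self_adjoint_sqrt:
  fixes y :: "'a::cstar_algebra"
  assumes "self_adjoint y" "norm y < 1"
  obtains s where "star s * s = 1 - y"
proof -
  define q where "q n = ((1/2 :: real) gchoose n) * (-1) ^ n" for n
  define f where "f n = q n *\<^sub>R y ^ n" for n
  have nf: "summable (\<lambda>n. norm (f n))"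
  proof (rule summable_comparison_test')
    show "summable (\<lambda>n. norm (((1/2 :: real) gchoose n) * norm y ^ n))"
      using assms(2) by (intro abs_summable_in_conv_radius) (auto simp: conv_radius_gchoose)
    show "norm (norm (f n)) \<le> norm (((1/2 :: real) gchoose n) * norm y ^ n)" if "n \<ge> 0" for n
      by (simp add: f_def q_def abs_mult norm_power_ineq mult_left_mono)
  qed
  define s where "s = suminf f"
  have "star (f n) = f n" for n
    using assms(1) by (simp add: f_def scaleR_eq_scaleC star_scaleC star_power self_adjoint_def)
  then have "star s = s"
    unfolding s_def using bounded_linear.suminf[OF bounded_linear_star summable_norm_cancel[OF nf]] by simp
  moreover have "(\<lambda>k. \<Sum>i\<le>k. f i * f (k - i)) sums (s * s)"
    unfolding s_def by (rule Cauchy_product_sums[OF nf nf])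
  moreover have "(\<Sum>i\<le>k. f i * f (k - i)) = (if k = 0 then 1 else if k = 1 then - y else 0)" for k
  proof -
    have "f i * f (k - i) = ((\<lambda>i. (1/2 gchoose i) * (1/2 gchoose (k - i)) * (-1) ^ k) i) *\<^sub>R y ^ k"
      if "i \<le> k" for i
      using that by (simp add: f_def q_def mult_ac flip: power_add)
    then have "(\<Sum>i\<le>k. f i * f (k - i)) =
        ((\<Sum>i\<in>{0..k}. (1/2 gchoose i) * (1/2 gchoose (k - i))) * (-1) ^ k) *\<^sub>R y ^ k"
      by (simp add: scaleR_sum_left sum_distrib_right atMost_atLeast0)
    also have "(\<Sum>i\<in>{0..k}. (1/2 gchoose i) * (1/2 gchoose (k - i))) = (real 1 gchoose k)"
      by (subst gbinomial_Vandermonde) simp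
    also have "real 1 gchoose k = (if k \<le> 1 then 1 else 0)"
      unfolding binomial_gbinomial[symmetric] by (cases k) auto
    finally show ?thesis by (auto simp: le_Suc_eq)
  qed
  moreover have "(\<lambda>k. if k = 0 then 1 else if k = 1 then - y else 0) sums (1 - y)"
    using sums_finite[of "{0, 1::nat}" "\<lambda>k. if k = 0 then 1 else if k = 1 then - y else 0"] by simp
  ultimately have "star s * s = 1 - y"
    by (simp only: sums_unique2)
  then show thesis by (rule that)
qed

context cstar_state
begin

text \<open>For self-adjoint \<open>u\<close> of norm below \<open>r\<close> the element 1 - u/r has
  the form \<open>star s * s\<close>, so positivity bounds \<open>Re (\<phi> u)\<close> by
  \<open>r\<close>. Cauchy-Schwarz against 1 reduces a general \<open>x\<close> to
  \<open>star x * x\<close>.\<close>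

lemma norm_le: "cmod (\<phi> x) \<le> norm x"
proof -
  have bound: "\<bar>Re (\<phi> y)\<bar> \<le> r" if y: "self_adjoint y" "norm y < r" for y r
  proof -
    have r: "r > 0" using that(2) norm_ge_zero[of y] by linarith
    have "Re (\<phi> u) \<le> r" if u: "self_adjoint u" "norm u < r" for u
    proof -
      have "self_adjoint ((1 / complex_of_real r) *\<^sub>C u)" "norm ((1 / complex_of_real r) *\<^sub>C u) < 1"
        using u r by (simp_all add: self_adjoint_def star_scaleC norm_scaleC norm_divide)
      then obtain s where "star s * s = 1 - (1 / complex_of_real r) *\<^sub>C u"
        by (rule self_adjoint_sqrt)
      then have "Re (\<phi> (1 - (1 / complex_of_real r) *\<^sub>C u)) \<ge> 0" by (metis Re_positive)
      then show ?thesis using r by (simp add: state_diff state_scale field_simps)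
    qed
    from this[of y] this[of "- y"] y show ?thesis
      using state_diff[of 0 y] by (simp add: self_adjoint_def star_minus abs_le_iff)
  qed
  \<comment> \<open>\<open>bound\<close> asks for a strict inequality, since the square root exists
    only for norms below 1; hence the passage to the limit in \<open>r\<close>.\<close>
  have "Re (\<phi> (star x * x)) \<le> (norm x)\<^sup>2"
  proof (rule dense_ge)
    show "Re (\<phi> (star x * x)) \<le> r" if "(norm x)\<^sup>2 < r" for r
      using bound[of "star x * x" r] that
      by (simp add: self_adjoint_def star_mult star_star cstar_identity)
  qed
  moreover have "(cmod (\<phi> x))\<^sup>2 \<le> Re (\<phi> (star x * x))"
    using Cauchy_Schwarz[of 1 x] by simp
  ultimately have "(cmod (\<phi> x))\<^sup>2 \<le> (norm x)\<^sup>2" by linarith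
  then show ?thesis by (rule power2_le_imp_le) simp
qed

lemma bounded_linear_state: "bounded_linear \<phi>"
  by (rule bounded_linear_intro[where K = 1])
    (simp_all add: state_add scaleR_eq_scaleC state_scale norm_le scaleR_conv_of_real)

end


section \<open>Operators on the free product\<close>

lemma alternating_iff: "alternating w \<longleftrightarrow> successively (\<noteq>) (map isl w)"
  by (simp add: alternating_def successively_map)

lemma alternating_Cons:
  "alternating (l # w) \<longleftrightarrow> alternating w \<and> (w = [] \<or> isl (hd w) \<noteq> isl l)"
  by (cases w) (auto simp: alternating_def)

lemma alternating_rev [simp]: "alternating (rev w) \<longleftrightarrow> alternating w"
  unfolding alternating_iff rev_map[symmetric] successively_rev
  by (rule successively_cong) auto

lemma alternating_snoc:
  "alternating (w @ [l]) \<longleftrightarrow> alternating w \<and> (w = [] \<or> isl (last w) \<noteq> isl l)"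
  using alternating_Cons[of l "rev w"] alternating_rev[of w] alternating_rev[of "w @ [l]"]
  by (simp add: hd_rev)

section \<open>Linear maps and their determination on words\<close>

lemma complex_linear_compose:
  "complex_linear f \<Longrightarrow> complex_linear g \<Longrightarrow> complex_linear (\<lambda>x. f (g x))"
  by (rule complex_linearI) (simp_all add: complex_linear_add complex_linear_scale)

lemma complex_linear_plus:
  "complex_linear f \<Longrightarrow> complex_linear g \<Longrightarrow> complex_linear (\<lambda>x. f x + g x)"
  by (rule complex_linearI) (simp_all add: complex_linear_add complex_linear_scale scaleC_add_right)

lemma complex_linear_scaled: "complex_linear f \<Longrightarrow> complex_linear (\<lambda>x. c *\<^sub>C f x)"
  by (rule complex_linearI)
    (simp_all add: complex_linear_add complex_linear_scale scaleC_add_right scaleC_scaleC mult.commute)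

lemma complex_linear_minus:
  "complex_linear f \<Longrightarrow> complex_linear g \<Longrightarrow> complex_linear (\<lambda>x. f x - g x)"
  by (rule complex_linearI)
    (simp_all add: complex_linear_add complex_linear_scale complex_vector.scale_right_diff_distrib)

lemma complex_linear_functional_scaled:
  "complex_linear f \<Longrightarrow> complex_linear (\<lambda>x. f x *\<^sub>C v)" for f :: "'a::complex_vector \<Rightarrow> complex"
  by (rule complex_linearI)
    (simp_all add: complex_linear_add complex_linear_scale scaleC_add_left scaleC_scaleC scaleC_complex_def)

lemma complex_linear_ident: "complex_linear (\<lambda>x. x)"
  and complex_linear_const_zero: "complex_linear (\<lambda>x. 0)"
  and complex_linear_fst: "complex_linear fst"
  and complex_linear_snd: "complex_linear snd"
  and complex_linear_Pair_zero: "complex_linear (\<lambda>x. (0, x))"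
  by (rule complex_linearI; simp add: scaleC_prod_def)+

lemma complex_linear_zero: "complex_linear f \<Longrightarrow> f 0 = 0"
  using complex_linear_scale[of f 0 0] by simp

lemma complex_linear_diff: "complex_linear f \<Longrightarrow> f (x - y) = f x - f y"
  using complex_linear_add[of f "x - y" y] by simp

lemma complex_linear_funpow: "complex_linear T \<Longrightarrow> complex_linear (T ^^ n)"
  for T :: "'z::complex_vector \<Rightarrow> 'z"
  by (induction n) (simp_all add: funpow.simps id_def o_def complex_linear_ident complex_linear_compose)

text \<open>Words span the free product. The hypothesis \<open>zero\<close> is discharged by
  \<open>tensor_word_nonalternating\<close> at each use.\<close>

lemma complex_linear_eq_on_words:
  fixes f g :: "('x::complex_vector, 'y::complex_vector) free_product \<Rightarrow> 'v::complex_vector"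
  assumes "complex_linear f" "complex_linear g" and eq: "\<And>w. alternating w \<Longrightarrow> f (tensor_word w) = g (tensor_word w)"
    and zero: "\<And>w :: ('x + 'y) list. \<not> alternating w \<Longrightarrow> tensor_word w = 0"
  shows "f = g"
proof
  fix u :: "('x, 'y) free_product"
  interpret D: Vector_Spaces.linear scaleC scaleC "\<lambda>u. f u - g u"
    by (rule complex_linear_minus[OF assms(1,2)])
  have "f (tensor_word w) - g (tensor_word w) = 0" for w
    using eq[of w] zero[of w] assms(1,2)
    by (cases "alternating w") (simp_all add: complex_linear_zero)
  moreover have "u \<in> complex_span (range tensor_word)" by (simp add: tensor_word_span)
  ultimately have "f u - g u = 0"
    using D.eq_0_on_span[of "range tensor_word" u] by blast
  then show "f u = g u" by simp
qed

section \<open>Multilinear functions of words\<close>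

lemma tensor_word_nonalternating: "\<not> alternating w \<Longrightarrow> tensor_word w = 0"
  by transfer (auto simp: tensor_equiv_def intro: complex_vector.span_base tensor_relations.nonalternating)

lemma word_multilinear_tensor_word: "word_multilinear tensor_word"
  unfolding word_multilinear_def
proof (intro conjI allI impI)
  show "complex_linear (\<lambda>x. tensor_word (us @ Inl x # vs))" for us vs :: "('a + 'b) list"
  proof (rule complex_linearI)
    show "tensor_word (us @ Inl (x + y) # vs) = tensor_word (us @ Inl x # vs) + tensor_word (us @ Inl y # vs)" for x y
      by transfer (simp add: tensor_equiv_def complex_vector.span_base tensor_relations.add_Inl)
    show "tensor_word (us @ Inl (c *\<^sub>C x) # vs) = c *\<^sub>C tensor_word (us @ Inl x # vs)" for c x
      by transfer (simp add: tensor_equiv_def complex_vector.span_base tensor_relations.scale_Inl)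
  qed
  show "complex_linear (\<lambda>x. tensor_word (us @ Inr x # vs))" for us vs :: "('a + 'b) list"
  proof (rule complex_linearI)
    show "tensor_word (us @ Inr (x + y) # vs) = tensor_word (us @ Inr x # vs) + tensor_word (us @ Inr y # vs)" for x y
      by transfer (simp add: tensor_equiv_def complex_vector.span_base tensor_relations.add_Inr)
    show "tensor_word (us @ Inr (c *\<^sub>C x) # vs) = c *\<^sub>C tensor_word (us @ Inr x # vs)" for c x
      by transfer (simp add: tensor_equiv_def complex_vector.span_base tensor_relations.scale_Inr)
  qed
qed (rule tensor_word_nonalternating)

lemma word_multilinear_Inl: "word_multilinear h \<Longrightarrow> complex_linear (\<lambda>x. h (us @ Inl x # vs))"
  and word_multilinear_Inr: "word_multilinear h \<Longrightarrow> complex_linear (\<lambda>y. h (us @ Inr y # vs))"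
  and word_multilinear_nonalternating: "word_multilinear h \<Longrightarrow> \<not> alternating w \<Longrightarrow> h w = 0"
  by (auto simp: word_multilinear_def)

lemma word_multilinear_Cons:
  assumes "word_multilinear h"
  shows "word_multilinear (\<lambda>w. h (l # w))"
  unfolding word_multilinear_def
  using word_multilinear_Inl[OF assms, of "l # us" for us] word_multilinear_Inr[OF assms, of "l # us" for us]
    word_multilinear_nonalternating[OF assms] by (auto simp: alternating_Cons)

lemma word_multilinear_rev:
  assumes "word_multilinear h"
  shows "word_multilinear (\<lambda>w. h (rev w))"
  unfolding word_multilinear_def
  using word_multilinear_Inl[OF assms] word_multilinear_Inr[OF assms]
    word_multilinear_nonalternating[OF assms] by auto

lemma word_multilinear_snoc:
  assumes "word_multilinear h"
  shows "word_multilinear (\<lambda>w. h (w @ [l]))"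
  using word_multilinear_rev[OF word_multilinear_Cons[OF word_multilinear_rev[OF assms], of l]] by simp

lemma word_multilinear_plus:
  "word_multilinear h \<Longrightarrow> word_multilinear k \<Longrightarrow> word_multilinear (\<lambda>w. c *\<^sub>C h w + k w)"
  by (simp add: word_multilinear_def complex_linear_plus[OF complex_linear_scaled])

text \<open>A common test of well-definedness: the function behind \<open>left_op\<close>, and after
  reversal of words also the one behind \<open>right_op\<close>, is a distinction on the first
  letter.\<close>

lemma word_multilinear_case:
  assumes hl: "\<And>x. word_multilinear (hl x)" "\<And>w. complex_linear (\<lambda>x. hl x w)"
    and hr: "\<And>y. word_multilinear (hr y)" "\<And>w. complex_linear (\<lambda>y. hr y w)"
  shows "word_multilinear (\<lambda>w. if alternating w then (case w of [] \<Rightarrow> c | Inl x # w' \<Rightarrow> hl x w' | Inr y # w' \<Rightarrow> hr y w') else 0)"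
    (is "word_multilinear ?h")
  unfolding word_multilinear_def
proof (intro conjI allI impI)
  have lin_if: "complex_linear (\<lambda>x. if b then f x else 0)" if "complex_linear f"
    for b and f :: "'z::complex_vector \<Rightarrow> 'c"
    using that by (cases b) (simp_all add: complex_linear_const_zero)
  fix us vs :: "('a + 'b) list"
  \<comment> \<open>Alternation depends on the sides of the letters and not on their contents, so
    the guard is constant along each slot.\<close>
  obtain bl br where alt: "alternating (us @ Inl x # vs) = bl" "alternating (us @ Inr y # vs) = br" for x y
    by (simp add: alternating_iff)
  show "complex_linear (\<lambda>x. ?h (us @ Inl x # vs))"
    unfolding alt(1)
  proof (rule lin_if, cases us)
    case (Cons l us')
    then show "complex_linear (\<lambda>x. case us @ Inl x # vs of [] \<Rightarrow> c | Inl x # w' \<Rightarrow> hl x w' | Inr y # w' \<Rightarrow> hr y w')"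
      using word_multilinear_Inl[OF hl(1)] word_multilinear_Inl[OF hr(1)] by (cases l) simp_all
  qed (simp add: hl)
  show "complex_linear (\<lambda>y. ?h (us @ Inr y # vs))"
    unfolding alt(2)
  proof (rule lin_if, cases us)
    case (Cons l us')
    then show "complex_linear (\<lambda>y. case us @ Inr y # vs of [] \<Rightarrow> c | Inl x # w' \<Rightarrow> hl x w' | Inr y # w' \<Rightarrow> hr y w')"
      using word_multilinear_Inr[OF hl(1)] word_multilinear_Inr[OF hr(1)] by (cases l) simp_all
  qed (simp add: hr)
qed simp

section \<open>Insertion at the two ends of a word and the operators it defines\<close>

lemma left_V_tensor_word: "left_V emb x (tensor_word w) = fst x *\<^sub>C tensor_word w + tensor_word (emb (snd x) # w)"
  unfolding left_V_def
  by (simp add: word_extend_tensor_word word_multilinear_Cons word_multilinear_tensor_word)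

lemma right_W_tensor_word: "right_W emb (tensor_word w) x = fst x *\<^sub>C tensor_word w + tensor_word (w @ [emb (snd x)])"
  unfolding right_W_def
  by (simp add: word_extend_tensor_word word_multilinear_snoc word_multilinear_tensor_word)

lemma word_multilinear_left_V: "word_multilinear (\<lambda>w. left_V emb x (tensor_word w))"
  unfolding left_V_tensor_word
  by (intro word_multilinear_plus word_multilinear_Cons word_multilinear_tensor_word)

lemma word_multilinear_right_W: "word_multilinear (\<lambda>w. right_W emb (tensor_word w) x)"
  unfolding right_W_tensor_word
  by (intro word_multilinear_plus word_multilinear_snoc word_multilinear_tensor_word)

text \<open>Linearity of the letter slot is a hypothesis here because the lemma serves to verify the
  assumptions of \<open>free_factor\<close> for \<open>Inl\<close> and \<open>Inr\<close>.\<close>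

lemma linear_left_V_generic:
  fixes T :: "complex \<times> 'z::complex_vector \<Rightarrow> complex \<times> 'z"
  assumes "complex_linear T" "\<And>us vs. complex_linear (\<lambda>x. tensor_word (us @ emb x # vs))"
  shows "complex_linear (\<lambda>x. left_V emb (T (0, x)) (tensor_word w))"
proof -
  note T0 = complex_linear_compose[OF assms(1) complex_linear_Pair_zero]
  show ?thesis
    unfolding left_V_tensor_word
    using complex_linear_plus[OF
        complex_linear_functional_scaled[OF complex_linear_compose[OF complex_linear_fst T0]]
        complex_linear_compose[OF assms(2)[of "[]"] complex_linear_compose[OF complex_linear_snd T0]]]
    by simp
qed

lemma linear_right_W_generic:
  fixes T :: "complex \<times> 'z::complex_vector \<Rightarrow> complex \<times> 'z"
  assumes "complex_linear T" "\<And>us vs. complex_linear (\<lambda>x. tensor_word (us @ emb x # vs))"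
  shows "complex_linear (\<lambda>x. right_W emb (tensor_word w) (T (0, x)))"
proof -
  note T0 = complex_linear_compose[OF assms(1) complex_linear_Pair_zero]
  show ?thesis
    unfolding right_W_tensor_word
    using complex_linear_plus[OF
        complex_linear_functional_scaled[OF complex_linear_compose[OF complex_linear_fst T0]]
        complex_linear_compose[OF assms(2)[of _ "[]"] complex_linear_compose[OF complex_linear_snd T0]]]
    by simp
qed

text \<open>What is needed of the two embeddings of letters, in a form that covers \<open>Inl\<close> (with
  \<open>side = True\<close>) and \<open>Inr\<close> (with \<open>side = False\<close>), whose domains have different types.\<close>

locale free_factor =
  fixes emb :: "'z::complex_vector \<Rightarrow> 'x::complex_vector + 'y::complex_vector" and side :: bool
  assumes range_emb: "l \<in> range emb \<longleftrightarrow> isl l = side"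
    and inj_emb: "inj emb"
    and linear_letter: "complex_linear (\<lambda>x. tensor_word (us @ emb x # vs))"
    and word_multilinear_left: "complex_linear T \<Longrightarrow> word_multilinear (\<lambda>w. if alternating w
      then (case left_split emb w of (x, w') \<Rightarrow> left_V emb (T x) (tensor_word w')) else 0)"
    and word_multilinear_right: "complex_linear T \<Longrightarrow> word_multilinear (\<lambda>w. if alternating w
      then (case right_split emb w of (w', x) \<Rightarrow> right_W emb (tensor_word w') (T x)) else 0)"
begin

lemma isl_emb [simp]: "isl (emb x) = side"
  using range_emb by auto

lemma inv_emb [simp]: "inv emb (emb x) = x"
  by (rule inv_f_f[OF inj_emb])

lemma linear_left_op: "complex_linear T \<Longrightarrow> complex_linear (left_op emb T)"
  unfolding left_op_def by (intro complex_linear_word_extend word_multilinear_left)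

lemma linear_right_op: "complex_linear T \<Longrightarrow> complex_linear (right_op emb T)"
  unfolding right_op_def by (intro complex_linear_word_extend word_multilinear_right)

lemma linear_left_V: "complex_linear (\<lambda>x. left_V emb x (tensor_word w))"
  unfolding left_V_tensor_word
  using complex_linear_plus[OF complex_linear_functional_scaled[OF complex_linear_fst]
      complex_linear_compose[OF linear_letter[of "[]"] complex_linear_snd]] by simp

lemma linear_right_W: "complex_linear (\<lambda>x. right_W emb (tensor_word w) x)"
  unfolding right_W_tensor_word
  using complex_linear_plus[OF complex_linear_functional_scaled[OF complex_linear_fst]
      complex_linear_compose[OF linear_letter[of _ "[]"] complex_linear_snd]] by simp

lemma left_op_tensor_word:
  assumes "complex_linear T" "alternating w"
  shows "left_op emb T (tensor_word w) = (case left_split emb w of (x, w') \<Rightarrow> left_V emb (T x) (tensor_word w'))"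
  unfolding left_op_def using assms by (simp add: word_extend_tensor_word word_multilinear_left)

lemma right_op_tensor_word:
  assumes "complex_linear T" "alternating w"
  shows "right_op emb T (tensor_word w) = (case right_split emb w of (w', x) \<Rightarrow> right_W emb (tensor_word w') (T x))"
  unfolding right_op_def using assms by (simp add: word_extend_tensor_word word_multilinear_right)

lemma pair_eq_scaleC_plus: "x = fst x *\<^sub>C (1, 0) + (0, snd x)" for x :: "complex \<times> 'z"
  by (simp add: scaleC_prod_def scaleC_complex_def prod_eq_iff)

text \<open>The defining relation of \<open>V (T \<otimes> I) V^-1\<close>. The condition on
  \<open>w\<close> places its class in the summand on which V is defined; there
  \<open>left_split\<close> undoes \<open>left_V\<close> at \<open>(1, 0)\<close> and at
  \<open>(0, snd x)\<close>, and linearity in \<open>x\<close> does the rest.\<close>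

lemma left_op_left_V:
  assumes T: "complex_linear T" and w: "alternating w" "w = [] \<or> isl (hd w) \<noteq> side"
  shows "left_op emb T (left_V emb x (tensor_word w)) = left_V emb (T x) (tensor_word w)"
proof -
  have *: "alternating (emb (snd x) # w)" using w by (auto simp: alternating_Cons)
  have w': "w = [] \<or> hd w \<notin> range emb" using w(2) range_emb by blast
  have "left_op emb T (left_V emb x (tensor_word w)) =
      fst x *\<^sub>C left_V emb (T (1, 0)) (tensor_word w) + left_V emb (T (0, snd x)) (tensor_word w)"
    using w w' * by (auto simp: left_V_tensor_word[of emb x] complex_linear_add[OF linear_left_op[OF T]]
        complex_linear_scale[OF linear_left_op[OF T]] left_op_tensor_word[OF T] left_split_def)
  also have "\<dots> = left_V emb (fst x *\<^sub>C T (1, 0) + T (0, snd x)) (tensor_word w)"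
    by (simp add: complex_linear_add[OF linear_left_V] complex_linear_scale[OF linear_left_V])
  also have "fst x *\<^sub>C T (1, 0) + T (0, snd x) = T x"
    by (metis T complex_linear_add complex_linear_scale pair_eq_scaleC_plus)
  finally show ?thesis .
qed

lemma right_op_right_W:
  assumes T: "complex_linear T" and w: "alternating w" "w = [] \<or> isl (last w) \<noteq> side"
  shows "right_op emb T (right_W emb (tensor_word w) x) = right_W emb (tensor_word w) (T x)"
proof -
  have *: "alternating (w @ [emb (snd x)])" using w by (auto simp: alternating_snoc)
  have w': "w = [] \<or> last w \<notin> range emb" using w(2) range_emb by blast
  have "right_op emb T (right_W emb (tensor_word w) x) =
      fst x *\<^sub>C right_W emb (tensor_word w) (T (1, 0)) + right_W emb (tensor_word w) (T (0, snd x))"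
    using w w' * by (auto simp: right_W_tensor_word[of emb _ x] complex_linear_add[OF linear_right_op[OF T]]
        complex_linear_scale[OF linear_right_op[OF T]] right_op_tensor_word[OF T] right_split_def)
  also have "\<dots> = right_W emb (tensor_word w) (fst x *\<^sub>C T (1, 0) + T (0, snd x))"
    by (simp add: complex_linear_add[OF linear_right_W] complex_linear_scale[OF linear_right_W])
  also have "fst x *\<^sub>C T (1, 0) + T (0, snd x) = T x"
    by (metis T complex_linear_add complex_linear_scale pair_eq_scaleC_plus)
  finally show ?thesis .
qed

lemma left_V_1_0: "left_V emb (1, 0) (tensor_word w) = tensor_word w"
  using complex_linear_zero[OF linear_letter[of "[]" w]] by (simp add: left_V_tensor_word scaleC_one)

lemma right_W_1_0: "right_W emb (tensor_word w) (1, 0) = tensor_word w"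
  using complex_linear_zero[OF linear_letter[of w "[]"]] by (simp add: right_W_tensor_word scaleC_one)

text \<open>Surjectivity of V on words: a word from the other side, or the empty one, is paired with
  the state vector, any other word loses its first letter.\<close>

lemma left_factor:
  assumes "alternating w"
  obtains x w' where "tensor_word w = left_V emb x (tensor_word w')" "alternating w'" "w' = [] \<or> isl (hd w') \<noteq> side"
proof (cases "w = [] \<or> isl (hd w) \<noteq> side")
  case True
  then show ?thesis using that[of "(1, 0)" w] assms left_V_1_0 by metis
next
  case False
  then obtain z w' where "w = emb z # w'"
    using range_emb[of "hd w"] by (metis list.collapse rangeE)
  then show ?thesis
    using that[of "(0, z)" w'] assms by (auto simp: left_V_tensor_word alternating_Cons)
qed

lemma right_factor:
  assumes "alternating w"
  obtains x w' where "tensor_word w = right_W emb (tensor_word w') x" "alternating w'" "w' = [] \<or> isl (last w') \<noteq> side"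
proof (cases "w = [] \<or> isl (last w) \<noteq> side")
  case True
  then show ?thesis using that[of w "(1, 0)"] assms right_W_1_0 by metis
next
  case False
  then obtain z w' where "w = w' @ [emb z]"
    using range_emb[of "last w"] by (metis append_butlast_last_id rangeE)
  then show ?thesis
    using that[of w' "(0, z)"] assms by (auto simp: right_W_tensor_word alternating_snoc)
qed

text \<open>A centred operator is a pure creation operator on such words, because the scalar part of
  \<open>P (1, 0)\<close> would be the only other contribution.\<close>

lemma left_op_fresh:
  assumes "complex_linear P" "fst (P (1, 0)) = 0" "alternating w" "w = [] \<or> isl (hd w) \<noteq> side"
  shows "left_op emb P (tensor_word w) = tensor_word (emb (snd (P (1, 0))) # w)"
  using left_op_left_V[OF assms(1,3,4), of "(1, 0)"] assms(2) by (simp add: left_V_1_0 left_V_tensor_word[of _ "P _"])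

lemma right_op_fresh:
  assumes "complex_linear P" "fst (P (1, 0)) = 0" "alternating w" "w = [] \<or> isl (last w) \<noteq> side"
  shows "right_op emb P (tensor_word w) = tensor_word (w @ [emb (snd (P (1, 0)))])"
  using right_op_right_W[OF assms(1,3,4), of "(1, 0)"] assms(2) by (simp add: right_W_1_0 right_W_tensor_word[of _ _ "P _"])

lemma left_op_same_side:
  assumes "complex_linear P" "alternating (emb z # w)"
  shows "left_op emb P (tensor_word (emb z # w)) =
    fst (P (0, z)) *\<^sub>C tensor_word w + tensor_word (emb (snd (P (0, z))) # w)"
  using left_op_left_V[of P w "(0, z)"] assms
  by (simp add: left_V_tensor_word alternating_Cons)

text \<open>The intertwining relation with V determines \<open>left_op\<close>, so compatibility
  with powers and scalar shifts follows without unfolding the definition.\<close>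

lemma left_op_eqI:
  assumes "complex_linear T" "complex_linear f"
    and "\<And>x w. alternating w \<Longrightarrow> w = [] \<or> isl (hd w) \<noteq> side \<Longrightarrow>
      f (left_V emb x (tensor_word w)) = left_V emb (T x) (tensor_word w)"
  shows "left_op emb T = f"
  by (rule complex_linear_eq_on_words[OF linear_left_op[OF assms(1)] assms(2) _ tensor_word_nonalternating])
    (metis assms left_factor left_op_left_V)

lemma right_op_eqI:
  assumes "complex_linear T" "complex_linear f"
    and "\<And>x w. alternating w \<Longrightarrow> w = [] \<or> isl (last w) \<noteq> side \<Longrightarrow>
      f (right_W emb (tensor_word w) x) = right_W emb (tensor_word w) (T x)"
  shows "right_op emb T = f"
  by (rule complex_linear_eq_on_words[OF linear_right_op[OF assms(1)] assms(2) _ tensor_word_nonalternating])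
    (metis assms right_factor right_op_right_W)

lemma left_op_funpow:
  assumes "complex_linear T"
  shows "left_op emb (T ^^ n) = left_op emb T ^^ n"
proof (rule left_op_eqI)
  show "(left_op emb T ^^ n) (left_V emb x (tensor_word w)) = left_V emb ((T ^^ n) x) (tensor_word w)"
    if "alternating w" "w = [] \<or> isl (hd w) \<noteq> side" for x w
    using that by (induction n) (simp_all add: left_op_left_V assms)
qed (intro complex_linear_funpow linear_left_op assms)+

lemma right_op_funpow:
  assumes "complex_linear T"
  shows "right_op emb (T ^^ n) = right_op emb T ^^ n"
proof (rule right_op_eqI)
  show "(right_op emb T ^^ n) (right_W emb (tensor_word w) x) = right_W emb (tensor_word w) ((T ^^ n) x)"
    if "alternating w" "w = [] \<or> isl (last w) \<noteq> side" for x w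
    using that by (induction n) (simp_all add: right_op_right_W assms)
qed (intro complex_linear_funpow linear_right_op assms)+

lemma left_op_shift:
  assumes "complex_linear T"
  shows "left_op emb (\<lambda>v. T v - c *\<^sub>C v) = (\<lambda>u. left_op emb T u - c *\<^sub>C u)"
proof (rule left_op_eqI)
  show "left_op emb T (left_V emb x (tensor_word w)) - c *\<^sub>C left_V emb x (tensor_word w) =
      left_V emb (T x - c *\<^sub>C x) (tensor_word w)"
    if "alternating w" "w = [] \<or> isl (hd w) \<noteq> side" for x w
    using that by (simp add: left_op_left_V assms complex_linear_diff[OF linear_left_V]
        complex_linear_scale[OF linear_left_V])
qed (intro complex_linear_minus complex_linear_scaled complex_linear_ident linear_left_op assms)+

lemma right_op_shift:
  assumes "complex_linear T"
  shows "right_op emb (\<lambda>v. T v - c *\<^sub>C v) = (\<lambda>u. right_op emb T u - c *\<^sub>C u)"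
proof (rule right_op_eqI)
  show "right_op emb T (right_W emb (tensor_word w) x) - c *\<^sub>C right_W emb (tensor_word w) x =
      right_W emb (tensor_word w) (T x - c *\<^sub>C x)"
    if "alternating w" "w = [] \<or> isl (last w) \<noteq> side" for x w
    using that by (simp add: right_op_right_W assms complex_linear_diff[OF linear_right_W]
        complex_linear_scale[OF linear_right_W])
qed (intro complex_linear_minus complex_linear_scaled complex_linear_ident linear_right_op assms)+

end

section \<open>Well-definedness of the operators for the two embeddings\<close>

lemma word_multilinear_left_Inl:
  fixes T :: "complex \<times> 'x::complex_vector \<Rightarrow> complex \<times> 'x"
  assumes T: "complex_linear T"
  shows "word_multilinear (\<lambda>w :: ('x + 'y::complex_vector) list. if alternating w
      then (case left_split Inl w of (x, w') \<Rightarrow> left_V Inl (T x) (tensor_word w')) else 0)"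
    (is "word_multilinear ?h")
proof -
  let ?k = "\<lambda>w :: ('x + 'y) list. if alternating w then (case w of
      [] \<Rightarrow> left_V Inl (T (1, 0)) (tensor_word [])
    | Inl x # w' \<Rightarrow> left_V Inl (T (0, x)) (tensor_word w')
    | Inr y # w' \<Rightarrow> left_V Inl (T (1, 0)) (tensor_word (Inr y # w'))) else 0"
  have "word_multilinear ?k"
  proof (rule word_multilinear_case)
    show "complex_linear (\<lambda>x. left_V Inl (T (0, x)) (tensor_word w))" for w :: "('x + 'y) list"
      by (rule linear_left_V_generic[OF T word_multilinear_Inl[OF word_multilinear_tensor_word]])
    show "complex_linear (\<lambda>y. left_V Inl (T (1, 0)) (tensor_word (Inr y # w)))" for w :: "('x + 'y) list"
      using word_multilinear_Inr[OF word_multilinear_left_V, of Inl "T (1, 0)" "[]" w] by simp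
  qed (intro word_multilinear_left_V word_multilinear_Cons[OF word_multilinear_left_V])+
  moreover have "?h = ?k"
  proof
    show "?h w = ?k w" for w
    proof (cases w)
      case (Cons l w')
      then show ?thesis by (cases l) (auto simp: left_split_def)
    qed (simp add: left_split_def)
  qed
  ultimately show ?thesis by (simp only:)
qed

text \<open>Reversing words turns the last letter into the first and reduces the claim to the test
  for functions of the first letter.\<close>

lemma word_multilinear_right_Inl:
  fixes T :: "complex \<times> 'x::complex_vector \<Rightarrow> complex \<times> 'x"
  assumes T: "complex_linear T"
  shows "word_multilinear (\<lambda>w :: ('x + 'y::complex_vector) list. if alternating w
      then (case right_split Inl w of (w', x) \<Rightarrow> right_W Inl (tensor_word w') (T x)) else 0)"
    (is "word_multilinear ?h")
proof -
  let ?k = "\<lambda>w :: ('x + 'y) list. if alternating w then (case w of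
      [] \<Rightarrow> right_W Inl (tensor_word []) (T (1, 0))
    | Inl x # w' \<Rightarrow> right_W Inl (tensor_word (rev w')) (T (0, x))
    | Inr y # w' \<Rightarrow> right_W Inl (tensor_word (rev (Inr y # w'))) (T (1, 0))) else 0"
  have "word_multilinear ?k"
  proof (rule word_multilinear_case)
    show "complex_linear (\<lambda>x. right_W Inl (tensor_word (rev w)) (T (0, x)))" for w :: "('x + 'y) list"
      by (rule linear_right_W_generic[OF T word_multilinear_Inl[OF word_multilinear_tensor_word]])
    show "complex_linear (\<lambda>y. right_W Inl (tensor_word (rev (Inr y # w))) (T (1, 0)))" for w :: "('x + 'y) list"
      using word_multilinear_Inr[OF word_multilinear_right_W, of Inl "rev w" "[]" "T (1, 0)"] by simp
    show "word_multilinear (\<lambda>w :: ('x + 'y) list. right_W Inl (tensor_word (rev w)) (T (0, x)))" for x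
      by (rule word_multilinear_rev[OF word_multilinear_right_W])
    show "word_multilinear (\<lambda>w :: ('x + 'y) list. right_W Inl (tensor_word (rev (Inr y # w))) (T (1, 0)))" for y
      by (rule word_multilinear_Cons[OF word_multilinear_rev[OF word_multilinear_right_W]])
  qed
  note word_multilinear_rev[OF this]
  moreover have "?h = (\<lambda>w. ?k (rev w))"
  proof
    show "?h w = ?k (rev w)" for w
    proof (cases w rule: rev_cases)
      case (snoc w' l)
      then show ?thesis
        using alternating_rev[of w] by (cases l) (auto simp: right_split_def)
    qed (simp add: right_split_def)
  qed
  ultimately show ?thesis by (simp only:)
qed

lemma word_multilinear_left_Inr:
  fixes T :: "complex \<times> 'y::complex_vector \<Rightarrow> complex \<times> 'y"
  assumes T: "complex_linear T"
  shows "word_multilinear (\<lambda>w :: ('x::complex_vector + 'y) list. if alternating w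
      then (case left_split Inr w of (x, w') \<Rightarrow> left_V Inr (T x) (tensor_word w')) else 0)"
    (is "word_multilinear ?h")
proof -
  let ?k = "\<lambda>w :: ('x + 'y) list. if alternating w then (case w of
      [] \<Rightarrow> left_V Inr (T (1, 0)) (tensor_word [])
    | Inl x # w' \<Rightarrow> left_V Inr (T (1, 0)) (tensor_word (Inl x # w'))
    | Inr y # w' \<Rightarrow> left_V Inr (T (0, y)) (tensor_word w')) else 0"
  have "word_multilinear ?k"
  proof (rule word_multilinear_case)
    show "complex_linear (\<lambda>y. left_V Inr (T (0, y)) (tensor_word w))" for w :: "('x + 'y) list"
      by (rule linear_left_V_generic[OF T word_multilinear_Inr[OF word_multilinear_tensor_word]])
    show "complex_linear (\<lambda>x. left_V Inr (T (1, 0)) (tensor_word (Inl x # w)))" for w :: "('x + 'y) list"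
      using word_multilinear_Inl[OF word_multilinear_left_V, of Inr "T (1, 0)" "[]" w] by simp
  qed (intro word_multilinear_left_V word_multilinear_Cons[OF word_multilinear_left_V])+
  moreover have "?h = ?k"
  proof
    show "?h w = ?k w" for w
    proof (cases w)
      case (Cons l w')
      then show ?thesis by (cases l) (auto simp: left_split_def)
    qed (simp add: left_split_def)
  qed
  ultimately show ?thesis by (simp only:)
qed

lemma word_multilinear_right_Inr:
  fixes T :: "complex \<times> 'y::complex_vector \<Rightarrow> complex \<times> 'y"
  assumes T: "complex_linear T"
  shows "word_multilinear (\<lambda>w :: ('x::complex_vector + 'y) list. if alternating w
      then (case right_split Inr w of (w', x) \<Rightarrow> right_W Inr (tensor_word w') (T x)) else 0)"
    (is "word_multilinear ?h")
proof -
  let ?k = "\<lambda>w :: ('x + 'y) list. if alternating w then (case w of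
      [] \<Rightarrow> right_W Inr (tensor_word []) (T (1, 0))
    | Inl x # w' \<Rightarrow> right_W Inr (tensor_word (rev (Inl x # w'))) (T (1, 0))
    | Inr y # w' \<Rightarrow> right_W Inr (tensor_word (rev w')) (T (0, y))) else 0"
  have "word_multilinear ?k"
  proof (rule word_multilinear_case)
    show "complex_linear (\<lambda>y. right_W Inr (tensor_word (rev w)) (T (0, y)))" for w :: "('x + 'y) list"
      by (rule linear_right_W_generic[OF T word_multilinear_Inr[OF word_multilinear_tensor_word]])
    show "complex_linear (\<lambda>x. right_W Inr (tensor_word (rev (Inl x # w))) (T (1, 0)))" for w :: "('x + 'y) list"
      using word_multilinear_Inl[OF word_multilinear_right_W, of Inr "rev w" "[]" "T (1, 0)"] by simp
    show "word_multilinear (\<lambda>w :: ('x + 'y) list. right_W Inr (tensor_word (rev w)) (T (0, y)))" for y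
      by (rule word_multilinear_rev[OF word_multilinear_right_W])
    show "word_multilinear (\<lambda>w :: ('x + 'y) list. right_W Inr (tensor_word (rev (Inl x # w))) (T (1, 0)))" for x
      by (rule word_multilinear_Cons[OF word_multilinear_rev[OF word_multilinear_right_W]])
  qed
  note word_multilinear_rev[OF this]
  moreover have "?h = (\<lambda>w. ?k (rev w))"
  proof
    show "?h w = ?k (rev w)" for w
    proof (cases w rule: rev_cases)
      case (snoc w' l)
      then show ?thesis
        using alternating_rev[of w] by (cases l) (auto simp: right_split_def)
    qed (simp add: right_split_def)
  qed
  ultimately show ?thesis by (simp only:)
qed

global_interpretation Inl_factor: free_factor "Inl :: 'x::complex_vector \<Rightarrow> 'x + 'y::complex_vector" True
proof (rule free_factor.intro)
  show "l \<in> range Inl \<longleftrightarrow> isl l = True" for l :: "'x + 'y" by (cases l) auto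
qed (simp_all add: word_multilinear_Inl[OF word_multilinear_tensor_word] word_multilinear_left_Inl
    word_multilinear_right_Inl)

global_interpretation Inr_factor: free_factor "Inr :: 'y::complex_vector \<Rightarrow> 'x::complex_vector + 'y" False
proof (rule free_factor.intro)
  show "l \<in> range Inr \<longleftrightarrow> isl l = False" for l :: "'x + 'y" by (cases l) auto
qed (simp_all add: word_multilinear_Inr[OF word_multilinear_tensor_word] word_multilinear_left_Inr
    word_multilinear_right_Inr)


section \<open>Moments of alternating centred words\<close>

abbreviation vacuum_coeff :: "('x::complex_vector, 'y::complex_vector) free_product \<Rightarrow> complex" where
  "vacuum_coeff \<equiv> word_extend (\<lambda>w. if w = [] then 1 else 0)"

lemma word_multilinear_vacuum: "word_multilinear (\<lambda>w. if w = [] then 1 else (0 :: complex))"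
  by (auto simp: word_multilinear_def alternating_def complex_linear_const_zero)

lemma linear_vacuum_coeff: "complex_linear vacuum_coeff"
  by (rule complex_linear_word_extend[OF word_multilinear_vacuum])

lemma vacuum_coeff_word: "vacuum_coeff (tensor_word w) = (if w = [] then 1 else 0)"
  by (rule word_extend_tensor_word[OF word_multilinear_vacuum])

type_synonym ('x, 'y) letter_op =
  "(complex \<times> 'x \<Rightarrow> complex \<times> 'x) + (complex \<times> 'y \<Rightarrow> complex \<times> 'y)"

definition left_act :: "('x::complex_vector, 'y::complex_vector) letter_op \<Rightarrow> ('x, 'y) free_product \<Rightarrow> ('x, 'y) free_product"
  where "left_act = case_sum (left_op Inl) (left_op Inr)"

definition right_act :: "('x::complex_vector, 'y::complex_vector) letter_op \<Rightarrow> ('x, 'y) free_product \<Rightarrow> ('x, 'y) free_product"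
  where "right_act = case_sum (right_op Inl) (right_op Inr)"

definition linear_letter_op :: "('x::complex_vector, 'y::complex_vector) letter_op \<Rightarrow> bool"
  where "linear_letter_op = case_sum complex_linear complex_linear"

definition centred_op :: "('x::complex_vector, 'y::complex_vector) letter_op \<Rightarrow> bool"
  where "centred_op = case_sum (\<lambda>P. fst (P (1, 0)) = 0) (\<lambda>P. fst (P (1, 0)) = 0)"

definition op_vector :: "('x::complex_vector, 'y::complex_vector) letter_op \<Rightarrow> 'x + 'y"
  where "op_vector = map_sum (\<lambda>P. snd (P (1, 0))) (\<lambda>P. snd (P (1, 0)))"

text \<open>The annihilation coefficient. The value 0 on opposite sides is a default;
  \<open>contract_words\<close> tests the sides itself.\<close>

definition contraction :: "('x::complex_vector, 'y::complex_vector) letter_op \<Rightarrow> 'x + 'y \<Rightarrow> complex"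
  where "contraction l v = (case (l, v) of (Inl P, Inl x) \<Rightarrow> fst (P (0, x)) | (Inr P, Inr y) \<Rightarrow> fst (P (0, y)) | _ \<Rightarrow> 0)"

lemma isl_op_vector [simp]: "isl (op_vector l) = isl l"
  by (cases l) (simp_all add: op_vector_def)

lemma linear_left_act: "linear_letter_op l \<Longrightarrow> complex_linear (left_act l)"
  by (cases l) (simp_all add: linear_letter_op_def left_act_def Inl_factor.linear_left_op Inr_factor.linear_left_op)

lemma left_act_fresh:
  assumes "linear_letter_op l" "centred_op l" "alternating w" "w = [] \<or> isl (hd w) \<noteq> isl l"
  shows "left_act l (tensor_word w) = tensor_word (op_vector l # w)"
  using assms by (cases l) (simp_all add: linear_letter_op_def centred_op_def left_act_def op_vector_def
      Inl_factor.left_op_fresh Inr_factor.left_op_fresh)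

lemma right_act_fresh:
  assumes "linear_letter_op l" "centred_op l" "alternating w" "w = [] \<or> isl (last w) \<noteq> isl l"
  shows "right_act l (tensor_word w) = tensor_word (w @ [op_vector l])"
  using assms by (cases l) (simp_all add: linear_letter_op_def centred_op_def right_act_def op_vector_def
      Inl_factor.right_op_fresh Inr_factor.right_op_fresh)

text \<open>The letter either disappears or is replaced. Later arguments see only the side of the
  replacement, so its value stays hidden.\<close>

lemma left_act_same_side:
  assumes "linear_letter_op l" "alternating (v # w)" "isl v = isl l"
  obtains v' where "left_act l (tensor_word (v # w)) = contraction l v *\<^sub>C tensor_word w + tensor_word (v' # w)"
    and "isl v' = isl l"
proof (cases l; cases v)
  fix P x assume "l = Inl P" "v = Inl x"
  then show thesis
    using Inl_factor.left_op_same_side[of P x w] assms that[of "Inl (snd (P (0, x)))"]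
    by (simp add: linear_letter_op_def left_act_def contraction_def)
next
  fix P x assume "l = Inr P" "v = Inr x"
  then show thesis
    using Inr_factor.left_op_same_side[of P x w] assms that[of "Inr (snd (P (0, x)))"]
    by (simp add: linear_letter_op_def left_act_def contraction_def)
qed (use assms in simp_all)

fun contract_words :: "('x::complex_vector, 'y::complex_vector) letter_op list \<Rightarrow> ('x + 'y) list \<Rightarrow> complex" where
  "contract_words [] [] = 1"
| "contract_words (l # ls) (v # vs) = (if isl l = isl v then contraction l v * contract_words ls vs else 0)"
| "contract_words _ _ = 0"

lemma linear_fold_left_act:
  "\<forall>l\<in>set ls. linear_letter_op l \<Longrightarrow> complex_linear (fold left_act ls)"
  by (induction ls)
    (simp_all add: id_def o_def complex_linear_ident complex_linear_compose linear_left_act)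

text \<open>The letters must be annihilated one after the other. Once an operator leaves a letter of
  its own side in front, the next operator is from the other side and can only create a further
  letter, and so on: the vacuum is out of reach.\<close>

lemma vacuum_coeff_fold_left_act:
  assumes "\<forall>l\<in>set ls. linear_letter_op l \<and> centred_op l" "alternating ls" "alternating w"
  shows "vacuum_coeff (fold left_act ls (tensor_word w)) = contract_words ls w"
  using assms
proof (induction ls arbitrary: w)
  case Nil
  then show ?case by (cases w) (simp_all add: vacuum_coeff_word)
next
  case (Cons l ls)
  have IH: "vacuum_coeff (fold left_act ls (tensor_word w')) = contract_words ls w'" if "alternating w'" for w'
    using Cons that by (simp add: alternating_Cons)
  \<comment> \<open>Either no operator remains and a nonempty word is left over, or the next
    operator is on the side opposite to \<open>v\<close>.\<close>
  have vanish: "contract_words ls (v # w') = 0" if "isl v = isl l" for v w'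
    using Cons.prems(2) that by (cases ls) (auto simp: alternating_Cons)
  show ?case
  proof (cases "w = [] \<or> isl (hd w) \<noteq> isl l")
    case True
    then have "alternating (op_vector l # w)"
      using Cons.prems by (auto simp: alternating_Cons)
    then have "vacuum_coeff (fold left_act (l # ls) (tensor_word w)) = 0"
      using Cons.prems True by (simp add: left_act_fresh IH vanish)
    with True show ?thesis by (cases w) auto
  next
    case False
    then obtain v w' where w: "w = v # w'" "isl v = isl l" by (cases w) auto
    obtain v' where v': "left_act l (tensor_word (v # w')) = contraction l v *\<^sub>C tensor_word w' + tensor_word (v' # w')"
      and "isl v' = isl l"
      using left_act_same_side[of l v w'] Cons.prems w by auto
    moreover from this have "alternating (v' # w')" "alternating w'"
      using Cons.prems w by (auto simp: alternating_Cons)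
    moreover have "complex_linear (fold left_act ls)"
      using Cons.prems by (intro linear_fold_left_act) simp
    ultimately show ?thesis
      using w by (simp add: complex_linear_add complex_linear_scale linear_vacuum_coeff IH vanish scaleC_complex_def)
  qed
qed

lemma fold_right_act:
  assumes "\<forall>l\<in>set ls. linear_letter_op l \<and> centred_op l" "alternating (w @ map op_vector ls)"
  shows "fold right_act ls (tensor_word w) = tensor_word (w @ map op_vector ls)"
  using assms
proof (induction ls arbitrary: w)
  case (Cons l ls)
  have "alternating ((w @ [op_vector l]) @ map op_vector ls)" using Cons.prems by simp
  then have "alternating (w @ [op_vector l])"
    unfolding alternating_def successively_append_iff by blast
  then show ?case
    using Cons.prems Cons.IH[of "w @ [op_vector l]"] by (auto simp: right_act_fresh alternating_snoc)
qed simp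

text \<open>Lists run in order of action on the vacuum, so their heads are the rightmost factors in
  \<open>centred_moment\<close>. The first right operator to act supplies the leftmost letter of the
  word, which is the one that the first left operator meets; therefore heads pair with
  heads.\<close>

fun word_pairing :: "('a::times \<Rightarrow> complex) \<Rightarrow> (bool \<times> 'a) list \<Rightarrow> (bool \<times> 'a) list \<Rightarrow> complex" where
  "word_pairing \<phi> [] [] = 1"
| "word_pairing \<phi> ((i, x) # xs) ((j, y) # ys) = (if i = j then \<phi> (x * y) * word_pairing \<phi> xs ys else 0)"
| "word_pairing \<phi> _ _ = 0"

section \<open>Transfer of moments from the operator model to the algebra\<close>

locale bi_free_model = cstar_state \<phi> for \<phi> :: "'a::cstar_algebra \<Rightarrow> complex" +
  fixes a b :: "bool \<Rightarrow> 'a"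
    and T1 S1 :: "complex \<times> 'x::complex_vector \<Rightarrow> complex \<times> 'x"
    and T2 S2 :: "complex \<times> 'y::complex_vector \<Rightarrow> complex \<times> 'y"
  assumes linear_ops: "complex_linear T1" "complex_linear S1" "complex_linear T2" "complex_linear S2"
    and moments: "set ks \<subseteq> {..<4} \<Longrightarrow>
      \<phi> (prod_list (map ((!) [a True, a False, b True, b False]) ks)) =
      vacuum_state (foldr (\<circ>) (map ((!)
        [left_op Inl T1, left_op Inr T2, right_op Inl S1, right_op Inr S2]) ks) id)"
begin

definition gen_word :: "nat list \<Rightarrow> 'a" where
  "gen_word ks = prod_list (map ((!) [a True, a False, b True, b False]) ks)"

definition op_word :: "nat list \<Rightarrow> ('x, 'y) free_product \<Rightarrow> ('x, 'y) free_product" where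
  "op_word ks = foldr (\<circ>) (map ((!)
    [left_op Inl T1, left_op Inr T2, right_op Inl S1, right_op Inr S2]) ks) id"

text \<open>A relation and not a map: an element may be written as several polynomials in the
  generators, and these may give different operators. The vacuum expectation is still determined,
  see \<open>state_represents\<close>.\<close>

inductive represents :: "'a \<Rightarrow> (('x, 'y) free_product \<Rightarrow> ('x, 'y) free_product) \<Rightarrow> bool" where
  word: "set ks \<subseteq> {..<4} \<Longrightarrow> represents (gen_word ks) (op_word ks)"
| add: "represents x L \<Longrightarrow> represents y M \<Longrightarrow> represents (x + y) (\<lambda>u. L u + M u)"
| scale: "represents x L \<Longrightarrow> represents (c *\<^sub>C x) (\<lambda>u. c *\<^sub>C L u)"

lemma linear_represents: "represents x L \<Longrightarrow> complex_linear L"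
proof (induction rule: represents.induct)
  case (word ks)
  then show ?case
  proof (induction ks)
    case (Cons k ks)
    have "k = 0 \<or> k = 1 \<or> k = 2 \<or> k = 3" using Cons.prems by auto
    then have "complex_linear ([left_op Inl T1, left_op Inr T2, right_op Inl S1, right_op Inr S2] ! k)"
      using linear_ops by (auto simp: Inl_factor.linear_left_op Inr_factor.linear_left_op
          Inl_factor.linear_right_op Inr_factor.linear_right_op)
    then show ?case using Cons by (simp add: op_word_def o_def complex_linear_compose)
  qed (simp add: op_word_def id_def complex_linear_ident)
qed (simp_all add: complex_linear_plus complex_linear_scaled)

lemma state_represents: "represents x L \<Longrightarrow> \<phi> x = vacuum_coeff (L (tensor_word []))"
  by (induction rule: represents.induct)
    (simp_all add: gen_word_def op_word_def moments vacuum_state_def state_add state_scale linear_vacuum_coeff complex_linear_add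
      complex_linear_scale scaleC_complex_def)

lemma represents_word_mult:
  assumes ks: "set ks \<subseteq> {..<4}" and "represents y M"
  shows "represents (gen_word ks * y) (op_word ks \<circ> M)"
  using assms(2)
proof (induction rule: represents.induct)
  case (word ks')
  have comp: "foldr (\<circ>) fs g = foldr (\<circ>) fs id \<circ> g"
    for fs :: "(('x, 'y) free_product \<Rightarrow> ('x, 'y) free_product) list" and g
    by (induction fs) (simp_all add: o_assoc)
  have "gen_word (ks @ ks') = gen_word ks * gen_word ks'" "op_word (ks @ ks') = op_word ks \<circ> op_word ks'"
    by (simp_all add: gen_word_def op_word_def comp[of _ "foldr _ _ _"])
  then show ?case
    using represents.word[of "ks @ ks'"] ks word by (simp add: comp_def)
next
  case (add y M z N)
  show ?case
    using represents.add[OF add.IH]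
    by (simp add: comp_def distrib_left complex_linear_add[OF linear_represents[OF represents.word[OF ks]]])
next
  case (scale y M c)
  show ?case
    using represents.scale[OF scale.IH]
    by (simp add: comp_def scaleC_mult_right complex_linear_scale[OF linear_represents[OF represents.word[OF ks]]])
qed

lemma represents_mult:
  assumes "represents x L" "represents y M"
  shows "represents (x * y) (\<lambda>u. L (M u))"
  using assms(1)
proof (induction rule: represents.induct)
  case (word ks)
  show ?case using represents_word_mult[OF word assms(2)] by (simp add: comp_def)
qed (auto simp: distrib_right scaleC_mult_left intro: represents.add represents.scale)

lemma represents_one: "represents 1 (\<lambda>u. u)"
  using represents.word[of "[]"] by (simp add: gen_word_def op_word_def id_def)

lemma represents_power: "represents x L \<Longrightarrow> represents (x ^ n) (L ^^ n)"
  by (induction n) (simp_all add: funpow.simps represents_one id_def o_def represents_mult)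

lemma represents_shift: "represents x L \<Longrightarrow> represents (x - c *\<^sub>C 1) (\<lambda>u. L u - c *\<^sub>C u)"
  using represents.add[OF _ represents.scale[OF represents_one, of "- c"]]
  by simp

text \<open>The power is centred by its own vacuum coefficient, which makes
  \<open>centred_letters\<close> immediate; \<open>represents_left_letter\<close> shows that this
  scalar equals the moment subtracted in \<open>centred_power\<close>.\<close>

definition left_letter :: "bool \<times> nat \<Rightarrow> ('x, 'y) letter_op" where
  "left_letter p =
    (if fst p then Inl (\<lambda>v. (T1 ^^ snd p) v - fst ((T1 ^^ snd p) (1, 0)) *\<^sub>C v)
     else Inr (\<lambda>v. (T2 ^^ snd p) v - fst ((T2 ^^ snd p) (1, 0)) *\<^sub>C v))"

definition right_letter :: "bool \<times> nat \<Rightarrow> ('x, 'y) letter_op" where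
  "right_letter p =
    (if fst p then Inl (\<lambda>v. (S1 ^^ snd p) v - fst ((S1 ^^ snd p) (1, 0)) *\<^sub>C v)
     else Inr (\<lambda>v. (S2 ^^ snd p) v - fst ((S2 ^^ snd p) (1, 0)) *\<^sub>C v))"

definition centred_power :: "(bool \<Rightarrow> 'a) \<Rightarrow> bool \<times> nat \<Rightarrow> 'a" where
  "centred_power c p = c (fst p) ^ snd p - \<phi> (c (fst p) ^ snd p) *\<^sub>C 1"

lemma isl_letter [simp]: "isl (left_letter p) = fst p" "isl (right_letter p) = fst p"
  by (simp_all add: left_letter_def right_letter_def)

lemma linear_letters: "linear_letter_op (left_letter p)" "linear_letter_op (right_letter p)"
  unfolding left_letter_def right_letter_def linear_letter_op_def
  by (simp_all add: complex_linear_minus complex_linear_funpow complex_linear_scaled complex_linear_ident linear_ops)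

lemma centred_letters: "centred_op (left_letter p)" "centred_op (right_letter p)"
  unfolding left_letter_def right_letter_def centred_op_def
  by (simp_all add: scaleC_prod_def scaleC_complex_def)

lemma represents_generators:
  "represents (a True) (left_op Inl T1)" "represents (a False) (left_op Inr T2)"
  "represents (b True) (right_op Inl S1)" "represents (b False) (right_op Inr S2)"
  using represents.word[of "[0]"] represents.word[of "[1]"] represents.word[of "[2]"] represents.word[of "[3]"]
  by (simp_all add: gen_word_def op_word_def)

lemma represents_left_letter: "represents (centred_power a p) (left_act (left_letter p))"
proof (cases "fst p")
  case True
  have r: "represents (a True ^ snd p) (left_op Inl (T1 ^^ snd p))"
    unfolding Inl_factor.left_op_funpow[OF linear_ops(1)] by (intro represents_power represents_generators)
  have "left_op Inl (T1 ^^ snd p) (tensor_word [] :: ('x, 'y) free_product) = left_V Inl ((T1 ^^ snd p) (1, 0)) (tensor_word [])"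
    using Inl_factor.left_op_left_V[OF complex_linear_funpow[OF linear_ops(1)], of "[]" "snd p" "(1, 0)"]
    by (simp add: Inl_factor.left_V_1_0 alternating_def)
  then have "\<phi> (a True ^ snd p) = fst ((T1 ^^ snd p) (1, 0))"
    by (simp add: state_represents[OF r] left_V_tensor_word complex_linear_add complex_linear_scale
        linear_vacuum_coeff vacuum_coeff_word scaleC_complex_def)
  then show ?thesis
    using represents_shift[OF r, of "\<phi> (a True ^ snd p)"] True
    by (simp add: centred_power_def left_act_def left_letter_def
        Inl_factor.left_op_shift complex_linear_funpow linear_ops)
next
  case False
  have r: "represents (a False ^ snd p) (left_op Inr (T2 ^^ snd p))"
    unfolding Inr_factor.left_op_funpow[OF linear_ops(3)] by (intro represents_power represents_generators)
  have "left_op Inr (T2 ^^ snd p) (tensor_word [] :: ('x, 'y) free_product) = left_V Inr ((T2 ^^ snd p) (1, 0)) (tensor_word [])"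
    using Inr_factor.left_op_left_V[OF complex_linear_funpow[OF linear_ops(3)], of "[]" "snd p" "(1, 0)"]
    by (simp add: Inr_factor.left_V_1_0 alternating_def)
  then have "\<phi> (a False ^ snd p) = fst ((T2 ^^ snd p) (1, 0))"
    by (simp add: state_represents[OF r] left_V_tensor_word complex_linear_add complex_linear_scale
        linear_vacuum_coeff vacuum_coeff_word scaleC_complex_def)
  then show ?thesis
    using represents_shift[OF r, of "\<phi> (a False ^ snd p)"] False
    by (simp add: centred_power_def left_act_def left_letter_def
        Inr_factor.left_op_shift complex_linear_funpow linear_ops)
qed

lemma represents_right_letter: "represents (centred_power b p) (right_act (right_letter p))"
proof (cases "fst p")
  case True
  have r: "represents (b True ^ snd p) (right_op Inl (S1 ^^ snd p))"
    unfolding Inl_factor.right_op_funpow[OF linear_ops(2)] by (intro represents_power represents_generators)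
  have "right_op Inl (S1 ^^ snd p) (tensor_word [] :: ('x, 'y) free_product) = right_W Inl (tensor_word []) ((S1 ^^ snd p) (1, 0))"
    using Inl_factor.right_op_right_W[OF complex_linear_funpow[OF linear_ops(2)], of "[]" "snd p" "(1, 0)"]
    by (simp add: Inl_factor.right_W_1_0 alternating_def)
  then have "\<phi> (b True ^ snd p) = fst ((S1 ^^ snd p) (1, 0))"
    by (simp add: state_represents[OF r] right_W_tensor_word complex_linear_add complex_linear_scale
        linear_vacuum_coeff vacuum_coeff_word scaleC_complex_def)
  then show ?thesis
    using represents_shift[OF r, of "\<phi> (b True ^ snd p)"] True
    by (simp add: centred_power_def right_act_def right_letter_def
        Inl_factor.right_op_shift complex_linear_funpow linear_ops)
next
  case False
  have r: "represents (b False ^ snd p) (right_op Inr (S2 ^^ snd p))"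
    unfolding Inr_factor.right_op_funpow[OF linear_ops(4)] by (intro represents_power represents_generators)
  have "right_op Inr (S2 ^^ snd p) (tensor_word [] :: ('x, 'y) free_product) = right_W Inr (tensor_word []) ((S2 ^^ snd p) (1, 0))"
    using Inr_factor.right_op_right_W[OF complex_linear_funpow[OF linear_ops(4)], of "[]" "snd p" "(1, 0)"]
    by (simp add: Inr_factor.right_W_1_0 alternating_def)
  then have "\<phi> (b False ^ snd p) = fst ((S2 ^^ snd p) (1, 0))"
    by (simp add: state_represents[OF r] right_W_tensor_word complex_linear_add complex_linear_scale
        linear_vacuum_coeff vacuum_coeff_word scaleC_complex_def)
  then show ?thesis
    using represents_shift[OF r, of "\<phi> (b False ^ snd p)"] False
    by (simp add: centred_power_def right_act_def right_letter_def
        Inr_factor.right_op_shift complex_linear_funpow linear_ops)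
qed

lemma represents_fold:
  assumes "\<And>p. represents (x p) (L p)"
  shows "represents (prod_list (map x (rev ps))) (\<lambda>u. fold L ps u)"
proof (induction ps)
  case (Cons p ps)
  then show ?case using represents_mult[OF Cons assms[of p]] by simp
qed (simp add: represents_one)

lemma centred_power_moment:
  assumes "successively (\<noteq>) (map fst ps)" "successively (\<noteq>) (map fst qs)"
  shows "\<phi> (prod_list (map (centred_power a) (rev ps)) * prod_list (map (centred_power b) (rev qs))) =
    word_pairing \<phi> (map (\<lambda>p. (fst p, centred_power a p)) ps) (map (\<lambda>q. (fst q, centred_power b q)) qs)"
proof -
  have contract: "\<phi> (prod_list (map (centred_power a) (rev ps)) * prod_list (map (centred_power b) (rev qs))) =
    contract_words (map left_letter ps) (map (\<lambda>q. op_vector (right_letter q)) qs)"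
    if "successively (\<noteq>) (map fst ps)" "successively (\<noteq>) (map fst qs)" for ps qs
  proof -
    have alt: "alternating (map left_letter ps)" "alternating (map (\<lambda>q. op_vector (right_letter q)) qs)"
      using that by (simp_all add: alternating_iff o_def)
    have "\<phi> (prod_list (map (centred_power a) (rev ps)) * prod_list (map (centred_power b) (rev qs))) =
      vacuum_coeff (fold left_act (map left_letter ps) (fold right_act (map right_letter qs) (tensor_word [])))"
      using state_represents[OF represents_mult[OF represents_fold[OF represents_left_letter]
            represents_fold[OF represents_right_letter]]]
      by (simp add: fold_map o_def)
    also have "fold right_act (map right_letter qs) (tensor_word []) = tensor_word (map (\<lambda>q. op_vector (right_letter q)) qs)"
      using fold_right_act[of "map right_letter qs" "[]"] alt
      by (simp add: linear_letters centred_letters o_def)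
    also have "vacuum_coeff (fold left_act (map left_letter ps) \<dots>) =
        contract_words (map left_letter ps) (map (\<lambda>q. op_vector (right_letter q)) qs)"
      using alt by (intro vacuum_coeff_fold_left_act) (auto simp: linear_letters centred_letters)
    finally show ?thesis .
  qed
  \<comment> \<open>The case of one letter on each side expresses the contraction through \<phi>,
    which removes the operator model from the formula.\<close>
  have "contraction (left_letter p) (op_vector (right_letter q)) = \<phi> (centred_power a p * centred_power b q)"
    if "fst p = fst q" for p q
    using contract[of "[p]" "[q]"] that by simp
  then have "contract_words (map left_letter ps) (map (\<lambda>q. op_vector (right_letter q)) qs) =
    word_pairing \<phi> (map (\<lambda>p. (fst p, centred_power a p)) ps) (map (\<lambda>q. (fst q, centred_power b q)) qs)"
    by (induction ps qs rule: list_induct2') auto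
  then show ?thesis using contract[OF assms] by simp
qed

end


section \<open>From centred powers to the closure of their span\<close>

lemma (in cstar_state) linear_sandwich: "complex_linear (\<lambda>x. \<phi> (u * x * v))"
  by (rule complex_linearI)
    (simp_all add: distrib_left distrib_right state_add scaleC_mult_left scaleC_mult_right state_scale scaleC_complex_def)

lemma (in cstar_state) continuous_sandwich: "continuous_on UNIV (\<lambda>x. \<phi> (u * x * v))"
  by (intro bounded_linear.continuous_on[OF bounded_linear_state] continuous_intros)

lemma closure_span_zero:
  fixes f :: "'a::cstar_algebra \<Rightarrow> complex"
  assumes f: "complex_linear f" "continuous_on UNIV f" "\<And>x. x \<in> B \<Longrightarrow> f x = 0"
    and x: "x \<in> closure (complex_span B)"
  shows "f x = 0"
proof -
  interpret L: Vector_Spaces.linear scaleC scaleC f by (rule f(1))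
  have "complex_span B \<subseteq> {x. f x = 0}" using L.eq_0_on_span f(3) by blast
  moreover have "closed {x. f x = 0}"
    using continuous_closed_vimage[of "{0}" f] f(2) by (simp add: vimage_def continuous_on_eq_continuous_at)
  ultimately show ?thesis using closure_minimal x by blast
qed

text \<open>Generators are replaced by elements of the closure one slot at a time, with
  \<open>us\<close> the part already treated. \<open>P\<close> sees only the indices and therefore
  survives each replacement.\<close>

lemma multilinear_closure_zero:
  fixes D :: "('i \<times> 'a::cstar_algebra) list \<Rightarrow> complex"
  assumes lin: "\<And>us i vs. complex_linear (\<lambda>x. D (us @ (i, x) # vs))"
    and cont: "\<And>us i vs. continuous_on UNIV (\<lambda>x. D (us @ (i, x) # vs))"
    and base: "\<And>xs. P (map fst xs) \<Longrightarrow> \<forall>(i, x)\<in>set xs. x \<in> B i \<Longrightarrow> D xs = 0"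
    and xs: "P (map fst xs)" "\<forall>(i, x)\<in>set xs. x \<in> closure (complex_span (B i))"
  shows "D xs = 0"
proof -
  have "D (us @ vs) = 0" if "\<forall>(i, x)\<in>set us. x \<in> closure (complex_span (B i))"
    "\<forall>(i, x)\<in>set vs. x \<in> B i" "P (map fst (us @ vs))" for us vs
    using that
  proof (induction us arbitrary: vs rule: rev_induct)
    case Nil
    then show ?case using base[of vs] by simp
  next
    case (snoc p us)
    obtain i x where p: "p = (i, x)" by fastforce
    have "D (us @ (i, x) # vs) = 0"
    proof (rule closure_span_zero[OF lin cont])
      show "D (us @ (i, y) # vs) = 0" if "y \<in> B i" for y
        using snoc.IH[of "(i, y) # vs"] snoc.prems that p by simp
      show "x \<in> closure (complex_span (B i))" using snoc.prems p by simp
    qed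
    then show ?case by (simp add: p)
  qed
  from this[of xs "[]"] xs show ?thesis by simp
qed

text \<open>Linearity and continuity in one letter at once; mismatched words are covered by
  \<open>c = 0\<close>.\<close>

lemma word_pairing_slot_left:
  "\<exists>c y. \<forall>x. word_pairing \<phi> (us @ (i, x) # vs) ys = c * \<phi> (x * y)"
proof (induction us arbitrary: ys)
  case Nil
  show ?case
  proof (cases ys)
    case Nil
    then have "\<forall>x. word_pairing \<phi> ([] @ (i, x) # vs) ys = 0 * \<phi> (x * y)" for y by simp
    then show ?thesis by blast
  next
    case (Cons p ys')
    then have "\<forall>x. word_pairing \<phi> ([] @ (i, x) # vs) ys =
        (if i = fst p then word_pairing \<phi> vs ys' else 0) * \<phi> (x * snd p)"
      by (cases p) simp
    then show ?thesis by blast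
  qed
next
  case (Cons q us)
  show ?case
  proof (cases ys)
    case Nil
    then have "\<forall>x. word_pairing \<phi> ((q # us) @ (i, x) # vs) ys = 0 * \<phi> (x * y)" for y
      by (cases q) simp
    then show ?thesis by blast
  next
    case (Cons p ys')
    obtain c y where "\<forall>x. word_pairing \<phi> (us @ (i, x) # vs) ys' = c * \<phi> (x * y)"
      using Cons.IH by blast
    then have "\<forall>x. word_pairing \<phi> ((q # us) @ (i, x) # vs) ys =
        (if fst q = fst p then \<phi> (snd q * snd p) * c else 0) * \<phi> (x * y)"
      using Cons by (cases p; cases q) simp
    then show ?thesis by blast
  qed
qed

lemma word_pairing_slot_right:
  "\<exists>c x. \<forall>y. word_pairing \<phi> xs (us @ (i, y) # vs) = c * \<phi> (x * y)"
proof (induction us arbitrary: xs)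
  case Nil
  show ?case
  proof (cases xs)
    case Nil
    then have "\<forall>y. word_pairing \<phi> xs ([] @ (i, y) # vs) = 0 * \<phi> (x * y)" for x by simp
    then show ?thesis by blast
  next
    case (Cons p xs')
    then have "\<forall>y. word_pairing \<phi> xs ([] @ (i, y) # vs) =
        (if i = fst p then word_pairing \<phi> xs' vs else 0) * \<phi> (snd p * y)"
      by (cases p) simp
    then show ?thesis by blast
  qed
next
  case (Cons q us)
  show ?case
  proof (cases xs)
    case Nil
    then have "\<forall>y. word_pairing \<phi> xs ((q # us) @ (i, y) # vs) = 0 * \<phi> (x * y)" for x
      by (cases q) simp
    then show ?thesis by blast
  next
    case (Cons p xs')
    obtain c x where "\<forall>y. word_pairing \<phi> xs' (us @ (i, y) # vs) = c * \<phi> (x * y)"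
      using Cons.IH by blast
    then have "\<forall>y. word_pairing \<phi> xs ((q # us) @ (i, y) # vs) =
        (if fst q = fst p then \<phi> (snd p * snd q) * c else 0) * \<phi> (x * y)"
      using Cons by (cases p; cases q) simp
    then show ?thesis by blast
  qed
qed

context bi_free_model
begin

definition centred_space :: "(bool \<Rightarrow> 'a) \<Rightarrow> bool \<Rightarrow> 'a set" where
  "centred_space c i = closure (complex_span (range (\<lambda>n. centred_power c (i, n))))"

lemma list_of_powers:
  assumes "\<forall>(i, x)\<in>set xs. x \<in> range (\<lambda>n. centred_power c (i, n))"
  obtains ps where "xs = map (\<lambda>p. (fst p, centred_power c p)) ps"
  using assms
proof (induction xs arbitrary: thesis)
  case (Cons q xs)
  obtain ps where "xs = map (\<lambda>p. (fst p, centred_power c p)) ps"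
    using Cons.IH Cons.prems(2) by auto
  moreover obtain n where "snd q = centred_power c (fst q, n)"
    using Cons.prems(2) by auto
  ultimately show ?case
    using Cons.prems(1)[of "(fst q, n) # ps"] by (cases q) simp
qed simp

text \<open>\<open>multilinear_closure_zero\<close> treats one list at a time, so the right letters
  are still centred powers here; \<open>centred_moment\<close> then extends them as well.\<close>

lemma centred_moment_mixed:
  assumes alt: "successively (\<noteq>) (map fst xs)" "successively (\<noteq>) (map fst ys)"
    and xs: "\<forall>(i, x)\<in>set xs. x \<in> centred_space a i"
    and ys: "\<forall>(i, y)\<in>set ys. y \<in> range (\<lambda>n. centred_power b (i, n))"
  shows "\<phi> (prod_list (map snd (rev xs)) * prod_list (map snd (rev ys))) = word_pairing \<phi> xs ys"
proof -
  let ?D = "\<lambda>xs. \<phi> (prod_list (map snd (rev xs)) * prod_list (map snd (rev ys))) - word_pairing \<phi> xs ys"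
  have slot: "\<exists>c y. (\<lambda>x. ?D (us @ (i, x) # vs)) =
      (\<lambda>x. \<phi> (prod_list (map snd (rev vs)) * x * (prod_list (map snd (rev us)) * prod_list (map snd (rev ys))))
        - c *\<^sub>C \<phi> (1 * x * y))" for us i vs
  proof -
    obtain c y where "\<forall>x. word_pairing \<phi> (us @ (i, x) # vs) ys = c * \<phi> (x * y)"
      using word_pairing_slot_left[of \<phi> us i vs ys] by blast
    then show ?thesis
      by (intro exI[of _ c] exI[of _ y]) (simp add: mult.assoc scaleC_complex_def)
  qed
  have "?D xs = 0"
  proof (rule multilinear_closure_zero[where D = ?D and P = "successively (\<noteq>)" and B = "\<lambda>i. range (\<lambda>n. centred_power a (i, n))"])
    show "complex_linear (\<lambda>x. ?D (us @ (i, x) # vs))" for us i vs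
    proof -
      obtain c y where eq: "(\<lambda>x. ?D (us @ (i, x) # vs)) =
      (\<lambda>x. \<phi> (prod_list (map snd (rev vs)) * x * (prod_list (map snd (rev us)) * prod_list (map snd (rev ys))))
        - c *\<^sub>C \<phi> (1 * x * y))" using slot by blast
      show ?thesis
        unfolding eq by (intro complex_linear_minus[OF linear_sandwich complex_linear_scaled[OF linear_sandwich]])
    qed
    show "continuous_on UNIV (\<lambda>x. ?D (us @ (i, x) # vs))" for us i vs
    proof -
      obtain c y where "(\<lambda>x. ?D (us @ (i, x) # vs)) =
      (\<lambda>x. \<phi> (prod_list (map snd (rev vs)) * x * (prod_list (map snd (rev us)) * prod_list (map snd (rev ys))))
        - c *\<^sub>C \<phi> (1 * x * y))" using slot by blast
      moreover have "continuous_on UNIV (\<lambda>x. \<phi> (u * x * v) - c *\<^sub>C \<phi> (1 * x * y))" for u v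
        unfolding scaleC_complex_def
        by (intro continuous_on_diff continuous_on_mult continuous_on_const continuous_sandwich)
      ultimately show ?thesis by (simp only:)
    qed
    show "?D xs = 0" if alt': "successively (\<noteq>) (map fst xs)" and powers: "\<forall>(i, x)\<in>set xs. x \<in> range (\<lambda>n. centred_power a (i, n))" for xs
    proof -
      obtain ps where ps: "xs = map (\<lambda>p. (fst p, centred_power a p)) ps"
        using powers by (rule list_of_powers)
      obtain qs where qs: "ys = map (\<lambda>p. (fst p, centred_power b p)) qs"
        using ys by (rule list_of_powers)
      show ?thesis
        using centred_power_moment[of ps qs] alt' alt(2) unfolding ps qs
        by (simp add: rev_map o_def)
    qed
  qed (use alt xs in \<open>simp_all add: centred_space_def\<close>)
  then show ?thesis by simp
qed

lemma centred_moment: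
  assumes alt: "successively (\<noteq>) (map fst xs)" "successively (\<noteq>) (map fst ys)"
    and xs: "\<forall>(i, x)\<in>set xs. x \<in> centred_space a i"
    and ys: "\<forall>(i, y)\<in>set ys. y \<in> centred_space b i"
  shows "\<phi> (prod_list (map snd (rev xs)) * prod_list (map snd (rev ys))) = word_pairing \<phi> xs ys"
proof -
  let ?D = "\<lambda>ys. \<phi> (prod_list (map snd (rev xs)) * prod_list (map snd (rev ys))) - word_pairing \<phi> xs ys"
  have slot: "\<exists>c x. (\<lambda>y. ?D (us @ (i, y) # vs)) =
      (\<lambda>y. \<phi> ((prod_list (map snd (rev xs)) * prod_list (map snd (rev vs))) * y * prod_list (map snd (rev us)))
        - c *\<^sub>C \<phi> (x * y * 1))" for us i vs
  proof -
    obtain c x where "\<forall>y. word_pairing \<phi> xs (us @ (i, y) # vs) = c * \<phi> (x * y)"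
      using word_pairing_slot_right[of \<phi> xs us i vs] by blast
    then show ?thesis
      by (intro exI[of _ c] exI[of _ x]) (simp add: mult.assoc scaleC_complex_def)
  qed
  have "?D ys = 0"
  proof (rule multilinear_closure_zero[where D = ?D and P = "successively (\<noteq>)" and B = "\<lambda>i. range (\<lambda>n. centred_power b (i, n))"])
    show "complex_linear (\<lambda>y. ?D (us @ (i, y) # vs))" for us i vs
    proof -
      obtain c x where eq: "(\<lambda>y. ?D (us @ (i, y) # vs)) =
      (\<lambda>y. \<phi> ((prod_list (map snd (rev xs)) * prod_list (map snd (rev vs))) * y * prod_list (map snd (rev us)))
        - c *\<^sub>C \<phi> (x * y * 1))" using slot by blast
      show ?thesis
        unfolding eq by (intro complex_linear_minus[OF linear_sandwich complex_linear_scaled[OF linear_sandwich]])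
    qed
    show "continuous_on UNIV (\<lambda>y. ?D (us @ (i, y) # vs))" for us i vs
    proof -
      obtain c x where "(\<lambda>y. ?D (us @ (i, y) # vs)) =
      (\<lambda>y. \<phi> ((prod_list (map snd (rev xs)) * prod_list (map snd (rev vs))) * y * prod_list (map snd (rev us)))
        - c *\<^sub>C \<phi> (x * y * 1))" using slot by blast
      moreover have "continuous_on UNIV (\<lambda>y. \<phi> (u * y * v) - c *\<^sub>C \<phi> (x * y * 1))" for u v
        unfolding scaleC_complex_def
        by (intro continuous_on_diff continuous_on_mult continuous_on_const continuous_sandwich)
      ultimately show ?thesis by (simp only:)
    qed
    show "?D ys = 0" if "successively (\<noteq>) (map fst ys)" "\<forall>(i, x)\<in>set ys. x \<in> range (\<lambda>n. centred_power b (i, n))" for ys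
      using centred_moment_mixed[OF alt(1) that(1) xs that(2)] by simp
  qed (use alt ys in \<open>simp_all add: centred_space_def\<close>)
  then show ?thesis by simp
qed

text \<open>Centring is linear and bounded, so it acts termwise on the Neumann series and turns each
  term into a multiple of a centred power.\<close>

lemma resolvent_centred:
  assumes "norm (c i) < cmod z"
  shows "k *\<^sub>C (resolvent (c i) z - \<phi> (resolvent (c i) z) *\<^sub>C 1) \<in> centred_space c i"
proof -
  define d where "d n = k / z ^ Suc n" for n
  have s: "(\<lambda>n. (1 / z ^ Suc n) *\<^sub>C c i ^ n) sums resolvent (c i) z"
    by (rule neumann_series(1)[OF assms])
  have lin: "bounded_linear (\<lambda>x. k *\<^sub>C (x - \<phi> x *\<^sub>C 1))"
    by (intro bounded_linear_compose[OF bounded_linear_scaleC] bounded_linear_sub bounded_linear_ident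
        bounded_linear_compose[OF bounded_linear_scaleC_left bounded_linear_state])
  have "(\<lambda>n. k *\<^sub>C ((1 / z ^ Suc n) *\<^sub>C c i ^ n - \<phi> ((1 / z ^ Suc n) *\<^sub>C c i ^ n) *\<^sub>C 1)) sums
      (k *\<^sub>C (resolvent (c i) z - \<phi> (resolvent (c i) z) *\<^sub>C 1))"
    by (rule bounded_linear.sums[OF lin s])
  moreover have "k *\<^sub>C ((1 / z ^ Suc n) *\<^sub>C c i ^ n - \<phi> ((1 / z ^ Suc n) *\<^sub>C c i ^ n) *\<^sub>C 1) =
      d n *\<^sub>C centred_power c (i, n)" for n
    by (simp add: centred_power_def d_def state_scale complex_vector.scale_right_diff_distrib scaleC_scaleC)
  ultimately have "(\<lambda>m. \<Sum>n<m. d n *\<^sub>C centred_power c (i, n)) \<longlonglongrightarrow>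
      k *\<^sub>C (resolvent (c i) z - \<phi> (resolvent (c i) z) *\<^sub>C 1)"
    by (simp add: sums_def)
  moreover have "(\<Sum>n<m. d n *\<^sub>C centred_power c (i, n)) \<in> complex_span (range (\<lambda>n. centred_power c (i, n)))" for m
    by (intro complex_vector.span_sum complex_vector.span_scale complex_vector.span_base rangeI)
  ultimately show ?thesis
    unfolding centred_space_def closure_sequential
    by (intro exI[of _ "\<lambda>m. \<Sum>n<m. d n *\<^sub>C centred_power c (i, n)"] conjI allI)
qed

end


section \<open>Sums over alternating words\<close>

primrec alt_word :: "(bool \<Rightarrow> 'a) \<Rightarrow> bool \<Rightarrow> nat \<Rightarrow> (bool \<times> 'a) list" where
  "alt_word r i 0 = []"
| "alt_word r i (Suc k) = (i, r i) # alt_word r (\<not> i) k"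

text \<open>The reversal puts \<open>r i\<close> at the right end, in accordance with the order of
  factors in \<open>centred_moment\<close>.\<close>

definition alt_prod :: "(bool \<Rightarrow> 'a::monoid_mult) \<Rightarrow> bool \<Rightarrow> nat \<Rightarrow> 'a" where
  "alt_prod r i k = prod_list (map snd (rev (alt_word r i k)))"

definition alt_series :: "(bool \<Rightarrow> 'a::{real_normed_algebra_1, banach}) \<Rightarrow> bool \<Rightarrow> 'a" where
  "alt_series r i = suminf (alt_prod r i)"

text \<open>The empty word belongs to both series, hence the correction by 1.\<close>

definition alt_sum :: "(bool \<Rightarrow> 'a::{real_normed_algebra_1, banach}) \<Rightarrow> 'a" where
  "alt_sum r = alt_series r True + alt_series r False - 1"

lemma alt_prod_0 [simp]: "alt_prod r i 0 = 1"
  and alt_prod_Suc: "alt_prod r i (Suc k) = alt_prod r (\<not> i) k * r i"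
  by (simp_all add: alt_prod_def)

lemma successively_alt_word: "successively (\<noteq>) (map fst (alt_word r i k))"
proof (induction k arbitrary: i)
  case (Suc k)
  then show ?case by (cases k) (use Suc[of "\<not> i"] in simp_all)
qed simp

lemma set_alt_word: "\<forall>(i, x)\<in>set (alt_word r j k). x = r i"
  by (induction k arbitrary: j) auto

locale small_letters =
  fixes r :: "bool \<Rightarrow> 'a::{real_normed_algebra_1, banach}"
  assumes small: "norm (r i) \<le> 1 / 2"
begin

lemma norm_alt_prod: "norm (alt_prod r i k) \<le> (1 / 2) ^ k"
proof (induction k arbitrary: i)
  case (Suc k)
  have "norm (alt_prod r i (Suc k)) \<le> norm (alt_prod r (\<not> i) k) * norm (r i)"
    unfolding alt_prod_Suc by (rule norm_mult_ineq)
  also have "\<dots> \<le> (1 / 2) ^ k * (1 / 2)"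
    by (intro mult_mono Suc small) simp_all
  finally show ?case by simp
qed simp

lemma alt_series_sums: "alt_prod r i sums alt_series r i"
  unfolding alt_series_def
  by (rule summable_sums, rule summable_comparison_test[where g = "\<lambda>k. (1 / 2) ^ k"])
    (use norm_alt_prod in \<open>auto intro: summable_geometric\<close>)

lemma alt_series_step: "alt_series r i = 1 + alt_series r (\<not> i) * r i"
proof -
  have "(\<lambda>k. alt_prod r i (Suc k)) sums (alt_series r i - 1)"
    using alt_series_sums[of i] by (simp add: sums_Suc_iff)
  moreover have "(\<lambda>k. alt_prod r i (Suc k)) sums (alt_series r (\<not> i) * r i)"
    unfolding alt_prod_Suc by (rule sums_mult2[OF alt_series_sums])
  ultimately show ?thesis by (metis sums_unique2 add_diff_cancel_left' diff_add_cancel add.commute)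
qed

text \<open>Deleting a final letter \<open>r i\<close>, if there is one, leaves a word that is empty
  or ends with the other letter.\<close>

lemma alt_sum_factor: "alt_sum r = alt_series r (\<not> i) * (1 + r i)"
  using alt_series_step[of True] alt_series_step[of False]
  by (cases i) (simp_all add: alt_sum_def algebra_simps)

text \<open>If \<open>u i\<close> is the inverse of \<open>1 + r i\<close>, then \<open>alt_sum r * u i\<close> is the series over the words
  whose last letter is not \<open>r i\<close>, and adding the two series counts the empty word twice.\<close>

lemma alt_sum_left_inverse:
  assumes "\<And>i. (1 + r i) * u i = 1"
  shows "alt_sum r * (u True + u False - 1) = 1"
proof -
  have "alt_sum r * u i = alt_series r (\<not> i)" for i
    unfolding alt_sum_factor[of i] mult.assoc assms by simp
  from this[of True] this[of False] show ?thesis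
    by (simp add: distrib_left right_diff_distrib) (simp add: alt_sum_def)
qed

end

text \<open>The inverse of \<open>1 + ?r i\<close> is \<open>?u i\<close>, and the equation for
  \<omega> turns \<open>?u True + ?u False - 1\<close> into \<open>g\<close> times z minus the sum.
  This gives a left inverse of an element already known to be invertible.\<close>

lemma resolvent_sum_eq_alt_sum:
  fixes a :: "bool \<Rightarrow> 'a::cstar_algebra"
  assumes sa: "\<And>i. self_adjoint (a i)" and z: "Im z \<noteq> 0" and \<omega>: "\<And>i. Im (\<omega> i) \<noteq> 0"
    and g: "g \<noteq> 0" "\<omega> True + \<omega> False - z = 1 / g"
    and small: "\<And>i. norm ((1 / g) *\<^sub>C resolvent (a i) (\<omega> i) - 1) \<le> 1 / 2"
  shows "resolvent (a True + a False) z = g *\<^sub>C alt_sum (\<lambda>i. (1 / g) *\<^sub>C resolvent (a i) (\<omega> i) - 1)"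
    (is "_ = g *\<^sub>C alt_sum ?r")
proof -
  interpret small_letters ?r by standard (rule small)
  let ?u = "\<lambda>i. g *\<^sub>C (\<omega> i *\<^sub>C 1 - a i)"
  have "(1 + ?r i) * ?u i = 1" for i
    using g(1) resolvent_inverse[OF sa \<omega>, of i]
    by (simp add: scaleC_mult_left scaleC_mult_right scaleC_scaleC scaleC_one)
  then have "alt_sum ?r * (?u True + ?u False - 1) = 1"
    by (rule alt_sum_left_inverse)
  also have "?u True + ?u False - 1 = g *\<^sub>C ((\<omega> True + \<omega> False) *\<^sub>C 1 - (a True + a False)) - 1"
    by (simp add: scaleC_add_left scaleC_add_right complex_vector.scale_right_diff_distrib)
  also have "\<omega> True + \<omega> False = z + 1 / g" using g(2) by (simp add: algebra_simps)
  also have "g *\<^sub>C ((z + 1 / g) *\<^sub>C 1 - (a True + a False)) - 1 = g *\<^sub>C (z *\<^sub>C 1 - (a True + a False))"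
    using g(1) by (simp add: scaleC_add_left scaleC_add_right complex_vector.scale_right_diff_distrib
        scaleC_scaleC scaleC_one)
  finally have left: "g *\<^sub>C alt_sum ?r * (z *\<^sub>C 1 - (a True + a False)) = 1"
    by (simp add: scaleC_mult_left scaleC_mult_right)
  have "self_adjoint (a True + a False)"
    using sa by (simp add: self_adjoint_def star_add)
  note right = resolvent_inverse(1)[OF this z]
  have "g *\<^sub>C alt_sum ?r = g *\<^sub>C alt_sum ?r * ((z *\<^sub>C 1 - (a True + a False)) * resolvent (a True + a False) z)"
    by (simp only: right mult_1_right)
  also have "\<dots> = resolvent (a True + a False) z"
    by (simp only: mult.assoc[symmetric] left mult_1_left)
  finally show ?thesis by (rule sym)
qed

context bi_free_model
begin

lemma alt_sum_moment:
  assumes r: "\<And>i. r i \<in> centred_space a i" "\<And>i. norm (r i) \<le> 1 / 2"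
    and s: "\<And>i. s i \<in> centred_space b i" "\<And>i. norm (s i) \<le> 1 / 2"
  defines "c \<equiv> \<phi> (alt_sum r * alt_sum s)" and "m \<equiv> \<lambda>i. 1 + \<phi> (r i * s i)"
  shows "c * (m True + m False - m True * m False) = m True * m False"
proof -
  interpret R: small_letters r by standard (rule r)
  interpret S: small_letters s by standard (rule s)
  \<comment> \<open>The pairing of two equal words of length \<open>k\<close> that start with index
    \<open>i\<close>: a product of \<open>k\<close> factors with alternating indices.\<close>
  define e where "e i = rec_nat (\<lambda>i. 1 :: complex) (\<lambda>_ f i. \<phi> (r i * s i) * f (\<not> i)) i" for i
  have e: "e 0 i = 1" "e (Suc k) i = \<phi> (r i * s i) * e k (\<not> i)" for k i
    by (simp_all add: e_def)
  have "word_pairing \<phi> (alt_word r i k) (alt_word s j l) = (if k = l \<and> (k = 0 \<or> i = j) then e k i else 0)"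
    for i j k l
  proof (induction k arbitrary: i j l)
    case 0
    then show ?case by (cases l) (simp_all add: e)
  next
    case (Suc k)
    show ?case by (cases l) (auto simp: e Suc)
  qed
  moreover have "\<phi> (alt_prod r i k * alt_prod s j l) = word_pairing \<phi> (alt_word r i k) (alt_word s j l)" for i j k l
    unfolding alt_prod_def
    using set_alt_word[of r i k] set_alt_word[of s j l] r(1) s(1)
    by (intro centred_moment successively_alt_word) auto
  ultimately have val: "\<phi> (alt_prod r i k * alt_prod s j l) = (if k = l \<and> (k = 0 \<or> i = j) then e k i else 0)"
    for i j k l by simp
  \<comment> \<open>Only the word of the same length contributes, and it must start with the same
    index unless it is empty.\<close>
  have row: "\<phi> (alt_series r i * alt_prod s j l) = (if l = 0 \<or> i = j then e l i else 0)" for i j l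
  proof -
    have lim: "(\<lambda>k. \<phi> (alt_prod r i k * alt_prod s j l)) sums \<phi> (alt_series r i * alt_prod s j l)"
      by (intro bounded_linear.sums[OF bounded_linear_state] sums_mult2 R.alt_series_sums)
    have "(\<lambda>k. \<phi> (alt_prod r i k * alt_prod s j l)) =
        (\<lambda>k. if k = l then (if l = 0 \<or> i = j then e l i else 0) else 0)"
      by (auto simp: val)
    then show ?thesis
      using lim sums_single[of l "\<lambda>_. if l = 0 \<or> i = j then e l i else 0"]
      by (simp only: sums_unique2)
  qed
  \<comment> \<open>Among all alternating words exactly one matches a given one, so the two rows
    minus the doubly counted empty word give a single term.\<close>
  have sum_row: "\<phi> (alt_sum r * alt_prod s j l) = e l j" for j l
  proof -
    have "\<phi> (alt_sum r * alt_prod s j l) =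
        \<phi> (alt_series r True * alt_prod s j l) + \<phi> (alt_series r False * alt_prod s j l) - \<phi> (alt_prod s j l)"
      by (simp add: alt_sum_def distrib_right left_diff_distrib state_add state_diff)
    then show ?thesis
      using val[of True 0 j l] by (auto simp: row e)
  qed
  define E where "E j = \<phi> (alt_sum r * alt_series s j)" for j
  have sums: "(\<lambda>l. e l j) sums E j" for j
    using bounded_linear.sums[OF bounded_linear_state sums_mult[OF S.alt_series_sums[of j], of "alt_sum r"]]
    by (simp add: sum_row E_def)
  have step: "E j = 1 + \<phi> (r j * s j) * E (\<not> j)" for j
  proof -
    have "(\<lambda>l. e (Suc l) j) sums (E j - 1)"
      using sums[of j] by (simp add: sums_Suc_iff[of "\<lambda>l. e l j"] e(1))
    moreover have "(\<lambda>l. e (Suc l) j) sums (\<phi> (r j * s j) * E (\<not> j))"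
      unfolding e by (rule sums_mult[OF sums])
    ultimately have "E j - 1 = \<phi> (r j * s j) * E (\<not> j)" by (rule sums_unique2)
    then show ?thesis by (simp add: algebra_simps)
  qed
  have c: "c = E True + E False - 1"
    using sum_row[of True 0]
    by (simp add: c_def alt_sum_def[of s] distrib_left right_diff_distrib state_add state_diff E_def e)
  have "c = m True * E False"
    using c step[of True] by (simp add: m_def distrib_right)
  moreover have "c = m False * E True"
    using c step[of False] by (simp add: m_def distrib_right)
  \<comment> \<open>Elimination without division: m1 m2 (E1 + E2) equals c (m1 + m2) by the last two
    equations, and E1 + E2 is c + 1.\<close>
  ultimately show ?thesis
    using c by algebra
qed

text \<open>Multiplication by \<open>\<omega> * ?g\<close> turns the normalised centred resolvent
  into the centred version of \<open>x * ?R\<close>. The constant 5 gives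
  \<open>norm (x * ?R) \<le> 1 / 5\<close>, hence at most 2/5 for the latter and at least 4/5 for
  the modulus of the factor. The summand 1 keeps \<open>Im \<omega>\<close> positive for
  \<open>x = 0\<close>.\<close>

lemma normalised_resolvent_small:
  assumes "self_adjoint x" "Im \<omega> \<ge> 5 * norm x + 1"
  shows "cauchy1 \<phi> x \<omega> \<noteq> 0" "norm ((1 / cauchy1 \<phi> x \<omega>) *\<^sub>C resolvent x \<omega> - 1) \<le> 1 / 2"
proof -
  let ?R = "resolvent x \<omega>" and ?g = "cauchy1 \<phi> x \<omega>"
  have pos: "Im \<omega> > 0" using assms(2) norm_ge_zero[of x] by linarith
  have "norm (x * ?R) \<le> norm x * (1 / Im \<omega>)"
    using norm_mult_ineq[of x ?R] mult_left_mono[OF norm_resolvent_le[OF assms(1) pos], of "norm x"] by simp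
  also have "\<dots> \<le> 1 / 5" using assms(2) pos by (simp add: field_simps)
  finally have small: "norm (x * ?R) \<le> 1 / 5" .
  have \<omega>R: "\<omega> *\<^sub>C ?R = 1 + x * ?R"
    using resolvent_inverse(1)[OF assms(1), of \<omega>] pos by (simp add: left_diff_distrib scaleC_mult_left algebra_simps)
  have \<omega>g: "\<omega> * ?g = 1 + \<phi> (x * ?R)"
    unfolding cauchy1_def state_scale[symmetric] \<omega>R by (simp add: state_add)
  have "cmod (\<phi> (x * ?R)) \<le> 1 / 5" using norm_le[of "x * ?R"] small by linarith
  then have low: "cmod (\<omega> * ?g) \<ge> 4 / 5"
    unfolding \<omega>g using norm_triangle_ineq2[of 1 "- \<phi> (x * ?R)"] by simp
  then show g: "?g \<noteq> 0" by auto
  have \<omega>0: "\<omega> \<noteq> 0" using pos by auto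
  have "(\<omega> * ?g) *\<^sub>C ((1 / ?g) *\<^sub>C ?R - 1) = \<omega> *\<^sub>C ?R - (\<omega> * ?g) *\<^sub>C 1"
    using g by (simp add: complex_vector.scale_right_diff_distrib scaleC_scaleC)
  also have "\<dots> = x * ?R - \<phi> (x * ?R) *\<^sub>C 1"
    unfolding \<omega>R \<omega>g by (simp add: scaleC_add_left scaleC_one)
  finally have "cmod (\<omega> * ?g) * norm ((1 / ?g) *\<^sub>C ?R - 1) = norm (x * ?R - \<phi> (x * ?R) *\<^sub>C 1)"
    by (simp only: norm_scaleC[symmetric])
  also have "\<dots> \<le> norm (x * ?R) + cmod (\<phi> (x * ?R))"
    using norm_triangle_ineq4[of "x * ?R" "\<phi> (x * ?R) *\<^sub>C 1"] by (simp add: norm_scaleC)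
  also have "\<dots> \<le> 2 / 5" using small norm_le[of "x * ?R"] by simp
  finally have "4 / 5 * norm ((1 / ?g) *\<^sub>C ?R - 1) \<le> 2 / 5"
    using mult_right_mono[OF low, of "norm ((1 / ?g) *\<^sub>C ?R - 1)"] by simp
  then show "norm ((1 / ?g) *\<^sub>C ?R - 1) \<le> 1 / 2" by simp
qed

text \<open>\<open>alt_sum_moment\<close> with denominators cleared: in this form both sides are
  holomorphic in each variable, ready for continuation.\<close>

lemma subordination_identity_near_infinity:
  assumes sa: "\<And>i. self_adjoint (a i)" "\<And>i. self_adjoint (b i)"
    and z: "Im z \<noteq> 0" "Im w \<noteq> 0"
    and large: "\<And>i. Im (\<alpha> i) \<ge> 5 * norm (a i) + 1" "\<And>i. Im (\<beta> i) \<ge> 5 * norm (b i) + 1"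
    and g: "\<alpha> True + \<alpha> False - z = 1 / g" "\<And>i. cauchy1 \<phi> (a i) (\<alpha> i) = g"
    and h: "\<beta> True + \<beta> False - w = 1 / h" "\<And>i. cauchy1 \<phi> (b i) (\<beta> i) = h"
  defines "G \<equiv> cauchy2 \<phi> (a True + a False, b True + b False) z w"
    and "K \<equiv> \<lambda>i. cauchy2 \<phi> (a i, b i) (\<alpha> i) (\<beta> i)"
  shows "G * (g * h * (K True + K False) - K True * K False) = g * h * (K True * K False)"
proof -
  define r where "r i = (1 / g) *\<^sub>C resolvent (a i) (\<alpha> i) - 1" for i
  define s where "s i = (1 / h) *\<^sub>C resolvent (b i) (\<beta> i) - 1" for i
  have [simp]: "g \<noteq> 0" "h \<noteq> 0"
    using normalised_resolvent_small(1)[OF sa(1) large(1)] normalised_resolvent_small(1)[OF sa(2) large(2)] g h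
    by metis+
  have r: "norm (r i) \<le> 1 / 2" and s: "norm (s i) \<le> 1 / 2" for i
    unfolding r_def s_def
    using normalised_resolvent_small(2)[OF sa(1) large(1), of i] normalised_resolvent_small(2)[OF sa(2) large(2), of i] g h
    by metis+
  have big: "norm (a i) < cmod (\<alpha> i)" "norm (b i) < cmod (\<beta> i)" for i
    using large[of i] abs_Im_le_cmod[of "\<alpha> i"] abs_Im_le_cmod[of "\<beta> i"] norm_ge_zero[of "a i"] norm_ge_zero[of "b i"]
    by linarith+
  have cen: "r i \<in> centred_space a i" "s i \<in> centred_space b i" for i
    using resolvent_centred[of a i "\<alpha> i" "1 / g"] resolvent_centred[of b i "\<beta> i" "1 / h"] big[of i] g(2)[of i] h(2)[of i]
    by (simp_all add: r_def s_def cauchy1_def complex_vector.scale_right_diff_distrib scaleC_scaleC scaleC_one)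
  have cen0: "\<phi> (r i) = 0" "\<phi> (s i) = 0" for i
    using g(2)[of i] h(2)[of i] by (simp_all add: r_def s_def state_diff state_scale cauchy1_def)
  have "1 + \<phi> (r i * s i) = \<phi> ((1 + r i) * (1 + s i))" for i
    by (simp add: distrib_left distrib_right state_add cen0)
  also have "\<phi> ((1 + r i) * (1 + s i)) = K i / (g * h)" for i
    by (simp add: r_def s_def K_def cauchy2_def scaleC_mult_left scaleC_mult_right scaleC_scaleC state_scale)
  finally have m: "1 + \<phi> (r i * s i) = K i / (g * h)" for i .
  have pos: "Im (\<alpha> i) \<noteq> 0" "Im (\<beta> i) \<noteq> 0" for i
    using large[of i] norm_ge_zero[of "a i"] norm_ge_zero[of "b i"] by linarith+
  have "resolvent (a True + a False) z = g *\<^sub>C alt_sum r" "resolvent (b True + b False) w = h *\<^sub>C alt_sum s"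
    unfolding r_def s_def
    using r s g h z pos sa by (intro resolvent_sum_eq_alt_sum; simp add: r_def s_def)+
  then have c: "\<phi> (alt_sum r * alt_sum s) = G / (g * h)"
    by (simp add: G_def cauchy2_def scaleC_mult_left scaleC_mult_right scaleC_scaleC state_scale)
  define N where "N = g * h"
  have [simp]: "N \<noteq> 0" by (simp add: N_def)
  have "G / N * (K True / N + K False / N - K True / N * (K False / N)) = K True / N * (K False / N)"
    using alt_sum_moment[of r s, OF cen(1) r cen(2) s] unfolding m c N_def .
  moreover have "G / N * (K True / N + K False / N - K True / N * (K False / N)) =
      G * (N * (K True + K False) - K True * K False) / N ^ 3"
    by (simp add: power3_eq_cube divide_simps)
  moreover have "K True / N * (K False / N) = N * (K True * K False) / N ^ 3"
    by (simp add: power3_eq_cube)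
  ultimately show ?thesis
    by (simp add: N_def)
qed

end


section \<open>Analytic continuation of Cauchy transforms\<close>

lemma upper_half_plane_iff [simp]: "z \<in> \<complex>\<^sup>+ \<longleftrightarrow> Im z > 0"
  by (simp add: upper_half_plane_def)

lemma open_upper_half_plane: "open \<complex>\<^sup>+"
  unfolding upper_half_plane_def by (rule open_halfspace_Im_gt)

lemma continuation_upper_half_plane:
  assumes "f holomorphic_on \<complex>\<^sup>+" "g holomorphic_on \<complex>\<^sup>+" "C \<ge> 0"
    and eq: "\<And>z. Im z > C \<Longrightarrow> f z = g z" and "Im z > 0"
  shows "f z = g z"
proof (rule analytic_continuation_open[of "{z. Im z > C}" "\<complex>\<^sup>+" f g z])
  have "\<i> * complex_of_real (C + 1) \<in> {z. Im z > C}" by simp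
  then show "{z. Im z > C} \<noteq> {}" by blast
  show "connected \<complex>\<^sup>+" unfolding upper_half_plane_def by (rule connected_halfspace_Im_gt)
qed (use assms in \<open>auto simp: open_halfspace_Im_gt open_upper_half_plane\<close>)

text \<open>The remainder bound has the factor \<open>1 / Im w\<close> because resolvents and Cauchy
  kernels both obey it; the criterion serves for either.\<close>

lemma holomorphic_upper_half_planeI:
  assumes expansion: "\<And>z w. Im z > 0 \<Longrightarrow> Im w > 0 \<Longrightarrow> f w - f z = (w - z) * D z + (w - z)\<^sup>2 * E z w"
    and bound: "\<And>z w. Im z > 0 \<Longrightarrow> Im w > 0 \<Longrightarrow> cmod (E z w) \<le> C z * (1 / Im w)"
  shows "f holomorphic_on \<complex>\<^sup>+"
  unfolding holomorphic_on_open[OF open_upper_half_plane]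
proof
  fix z assume "z \<in> \<complex>\<^sup>+"
  then have z: "Im z > 0" by simp
  have near: "eventually (\<lambda>w. w \<in> \<complex>\<^sup>+ \<and> w \<noteq> z) (at z)"
    using z by (intro eventually_conj eventually_at_in_open' open_upper_half_plane)
      (auto simp: eventually_at_filter)
  have "((\<lambda>w. cmod (w - z) * (C z * (1 / Im w))) \<longlongrightarrow> cmod (z - z) * (C z * (1 / Im z))) (at z)"
    using z by (intro tendsto_intros) auto
  then have lim0: "((\<lambda>w. cmod (w - z) * (C z * (1 / Im w))) \<longlongrightarrow> 0) (at z)" by simp
  have "((\<lambda>w. (w - z) * E z w) \<longlongrightarrow> 0) (at z)"
  proof (rule Lim_null_comparison[OF _ lim0])
    show "eventually (\<lambda>w. norm ((w - z) * E z w) \<le> cmod (w - z) * (C z * (1 / Im w))) (at z)"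
      using near
    proof eventually_elim
      case (elim w)
      then have "cmod (E z w) \<le> C z * (1 / Im w)" using bound z by simp
      then show ?case unfolding norm_mult by (rule mult_left_mono) simp
    qed
  qed
  from tendsto_add[OF tendsto_const[of "D z"] this]
  have "((\<lambda>w. D z + (w - z) * E z w) \<longlongrightarrow> D z) (at z)" by simp
  moreover have "eventually (\<lambda>w. D z + (w - z) * E z w = (f w - f z) / (w - z)) (at z)"
    using near by eventually_elim (use z in \<open>auto simp: expansion power2_eq_square add_divide_distrib\<close>)
  ultimately have "((\<lambda>w. (f w - f z) / (w - z)) \<longlongrightarrow> D z) (at z)"
    by (rule Lim_transform_eventually)
  then show "\<exists>f'. (f has_field_derivative f') (at z)"
    by (auto simp: has_field_derivative_iff)
qed

context cstar_state
begin

lemma holomorphic_resolvent: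
  assumes a: "self_adjoint a"
  shows "(\<lambda>z. \<phi> (x * resolvent a z * y)) holomorphic_on \<complex>\<^sup>+"
proof -
  let ?R = "resolvent a"
  \<comment> \<open>The resolvent identity inserted into itself once.\<close>
  have expand: "?R w - ?R z = (w - z) *\<^sub>C (- (?R z * ?R z)) + (w - z)\<^sup>2 *\<^sub>C (?R w * ?R z * ?R z)"
    if "Im z > 0" "Im w > 0" for z w
  proof -
    have sq: "(w - z)\<^sup>2 = (z - w) * (z - w)"
      by (simp add: power2_eq_square algebra_simps)
    have wz: "?R w - ?R z = (z - w) *\<^sub>C (?R w * ?R z)"
      using a that by (intro resolvent_identity) auto
    have "?R w * ?R z = ?R z * ?R z + (z - w) *\<^sub>C (?R w * ?R z * ?R z)"
      using arg_cong[OF wz, of "\<lambda>u. u * ?R z"] by (simp add: left_diff_distrib scaleC_mult_left algebra_simps)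
    then have "?R w - ?R z = (z - w) *\<^sub>C (?R z * ?R z + (z - w) *\<^sub>C (?R w * ?R z * ?R z))"
      using wz by simp
    also have "\<dots> = (z - w) *\<^sub>C (?R z * ?R z) + (w - z)\<^sup>2 *\<^sub>C (?R w * ?R z * ?R z)"
      by (simp only: scaleC_add_right scaleC_scaleC sq)
    also have "(z - w) *\<^sub>C (?R z * ?R z) = (w - z) *\<^sub>C (- (?R z * ?R z))"
      by (simp add: complex_vector.scale_left_diff_distrib complex_vector.scale_minus_right)
    finally show ?thesis .
  qed
  show ?thesis
  proof (rule holomorphic_upper_half_planeI)
    fix z w :: complex assume z: "Im z > 0" and w: "Im w > 0"
    have "\<phi> (x * ?R w * y) - \<phi> (x * ?R z * y) = \<phi> (x * (?R w - ?R z) * y)"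
      by (simp add: left_diff_distrib right_diff_distrib state_diff)
    then show "\<phi> (x * ?R w * y) - \<phi> (x * ?R z * y) =
        (w - z) * \<phi> (x * (- (?R z * ?R z)) * y) + (w - z)\<^sup>2 * \<phi> (x * (?R w * ?R z * ?R z) * y)"
      unfolding expand[OF z w]
      by (simp only: distrib_left distrib_right state_add scaleC_mult_left scaleC_mult_right state_scale)
  next
    fix z w :: complex assume z: "Im z > 0" and w: "Im w > 0"
    have "cmod (\<phi> (x * (?R w * ?R z * ?R z) * y)) \<le> norm (x * (?R w * ?R z * ?R z) * y)"
      by (rule norm_le)
    also have "\<dots> \<le> norm x * (norm (?R w) * norm (?R z) * norm (?R z)) * norm y"
      by (intro order_trans[OF norm_mult_ineq] mult_mono order_refl mult_nonneg_nonneg norm_ge_zero)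
    also have "\<dots> = norm x * norm y * (norm (?R z))\<^sup>2 * norm (?R w)"
      by (simp add: power2_eq_square)
    also have "\<dots> \<le> norm x * norm y * (norm (?R z))\<^sup>2 * (1 / Im w)"
      by (intro mult_left_mono norm_resolvent_le a w) simp
    finally show "cmod (\<phi> (x * (?R w * ?R z * ?R z) * y)) \<le> norm x * norm y * (norm (?R z))\<^sup>2 * (1 / Im w)" .
  qed
qed

end

section \<open>Cauchy integrals of measures\<close>

lemma norm_cauchy_kernel_le:
  assumes "Im z > 0"
  shows "cmod (1 / (z - complex_of_real t)) \<le> 1 / Im z"
proof -
  have "Im z \<le> cmod (z - complex_of_real t)"
    using abs_Im_le_cmod[of "z - complex_of_real t"] by simp
  then show ?thesis using assms by (simp add: norm_divide frac_le)
qed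

text \<open>\<open>u\<close> is the coordinate being transformed and \<open>h\<close> the rest of
  the integrand: a power of the first coordinate in one application, a Cauchy kernel of the second
  coordinate in the other.\<close>

locale bounded_kernel = prob_space M for M :: "'p measure" +
  fixes h :: "'p \<Rightarrow> complex" and u :: "'p \<Rightarrow> real" and H B :: real
  assumes meas_h [measurable]: "h \<in> borel_measurable M" and meas_u [measurable]: "u \<in> borel_measurable M"
    and bound_h: "AE p in M. cmod (h p) \<le> H" and bound_u: "AE p in M. \<bar>u p\<bar> \<le> B"
begin

lemma H_nonneg: "H \<ge> 0"
proof -
  have "AE p in M. 0 \<le> H"
    using bound_h by eventually_elim (use norm_ge_zero order_trans in blast)
  then show ?thesis by (simp add: prob_space)
qed

lemma B_nonneg: "B \<ge> 0"
proof -
  have "AE p in M. 0 \<le> B"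
    using bound_u by eventually_elim (use abs_ge_zero order_trans in blast)
  then show ?thesis by (simp add: prob_space)
qed

lemma integrable_times:
  assumes "k \<in> borel_measurable M" "\<And>p. cmod (k p) \<le> K"
  shows "integrable M (\<lambda>p. h p * k p)"
proof (rule integrable_const_bound[where B = "H * K"])
  show "AE p in M. norm (h p * k p) \<le> H * K"
    using bound_h by eventually_elim (use assms(2) H_nonneg in \<open>auto simp: norm_mult intro!: mult_mono\<close>)
qed (use assms(1) in measurable)

lemma holomorphic_cauchy_integral:
  "(\<lambda>z. \<integral>p. h p * (1 / (z - complex_of_real (u p))) \<partial>M) holomorphic_on \<complex>\<^sup>+"
proof (rule holomorphic_upper_half_planeI)
  let ?k = "\<lambda>z p. 1 / (z - complex_of_real (u p))"
  fix z w :: complex assume z: "Im z > 0" and w: "Im w > 0"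
  have meas [measurable]: "?k z \<in> borel_measurable M" for z by measurable
  have kz: "cmod (?k z p) \<le> 1 / Im z" and kw: "cmod (?k w p) \<le> 1 / Im w" for p
    using norm_cauchy_kernel_le z w by blast+
  have b2: "cmod (?k z p * ?k z p) \<le> 1 / Im z * (1 / Im z)" for p
    unfolding norm_mult by (intro mult_mono kz) (use z in auto)
  have b3: "cmod (?k z p * ?k z p * ?k w p) \<le> 1 / Im z * (1 / Im z) * (1 / Im w)" for p
    unfolding norm_mult[of "?k z p * ?k z p"] by (intro mult_mono b2 kw) (use z in auto)
  have int: "integrable M (\<lambda>p. h p * ?k z p)" "integrable M (\<lambda>p. h p * ?k w p)"
    "integrable M (\<lambda>p. h p * (?k z p * ?k z p))" "integrable M (\<lambda>p. h p * (?k z p * ?k z p * ?k w p))"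
    by (rule integrable_times[OF _ kz] integrable_times[OF _ kw] integrable_times[OF _ b2] integrable_times[OF _ b3],
        measurable)+
  have lincomb: "(\<integral>p. c * - F p + d * G p \<partial>M) = c * - (\<integral>p. F p \<partial>M) + d * (\<integral>p. G p \<partial>M)"
    if "integrable M F" "integrable M G" for F G :: "'p \<Rightarrow> complex" and c d
    using that by simp
  have "h p * ?k w p - h p * ?k z p = (w - z) * - (h p * (?k z p * ?k z p)) + (w - z)\<^sup>2 * (h p * (?k z p * ?k z p * ?k w p))" for p
  proof -
    have "z - complex_of_real (u p) \<noteq> 0" "w - complex_of_real (u p) \<noteq> 0"
      using z w by (auto simp: complex_eq_iff)
    then have "?k w p - ?k z p = (w - z) * - (?k z p * ?k z p) + (w - z)\<^sup>2 * (?k z p * ?k z p * ?k w p)"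
      by (simp add: divide_simps power2_eq_square) (simp add: algebra_simps)
    then have "h p * (?k w p - ?k z p) = h p * ((w - z) * - (?k z p * ?k z p) + (w - z)\<^sup>2 * (?k z p * ?k z p * ?k w p))"
      by simp
    then show ?thesis by (simp only: algebra_simps mult_minus_right mult_minus_left)
  qed
  then have "(\<integral>p. h p * ?k w p \<partial>M) - (\<integral>p. h p * ?k z p \<partial>M) =
      (\<integral>p. (w - z) * - (h p * (?k z p * ?k z p)) + (w - z)\<^sup>2 * (h p * (?k z p * ?k z p * ?k w p)) \<partial>M)"
    unfolding Bochner_Integration.integral_diff[OF int(2,1), symmetric] by (simp only:)
  also have "\<dots> = (w - z) * - (\<integral>p. h p * (?k z p * ?k z p) \<partial>M) + (w - z)\<^sup>2 * (\<integral>p. h p * (?k z p * ?k z p * ?k w p) \<partial>M)"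
    by (rule lincomb[OF int(3,4)])
  finally show "(\<integral>p. h p * ?k w p \<partial>M) - (\<integral>p. h p * ?k z p \<partial>M) = \<dots>" .
  have "cmod (\<integral>p. h p * (?k z p * ?k z p * ?k w p) \<partial>M) \<le> (\<integral>p. cmod (h p * (?k z p * ?k z p * ?k w p)) \<partial>M)"
    by (rule integral_norm_bound)
  also have "\<dots> \<le> (\<integral>p. H * (1 / Im z * (1 / Im z) * (1 / Im w)) \<partial>M)"
  proof (rule integral_mono_AE)
    show "AE p in M. cmod (h p * (?k z p * ?k z p * ?k w p)) \<le> H * (1 / Im z * (1 / Im z) * (1 / Im w))"
      using bound_h by eventually_elim
        (unfold norm_mult[of "h _"], intro mult_mono b3, use H_nonneg in auto)
  qed (use integrable_norm[OF int(4)] in simp_all)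
  finally show "cmod (\<integral>p. h p * (?k z p * ?k z p * ?k w p) \<partial>M) \<le> H * (1 / Im z * (1 / Im z)) * (1 / Im w)"
    by (simp add: prob_space)
qed

lemma cauchy_integral_sums:
  assumes z: "B < cmod z"
  shows "(\<lambda>n. (1 / z ^ Suc n) * (\<integral>p. h p * complex_of_real (u p ^ n) \<partial>M)) sums
    (\<integral>p. h p * (1 / (z - complex_of_real (u p))) \<partial>M)"
proof -
  define f where "f n p = (1 / z ^ Suc n) * (h p * complex_of_real (u p ^ n))" for n p
  define q where "q = B / cmod z"
  have q: "0 \<le> q" "q < 1" using z B_nonneg by (auto simp: q_def divide_simps)
  have z0: "z \<noteq> 0" using z B_nonneg by auto
  have ae: "AE p in M. cmod (f n p) \<le> H / cmod z * q ^ n" for n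
    using bound_h bound_u
  proof eventually_elim
    case (elim p)
    have "cmod (h p) * \<bar>u p\<bar> ^ n \<le> H * B ^ n"
      by (intro mult_mono power_mono elim H_nonneg) auto
    then show ?case
      using z0 by (simp add: f_def q_def norm_mult norm_divide norm_power power_divide field_simps)
  qed
  have meas: "f n \<in> borel_measurable M" for n unfolding f_def by measurable
  have int: "integrable M (f n)" for n
    by (rule integrable_const_bound[OF ae meas])
  have geo: "summable (\<lambda>n. H / cmod z * q ^ n)"
    using q by (intro summable_mult summable_geometric) simp
  have "(\<lambda>n. integral\<^sup>L M (f n)) sums (\<integral>p. suminf (\<lambda>n. f n p) \<partial>M)"
  proof (rule sums_integral[OF int])
    have "AE p in M. \<forall>n. cmod (f n p) \<le> H / cmod z * q ^ n" using ae by (simp add: AE_all_countable)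
    then show "AE p in M. summable (\<lambda>n. norm (f n p))"
      by eventually_elim (rule summable_comparison_test'[OF geo, of 0], simp)
    show "summable (\<lambda>n. \<integral>p. norm (f n p) \<partial>M)"
    proof (rule summable_comparison_test'[OF geo, of 0])
      fix n :: nat
      have "(\<integral>p. norm (f n p) \<partial>M) \<le> (\<integral>p. H / cmod z * q ^ n \<partial>M)"
        by (rule integral_mono_AE) (use int ae in auto)
      then show "norm (\<integral>p. norm (f n p) \<partial>M) \<le> H / cmod z * q ^ n"
        by (simp add: prob_space)
    qed
  qed
  also have "(\<integral>p. suminf (\<lambda>n. f n p) \<partial>M) = (\<integral>p. h p * (1 / (z - complex_of_real (u p))) \<partial>M)"
  proof (rule integral_cong_AE)
    show "AE p in M. suminf (\<lambda>n. f n p) = h p * (1 / (z - complex_of_real (u p)))"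
      using bound_u
    proof eventually_elim
      case (elim p)
      then have small: "cmod (complex_of_real (u p) / z) < 1"
        using z B_nonneg by (simp add: norm_divide divide_simps)
      have "z \<noteq> complex_of_real (u p)" using elim z by auto
      then have val: "h p / z * (1 / (1 - complex_of_real (u p) / z)) = h p * (1 / (z - complex_of_real (u p)))"
        using z0 by (simp add: divide_simps)
      have "(\<lambda>n. h p / z * (complex_of_real (u p) / z) ^ n) sums (h p / z * (1 / (1 - complex_of_real (u p) / z)))"
        by (intro sums_mult geometric_sums small)
      moreover have "h p / z * (complex_of_real (u p) / z) ^ n = f n p" for n
        by (simp add: f_def power_divide)
      ultimately show ?case using val by (simp add: sums_iff)
    qed
  qed (unfold f_def, measurable)
  finally show ?thesis
    by (simp add: f_def integral_mult_right_zero del: power_Suc of_real_power)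
qed

end

text \<open>Equal moments give equal expansions at infinity, and both sides are holomorphic on the
  half-plane. The outer factors \<open>x\<close> and \<open>y\<close> leave room for the other
  variable.\<close>

lemma (in cstar_state) state_resolvent_eq_integral:
  assumes "bounded_kernel M h u H B" and a: "self_adjoint a"
    and mom: "\<And>n. \<phi> (x * a ^ n * y) = (\<integral>p. h p * complex_of_real (u p ^ n) \<partial>M)"
    and z: "Im z > 0"
  shows "\<phi> (x * resolvent a z * y) = (\<integral>p. h p * (1 / (z - complex_of_real (u p))) \<partial>M)"
proof -
  interpret bounded_kernel M h u H B by fact
  show ?thesis
  proof (rule continuation_upper_half_plane[where C = "norm a + B"
        and f = "\<lambda>z. \<phi> (x * resolvent a z * y)" and g = "\<lambda>z. \<integral>p. h p * (1 / (z - complex_of_real (u p))) \<partial>M"])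
    fix z assume "Im z > norm a + B"
    then have "norm a < cmod z" "B < cmod z"
      using abs_Im_le_cmod[of z] B_nonneg norm_ge_zero[of a] by linarith+
    then have "(\<lambda>n. (1 / z ^ Suc n) * \<phi> (x * a ^ n * y)) sums (\<integral>p. h p * (1 / (z - complex_of_real (u p))) \<partial>M)"
      unfolding mom by (intro cauchy_integral_sums)
    moreover have "(\<lambda>n. \<phi> (x * ((1 / z ^ Suc n) *\<^sub>C a ^ n) * y)) sums \<phi> (x * resolvent a z * y)"
      by (intro bounded_linear.sums[OF bounded_linear_state] sums_mult sums_mult2 neumann_series(1)) fact
    ultimately show "\<phi> (x * resolvent a z * y) = (\<integral>p. h p * (1 / (z - complex_of_real (u p))) \<partial>M)"
      by (simp only: scaleC_mult_left scaleC_mult_right state_scale sums_unique2)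
  next
    show "norm a + B \<ge> 0" using B_nonneg by simp
  qed (rule holomorphic_resolvent[OF a] holomorphic_cauchy_integral z)+
qed

text \<open>One variable at a time: \<open>b\<close> is passed to its resolvent behind the fixed
  power \<open>a ^ n\<close>, then \<open>a\<close> in front of the fixed
  \<open>resolvent b w\<close>.\<close>

lemma (in cstar_state) cauchy_measure_eq:
  assumes sa: "self_adjoint a" "self_adjoint b" and \<eta>: "is_distribution \<phi> (a, b) \<eta>"
    and z: "Im z > 0" and w: "Im w > 0"
  shows "cauchy_measure \<eta> z w = cauchy2 \<phi> (a, b) z w"
proof -
  interpret prob_space \<eta> using \<eta> by (simp add: is_distribution_def)
  have sets [measurable_cong]: "sets \<eta> = sets borel" using \<eta> by (simp add: is_distribution_def)
  obtain K where "compact K" and K: "AE p in \<eta>. p \<in> K" using \<eta> by (auto simp: is_distribution_def)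
  then obtain B where B: "\<And>p. p \<in> K \<Longrightarrow> norm p \<le> B"
    using compact_imp_bounded bounded_iff by metis
  have bound: "AE p in \<eta>. \<bar>fst p\<bar> \<le> B" "AE p in \<eta>. \<bar>snd p\<bar> \<le> B"
  proof -
    have "\<bar>fst p\<bar> \<le> B \<and> \<bar>snd p\<bar> \<le> B" if "p \<in> K" for p
      using B[OF that] norm_fst_le[of "fst p" "snd p"] norm_snd_le[of "snd p" "fst p"] by simp
    with K show "AE p in \<eta>. \<bar>fst p\<bar> \<le> B" "AE p in \<eta>. \<bar>snd p\<bar> \<le> B"
      by (auto elim: eventually_mono)
  qed
  have [measurable]: "(fst :: real \<times> real \<Rightarrow> real) \<in> borel_measurable \<eta>" "(snd :: real \<times> real \<Rightarrow> real) \<in> borel_measurable \<eta>"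
    unfolding measurable_cong_sets[OF sets refl] by (simp_all add: borel_measurable_continuous_onI continuous_intros)
  have moment: "\<phi> (a ^ n * b ^ m * 1) = (\<integral>p. complex_of_real (fst p ^ n) * complex_of_real (snd p ^ m) \<partial>\<eta>)" for n m
    unfolding of_real_mult[symmetric] integral_complex_of_real
    using \<eta> by (simp add: is_distribution_def)
  have "\<phi> (a ^ n * resolvent b w * 1) = (\<integral>p. complex_of_real (fst p ^ n) * (1 / (w - complex_of_real (snd p))) \<partial>\<eta>)" for n
  proof (rule state_resolvent_eq_integral[OF _ sa(2) moment w])
    show "bounded_kernel \<eta> (\<lambda>p. complex_of_real (fst p ^ n)) snd (B ^ n) B"
    proof unfold_locales
      show "AE p in \<eta>. cmod (complex_of_real (fst p ^ n)) \<le> B ^ n"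
        using bound(1) by eventually_elim (simp add: norm_power power_mono)
    qed (use bound in measurable)
  qed
  then have moment': "\<phi> (1 * a ^ n * resolvent b w) = (\<integral>p. (1 / (w - complex_of_real (snd p))) * complex_of_real (fst p ^ n) \<partial>\<eta>)" for n
    by (simp add: mult.commute)
  have "\<phi> (1 * resolvent a z * resolvent b w) =
      (\<integral>p. (1 / (w - complex_of_real (snd p))) * (1 / (z - complex_of_real (fst p))) \<partial>\<eta>)"
  proof (rule state_resolvent_eq_integral[OF _ sa(1) moment' z])
    show "bounded_kernel \<eta> (\<lambda>p. 1 / (w - complex_of_real (snd p))) fst (1 / Im w) B"
    proof unfold_locales
      show "AE p in \<eta>. cmod (1 / (w - complex_of_real (snd p))) \<le> 1 / Im w"
        using norm_cauchy_kernel_le[OF w] by simp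
    qed (use bound in measurable)
  qed
  then show ?thesis
    by (simp add: cauchy2_def cauchy_measure_def mult.commute)
qed


section \<open>Covariance bounds\<close>

context cstar_state
begin

text \<open>Both orders occur: Cauchy-Schwarz for \<open>star (resolvent a z)\<close> and
  \<open>resolvent b w\<close> yields one of each.\<close>

lemma state_resolvent_square:
  assumes a: "self_adjoint a" and z: "Im z > 0"
  shows "Re (\<phi> (star (resolvent a z) * resolvent a z)) = - Im (cauchy1 \<phi> a z) / Im z"
    and "Re (\<phi> (resolvent a z * star (resolvent a z))) = - Im (cauchy1 \<phi> a z) / Im z"
proof -
  let ?R = "resolvent a z"
  have "?R - star ?R = (cnj z - z) *\<^sub>C (?R * star ?R)" "star ?R - ?R = (z - cnj z) *\<^sub>C (star ?R * ?R)"
    using a z by (simp_all add: star_resolvent resolvent_identity)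
  then have "\<phi> (?R - star ?R) = \<phi> ((cnj z - z) *\<^sub>C (?R * star ?R))"
    "\<phi> (star ?R - ?R) = \<phi> ((z - cnj z) *\<^sub>C (star ?R * ?R))"
    by (simp_all only:)
  then have "Im (cauchy1 \<phi> a z) = - Im z * Re (\<phi> (?R * star ?R))"
    "Im (cauchy1 \<phi> a z) = - Im z * Re (\<phi> (star ?R * ?R))"
    by (simp_all add: state_diff state_scale state_star complex_eq_iff cauchy1_def)
  then show "Re (\<phi> (star ?R * ?R)) = - Im (cauchy1 \<phi> a z) / Im z"
    "Re (\<phi> (?R * star ?R)) = - Im (cauchy1 \<phi> a z) / Im z"
    using z by (simp_all add: field_simps)
qed

lemma Im_cauchy1_neg:
  assumes a: "self_adjoint a" and z: "Im z > 0"
  shows "Im (cauchy1 \<phi> a z) < 0"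
proof -
  let ?R = "resolvent a z"
  have "?R \<noteq> 0" using resolvent_inverse(1)[OF a, of z] z by auto
  then have "Re (\<phi> (star ?R * ?R)) \<noteq> 0"
    using faithful[of ?R] Im_positive[of ?R] by (auto simp: complex_eq_iff)
  then have "Re (\<phi> (star ?R * ?R)) > 0" using Re_positive[of ?R] by linarith
  then show ?thesis
    unfolding state_resolvent_square(1)[OF a z] using z by (simp add: divide_simps)
qed

text \<open>The second part is Cauchy-Schwarz against 1, combined with
  \<open>state_resolvent_square\<close>; it later gives the lower bounds for the subordination
  functions.\<close>

lemma Im_reciprocal_cauchy1:
  assumes a: "self_adjoint a" and z: "Im z > 0"
  shows "- Im (cauchy1 \<phi> a z) = Im (1 / cauchy1 \<phi> a z) * (cmod (cauchy1 \<phi> a z))\<^sup>2"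
    and "Im z \<le> Im (1 / cauchy1 \<phi> a z)"
proof -
  let ?g = "cauchy1 \<phi> a z"
  have g: "?g \<noteq> 0" using Im_cauchy1_neg[OF a z] by auto
  then have pos: "(cmod ?g)\<^sup>2 > 0" by simp
  show eq: "- Im ?g = Im (1 / ?g) * (cmod ?g)\<^sup>2"
    using pos by (simp add: Im_divide cmod_power2)
  have "(cmod ?g)\<^sup>2 \<le> - Im ?g / Im z"
    using Cauchy_Schwarz[of 1 "resolvent a z"]
    unfolding state_resolvent_square(1)[OF a z] by (simp add: cauchy1_def)
  then have "Im z * (cmod ?g)\<^sup>2 \<le> Im (1 / ?g) * (cmod ?g)\<^sup>2"
    using z unfolding eq[symmetric] by (simp add: field_simps)
  then show "Im z \<le> Im (1 / ?g)" using pos by (simp add: mult_le_cancel_right)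
qed

lemma cauchy2_bound:
  assumes sa: "self_adjoint a" "self_adjoint b" and z: "Im z > 0" and w: "Im w > 0"
  shows "Im z * Im w * (cmod (cauchy2 \<phi> (a, b) z w))\<^sup>2 \<le> Im (cauchy1 \<phi> a z) * Im (cauchy1 \<phi> b w)"
proof -
  have "(cmod (cauchy2 \<phi> (a, b) z w))\<^sup>2 \<le> (- Im (cauchy1 \<phi> a z) / Im z) * (- Im (cauchy1 \<phi> b w) / Im w)"
    using Cauchy_Schwarz[of "star (resolvent a z)" "resolvent b w"]
    by (simp add: star_star cauchy2_def state_resolvent_square sa z w del: minus_divide_left)
  then show ?thesis using z w by (simp add: field_simps)
qed

text \<open>After division by the mean, the variance of a resolvent at \<open>z\<close> is
  \<open>Im (1 / g) / Im z - 1\<close>; the bound is the covariance estimate in these units.\<close>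

lemma normalised_covariance_bound:
  assumes sa: "self_adjoint a" "self_adjoint b" and z: "Im z > 0" and w: "Im w > 0"
  defines "g \<equiv> cauchy1 \<phi> a z" and "h \<equiv> cauchy1 \<phi> b w"
  shows "(cmod (cauchy2 \<phi> (a, b) z w / (g * h) - 1))\<^sup>2 \<le> (Im (1 / g) / Im z - 1) * (Im (1 / h) / Im w - 1)"
proof -
  have "g \<noteq> 0" "h \<noteq> 0"
    using Im_cauchy1_neg[OF sa(1) z] Im_cauchy1_neg[OF sa(2) w] by (auto simp: g_def h_def)
  then have pos: "(cmod g)\<^sup>2 > 0" "(cmod h)\<^sup>2 > 0" and gh: "g * h \<noteq> 0" by simp_all
  let ?K = "cauchy2 \<phi> (a, b) z w"
  have "(cmod (?K - g * h))\<^sup>2 \<le> (- Im g / Im z - (cmod g)\<^sup>2) * (- Im h / Im w - (cmod h)\<^sup>2)"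
    using covariance_bound[of "star (resolvent a z)" "resolvent b w"]
    by (simp add: star_star state_star cauchy2_def g_def h_def cauchy1_def
        state_resolvent_square[unfolded cauchy1_def] sa z w del: minus_divide_left)
  also have "\<dots> = (Im (1 / g) / Im z - 1) * (Im (1 / h) / Im w - 1) * (cmod (g * h))\<^sup>2"
    unfolding g_def h_def Im_reciprocal_cauchy1(1)[OF sa(1) z] Im_reciprocal_cauchy1(1)[OF sa(2) w]
    by (simp add: norm_mult power_mult_distrib algebra_simps)
  finally have "(cmod (?K - g * h))\<^sup>2 / (cmod (g * h))\<^sup>2 \<le> (Im (1 / g) / Im z - 1) * (Im (1 / h) / Im w - 1)"
    using gh by (subst pos_divide_le_eq) auto
  moreover have "?K / (g * h) - 1 = (?K - g * h) / (g * h)"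
    using gh by (simp add: diff_divide_distrib)
  ultimately show ?thesis by (simp add: norm_divide power_divide)
qed

end


section \<open>The subordination inequality\<close>

text \<open>Cauchy-Schwarz in the plane for the vectors with squared coordinates (A - x, x) and (B -
  y, y); after squaring, what remains is the arithmetic-geometric mean inequality.\<close>

lemma sqrt_diff_mult_le:
  assumes "0 \<le> x" "x \<le> A" "0 \<le> y" "y \<le> B"
  shows "sqrt ((A - x) * (B - y)) \<le> sqrt (A * B) - sqrt (x * y)"
proof (rule real_le_lsqrt)
  have "x * y \<le> A * B" using assms by (intro mult_mono) auto
  then show "0 \<le> sqrt (A * B) - sqrt (x * y)" by simp
  have "sqrt (A * B) * sqrt (x * y) = sqrt (A * y * (B * x))"
    unfolding real_sqrt_mult[symmetric] by (simp add: mult_ac)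
  also have "\<dots> \<le> (A * y + B * x) / 2"
    using assms by (intro arith_geo_mean_sqrt) auto
  finally show "(A - x) * (B - y) \<le> (sqrt (A * B) - sqrt (x * y))\<^sup>2"
    using assms by (simp add: power2_diff algebra_simps)
qed

text \<open>\<open>A1\<close>, \<open>A2\<close> and \<open>x\<close> stand for the imaginary parts
  of the two subordination functions and of their argument, so that \<open>A1 + A2 - x\<close> is
  the imaginary part of 1/g; \<open>B1\<close>, \<open>B2\<close> and \<open>y\<close> play the same
  role on the right face.\<close>

lemma weighted_norm_bound:
  assumes x: "0 < x" "x \<le> A2" "0 < A1" and y: "0 < y" "y \<le> B2" "0 < B1"
    and c: "(cmod (c1 - 1))\<^sup>2 \<le> ((A1 + A2 - x) / A1 - 1) * ((B1 + B2 - y) / B1 - 1)"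
  shows "sqrt (A1 * B1) * cmod (c1 - 1) \<le> sqrt (A2 * B2) - sqrt (x * y)"
proof -
  have "(A1 + A2 - x) / A1 - 1 = (A2 - x) / A1" "(B1 + B2 - y) / B1 - 1 = (B2 - y) / B1"
    using x y by (simp_all add: field_simps)
  with c have "(cmod (c1 - 1))\<^sup>2 \<le> (A2 - x) * (B2 - y) / (A1 * B1)" by simp
  then have "A1 * B1 * (cmod (c1 - 1))\<^sup>2 \<le> (A2 - x) * (B2 - y)"
    using x y by (simp add: field_simps)
  from real_sqrt_le_mono[OF this]
  have "sqrt (A1 * B1) * cmod (c1 - 1) \<le> sqrt ((A2 - x) * (B2 - y))"
    by (simp add: real_sqrt_mult)
  also have "\<dots> \<le> sqrt (A2 * B2) - sqrt (x * y)"
    using x y by (intro sqrt_diff_mult_le) auto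
  finally show ?thesis .
qed

text \<open>Dividing the relation by \<open>c2\<close> turns it into \<open>c - c1 = (c (c1 - 1) + c1) (c2 - 1)\<close>, where
  both factors are controlled by the assumed bounds; \<open>c2 = 0\<close> forces \<open>c = 0\<close> because \<open>c1\<close> and
  \<open>c2\<close> cannot both vanish.\<close>

lemma norm_bound_of_relation:
  fixes c c1 c2 :: complex
  assumes rel: "c * (c1 + c2 - c1 * c2) = c1 * c2"
    and b1: "\<alpha> * cmod (c1 - 1) \<le> \<beta> - \<xi>" and b2: "\<beta> * cmod (c2 - 1) \<le> \<alpha> - \<xi>"
    and pos: "\<xi> > 0" "\<alpha> \<ge> \<xi>" "\<beta> \<ge> \<xi>"
  shows "\<xi> * cmod c \<le> \<alpha> * cmod c1"
proof (cases "c2 = 0")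
  case True
  then have "\<beta> \<le> \<alpha> - \<xi>" using b2 by simp
  have "c * c1 = 0" using rel True by simp
  moreover have "c1 \<noteq> 0"
  proof
    assume "c1 = 0"
    then have "\<alpha> \<le> \<beta> - \<xi>" using b1 by simp
    with \<open>\<beta> \<le> \<alpha> - \<xi>\<close> pos show False by linarith
  qed
  ultimately show ?thesis using pos by simp
next
  case False
  have "c2 * (c - c1) = c2 * ((c * (c1 - 1) + c1) * (c2 - 1))"
    using rel by algebra
  then have eq: "c - c1 = (c * (c1 - 1) + c1) * (c2 - 1)"
    using False by simp
  define n n1 d1 where "n = cmod c" and "n1 = cmod c1" and "d1 = cmod (c1 - 1)"
  have nonneg: "n \<ge> 0" "n1 \<ge> 0" "d1 \<ge> 0" by (simp_all add: n_def n1_def d1_def)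
  have "n - n1 \<le> cmod (c - c1)" unfolding n_def n1_def by (rule norm_triangle_ineq2)
  also have "\<dots> = cmod (c * (c1 - 1) + c1) * cmod (c2 - 1)"
    unfolding eq by (rule norm_mult)
  also have "\<dots> \<le> (n * d1 + n1) * cmod (c2 - 1)"
    using norm_triangle_ineq[of "c * (c1 - 1)" c1]
    by (intro mult_right_mono) (simp_all add: n_def n1_def d1_def norm_mult)
  finally have "\<beta> * (n - n1) \<le> \<beta> * ((n * d1 + n1) * cmod (c2 - 1))"
    using pos by (intro mult_left_mono) auto
  also have "\<dots> = (n * d1 + n1) * (\<beta> * cmod (c2 - 1))" by (simp add: mult_ac)
  also have "\<dots> \<le> (n * d1 + n1) * (\<alpha> - \<xi>)"
    using b2 nonneg by (intro mult_left_mono) auto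
  finally have "\<alpha> * (\<beta> * (n - n1)) \<le> \<alpha> * ((n * d1 + n1) * (\<alpha> - \<xi>))"
    using pos by (intro mult_left_mono) auto
  also have "\<dots> = (n * (\<alpha> * d1) + \<alpha> * n1) * (\<alpha> - \<xi>)" by (simp add: algebra_simps)
  also have "\<dots> \<le> (n * (\<beta> - \<xi>) + \<alpha> * n1) * (\<alpha> - \<xi>)"
    using b1 nonneg pos unfolding d1_def by (intro mult_right_mono add_right_mono mult_left_mono) auto
  finally have "(\<xi> * n) * (\<alpha> + \<beta> - \<xi>) \<le> (\<alpha> * n1) * (\<alpha> + \<beta> - \<xi>)"
    by (simp add: algebra_simps)
  moreover have "\<alpha> + \<beta> - \<xi> > 0" using pos by linarith
  ultimately show ?thesis by (simp add: n_def n1_def mult_le_cancel_right)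
qed

locale bi_free_subordination = bi_free_model \<phi> a b T1 S1 T2 S2
  for \<phi> :: "'a::cstar_algebra \<Rightarrow> complex" and a b
    and T1 S1 :: "complex \<times> 'x::complex_vector \<Rightarrow> complex \<times> 'x"
    and T2 S2 :: "complex \<times> 'y::complex_vector \<Rightarrow> complex \<times> 'y" +
  fixes \<alpha> \<beta> :: "bool \<Rightarrow> complex \<Rightarrow> complex"
  assumes sa: "self_adjoint (a i)" "self_adjoint (b i)"
    and sub_a: "subordination_functions \<phi> (a True) (a False) (\<alpha> True) (\<alpha> False)"
    and sub_b: "subordination_functions \<phi> (b True) (b False) (\<beta> True) (\<beta> False)"
begin

abbreviation g where "g \<equiv> cauchy1 \<phi> (a True + a False)"
abbreviation h where "h \<equiv> cauchy1 \<phi> (b True + b False)"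
abbreviation G where "G \<equiv> cauchy2 \<phi> (a True + a False, b True + b False)"
abbreviation K where "K i z w \<equiv> cauchy2 \<phi> (a i, b i) (\<alpha> i z) (\<beta> i w)"

lemma sa_sum: "self_adjoint (a True + a False)" "self_adjoint (b True + b False)"
  using sa by (simp_all add: self_adjoint_def star_add)

lemma subordination:
  assumes "Im z > 0"
  shows "Im (\<alpha> i z) > 0" "cauchy1 \<phi> (a i) (\<alpha> i z) = g z" "\<alpha> True z + \<alpha> False z - z = 1 / g z"
    and "Im (\<beta> i z) > 0" "cauchy1 \<phi> (b i) (\<beta> i z) = h z" "\<beta> True z + \<beta> False z - z = 1 / h z"
  using sub_a sub_b assms by (cases i; force simp: subordination_functions_def Pi_iff)+

lemma holomorphic_subordination: "\<alpha> i holomorphic_on \<complex>\<^sup>+" "\<beta> i holomorphic_on \<complex>\<^sup>+"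
  using sub_a sub_b by (cases i; simp add: subordination_functions_def)+

text \<open>The right-hand sides are the imaginary parts of 1/g and 1/h, which are also reciprocal
  Cauchy transforms of \<open>a i\<close> and \<open>b i\<close> at the subordinated points, so
  \<open>Im_reciprocal_cauchy1\<close> applies. Read for the opposite index, this bounds each
  subordination function from below by \<open>Im z\<close>.\<close>

lemma Im_subordination_le:
  assumes "Im z > 0"
  shows "Im (\<alpha> i z) \<le> Im (\<alpha> True z) + Im (\<alpha> False z) - Im z"
    and "Im (\<beta> i z) \<le> Im (\<beta> True z) + Im (\<beta> False z) - Im z"
proof -
  note s = subordination[OF assms]
  have "Im (\<alpha> i z) \<le> Im (1 / g z)" "Im (\<beta> i z) \<le> Im (1 / h z)"
    using Im_reciprocal_cauchy1(2)[OF sa(1)[of i] s(1)[of i]] Im_reciprocal_cauchy1(2)[OF sa(2)[of i] s(4)[of i]]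
    by (simp_all only: s)
  then show "Im (\<alpha> i z) \<le> Im (\<alpha> True z) + Im (\<alpha> False z) - Im z"
    "Im (\<beta> i z) \<le> Im (\<beta> True z) + Im (\<beta> False z) - Im z"
    unfolding s(3,6)[symmetric] by simp_all
qed

lemma Im_subordination_ge:
  assumes "Im z > 0"
  shows "Im z \<le> Im (\<alpha> i z)" "Im z \<le> Im (\<beta> i z)"
  using Im_subordination_le[OF assms, of True] Im_subordination_le[OF assms, of False]
  by (cases i; simp)+

lemma holomorphic_cauchy:
  shows "g holomorphic_on \<complex>\<^sup>+" "h holomorphic_on \<complex>\<^sup>+"
    and "(\<lambda>z. G z w) holomorphic_on \<complex>\<^sup>+" "G z holomorphic_on \<complex>\<^sup>+"
    and "(\<lambda>z. K i z w) holomorphic_on \<complex>\<^sup>+" "K i z holomorphic_on \<complex>\<^sup>+"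
proof -
  show "g holomorphic_on \<complex>\<^sup>+" "h holomorphic_on \<complex>\<^sup>+"
    using holomorphic_resolvent[OF sa_sum(1), of 1 1] holomorphic_resolvent[OF sa_sum(2), of 1 1]
    by (simp_all add: cauchy1_def[abs_def])
  show "(\<lambda>z. G z w) holomorphic_on \<complex>\<^sup>+" "G z holomorphic_on \<complex>\<^sup>+"
    using holomorphic_resolvent[OF sa_sum(1), of 1] holomorphic_resolvent[OF sa_sum(2), of _ 1]
    by (simp_all add: cauchy2_def[abs_def])
  have maps: "\<alpha> i ` \<complex>\<^sup>+ \<subseteq> \<complex>\<^sup>+" "\<beta> i ` \<complex>\<^sup>+ \<subseteq> \<complex>\<^sup>+"
    using subordination(1,4) by auto
  show "(\<lambda>z. K i z w) holomorphic_on \<complex>\<^sup>+" "K i z holomorphic_on \<complex>\<^sup>+"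
    using holomorphic_on_compose_gen[OF holomorphic_subordination(1) holomorphic_resolvent[OF sa(1)[of i], of 1] maps(1)]
      holomorphic_on_compose_gen[OF holomorphic_subordination(2) holomorphic_resolvent[OF sa(2)[of i], of _ 1] maps(2)]
    by (simp_all add: cauchy2_def[abs_def] o_def)
qed

lemma subordination_identity:
  assumes z: "Im z > 0" and w: "Im w > 0"
  shows "G z w * (g z * h w * (K True z w + K False z w) - K True z w * K False z w) =
    g z * h w * (K True z w * K False z w)"
proof -
  \<comment> \<open>By \<open>Im_subordination_ge\<close> a large imaginary part of the argument
    passes to all subordinated points, so one threshold serves the four elements.\<close>
  define C where "C = 5 * (norm (a True) + norm (a False) + norm (b True) + norm (b False)) + 1"
  have C: "C \<ge> 1" "5 * norm (a i) + 1 \<le> C" "5 * norm (b i) + 1 \<le> C" for i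
    by (cases i; simp add: C_def)+
  have large: "G z w * (g z * h w * (K True z w + K False z w) - K True z w * K False z w) =
    g z * h w * (K True z w * K False z w)" if "Im z > C" "Im w > C" for z w
  proof (rule subordination_identity_near_infinity[where \<alpha> = "\<lambda>i. \<alpha> i z" and \<beta> = "\<lambda>i. \<beta> i w"])
    have z: "Im z > 0" and w: "Im w > 0" using that C(1) by linarith+
    then show "Im z \<noteq> 0" "Im w \<noteq> 0" by simp_all
    show "5 * norm (a i) + 1 \<le> Im (\<alpha> i z)" "5 * norm (b i) + 1 \<le> Im (\<beta> i w)" for i
      using Im_subordination_ge(1)[OF z, of i] Im_subordination_ge(2)[OF w, of i] C(2,3)[of i] that by linarith+
    show "\<alpha> True z + \<alpha> False z - z = 1 / g z" "\<beta> True w + \<beta> False w - w = 1 / h w"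
      "cauchy1 \<phi> (a i) (\<alpha> i z) = g z" "cauchy1 \<phi> (b i) (\<beta> i w) = h w" for i
      by (rule subordination z w)+
  qed (rule sa)+
  \<comment> \<open>Continuation in \<open>z\<close> with \<open>w\<close> still near infinity; the
    final step continues in \<open>w\<close> for arbitrary \<open>z\<close>.\<close>
  have half: "G z w * (g z * h w * (K True z w + K False z w) - K True z w * K False z w) =
    g z * h w * (K True z w * K False z w)" if "Im z > 0" "Im w > C" for z w
    by (rule continuation_upper_half_plane[where C = C and z = z
          and f = "\<lambda>z. G z w * (g z * h w * (K True z w + K False z w) - K True z w * K False z w)"
          and g = "\<lambda>z. g z * h w * (K True z w * K False z w)"])
      (use that C(1) in \<open>auto intro!: large holomorphic_intros holomorphic_cauchy\<close>)
  show ?thesis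
    by (rule continuation_upper_half_plane[where C = C and z = w
          and f = "\<lambda>w. G z w * (g z * h w * (K True z w + K False z w) - K True z w * K False z w)"
          and g = "\<lambda>w. g z * h w * (K True z w * K False z w)"])
      (use z w C(1) in \<open>auto intro!: half holomorphic_intros holomorphic_cauchy\<close>)
qed

lemma subordination_inequality:
  assumes z: "Im z > 0" and w: "Im w > 0"
  shows "Im z * Im w * (cmod (G z w))\<^sup>2 \<le> Im (\<alpha> i z) * Im (\<beta> i w) * (cmod (K i z w))\<^sup>2"
proof -
  note s = subordination[OF z] subordination[OF w]
  define N where "N = g z * h w"
  define c where "c = G z w / N"
  define k where "k i = K i z w / N" for i
  \<comment> \<open>Geometric means over the left and right faces: with these weights the covariance
    bound becomes the linear estimate that \<open>norm_bound_of_relation\<close> expects.\<close>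
  define A where "A i = sqrt (Im (\<alpha> i z) * Im (\<beta> i w))" for i
  define \<xi> where "\<xi> = sqrt (Im z * Im w)"
  have N: "N \<noteq> 0"
    using Im_cauchy1_neg[OF sa_sum(1) z] Im_cauchy1_neg[OF sa_sum(2) w] by (auto simp: N_def)
  have "G z w = N * c" "K i z w = N * k i" for i
    using N by (simp_all add: c_def k_def)
  then have "N * c * (N * (N * k True + N * k False) - N * k True * (N * k False)) = N * (N * k True * (N * k False))"
    using subordination_identity[OF z w] by (simp add: N_def)
  then have "N ^ 3 * (c * (k True + k False - k True * k False)) = N ^ 3 * (k True * k False)"
    by (simp add: power3_eq_cube algebra_simps)
  then have rel: "c * (k True + k False - k True * k False) = k True * k False"
    using N by simp
  have "A i * cmod (k i - 1) \<le> A (\<not> i) - \<xi>" for i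
    unfolding A_def \<xi>_def
  proof (rule weighted_norm_bound)
    have sums: "\<alpha> i z + \<alpha> (\<not> i) z - z = 1 / g z" "\<beta> i w + \<beta> (\<not> i) w - w = 1 / h w"
      using s(3) s(12) by (cases i; simp add: add.commute)+
    have "(cmod (k i - 1))\<^sup>2 \<le> (Im (1 / g z) / Im (\<alpha> i z) - 1) * (Im (1 / h w) / Im (\<beta> i w) - 1)"
      using normalised_covariance_bound[OF sa(1)[of i] sa(2)[of i] s(1)[of i] s(10)[of i]]
      by (simp only: s(2) s(11) k_def N_def)
    then show "(cmod (k i - 1))\<^sup>2 \<le> ((Im (\<alpha> i z) + Im (\<alpha> (\<not> i) z) - Im z) / Im (\<alpha> i z) - 1) *
        ((Im (\<beta> i w) + Im (\<beta> (\<not> i) w) - Im w) / Im (\<beta> i w) - 1)"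
      unfolding sums[symmetric] by simp
  qed (use s(1,10) z w Im_subordination_ge z w in auto)
  from this[of i] this[of "\<not> i"]
  have b: "A i * cmod (k i - 1) \<le> A (\<not> i) - \<xi>" "A (\<not> i) * cmod (k (\<not> i) - 1) \<le> A i - \<xi>" by simp_all
  have pos: "\<xi> > 0" using z w by (simp add: \<xi>_def)
  have ge: "\<xi> \<le> A i" for i
    unfolding A_def \<xi>_def using z w s(1,10) Im_subordination_ge
    by (intro real_sqrt_le_mono mult_mono) (auto simp: less_imp_le)
  have "c * (k i + k (\<not> i) - k i * k (\<not> i)) = k i * k (\<not> i)"
    using rel by (cases i) (simp_all add: add.commute mult.commute)
  from norm_bound_of_relation[OF this b pos ge ge]
  have "\<xi> * cmod c \<le> A i * cmod (k i)" .
  then have "(\<xi> * cmod c)\<^sup>2 \<le> (A i * cmod (k i))\<^sup>2"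
    using pos by (intro power_mono) auto
  then have "Im z * Im w * (cmod c)\<^sup>2 \<le> Im (\<alpha> i z) * Im (\<beta> i w) * (cmod (k i))\<^sup>2"
    using z w s(1)[of i] s(10)[of i] by (simp add: power_mult_distrib \<xi>_def A_def)
  then have "Im z * Im w * (cmod c)\<^sup>2 * (cmod N)\<^sup>2 \<le> Im (\<alpha> i z) * Im (\<beta> i w) * (cmod (k i))\<^sup>2 * (cmod N)\<^sup>2"
    by (intro mult_right_mono) auto
  then show ?thesis
    using N by (simp add: c_def k_def norm_divide power_divide)
qed

end

theorem proposition3p5:
  fixes \<phi> :: "'a::cstar_algebra \<Rightarrow> complex"
    and a b :: "nat \<Rightarrow> 'a"
    and \<eta> :: "nat \<Rightarrow> (real \<times> real) measure"
    and \<eta>_conv :: "(real \<times> real) measure"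
    and \<omega>a \<omega>b :: "nat \<Rightarrow> complex \<Rightarrow> complex"
  assumes "faithful_state \<phi>"
    and "\<forall>j\<in>{1, 2}. self_adjoint (a j) \<and> self_adjoint (b j) \<and> a j * b j = b j * a j"
    and "bi_free TYPE('x::complex_vector) TYPE('y::complex_vector) \<phi> (a 1, b 1) (a 2, b 2)"
    and "\<forall>j\<in>{1, 2}. is_distribution \<phi> (a j, b j) (\<eta> j)"
    and "is_distribution \<phi> (a 1 + a 2, b 1 + b 2) \<eta>_conv"
    and "subordination_functions \<phi> (a 1) (a 2) (\<omega>a 1) (\<omega>a 2)"
    and "subordination_functions \<phi> (b 1) (b 2) (\<omega>b 1) (\<omega>b 2)"
  shows "\<forall>z\<in>\<complex>\<^sup>+. \<forall>w\<in>\<complex>\<^sup>+. \<forall>j\<in>{1, 2}.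
      Im (cauchy1 \<phi> (a j) z) * Im (cauchy1 \<phi> (b j) w)
        \<ge> Im z * Im w * (cmod (cauchy2 \<phi> (a j, b j) z w))\<^sup>2 \<and>
      Im (\<omega>a j z) * Im (\<omega>b j w) * (cmod (cauchy_measure (\<eta> j) (\<omega>a j z) (\<omega>b j w)))\<^sup>2
        \<ge> Im z * Im w * (cmod (cauchy_measure \<eta>_conv z w))\<^sup>2"
proof (intro ballI)
  fix z w j assume "z \<in> \<complex>\<^sup>+" "w \<in> \<complex>\<^sup>+" and j: "j \<in> {1, 2 :: nat}"
  then have z: "Im z > 0" and w: "Im w > 0" by simp_all
  interpret cstar_state \<phi> by unfold_locales fact
  \<comment> \<open>Truth values as indices make the opposite index \<open>\<not> i\<close>, the
    form in which alternating words are indexed.\<close>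
  define n where "n i = (if i then 1 else 2 :: nat)" for i
  have n: "n i \<in> {1, 2}" "n True = 1" "n False = 2" for i by (simp_all add: n_def)
  obtain T1 S1 :: "complex \<times> 'x \<Rightarrow> complex \<times> 'x" and T2 S2 :: "complex \<times> 'y \<Rightarrow> complex \<times> 'y"
    where lin: "complex_linear T1" "complex_linear S1" "complex_linear T2" "complex_linear S2"
      and mom: "\<forall>ks. set ks \<subseteq> {..<4} \<longrightarrow>
          \<phi> (prod_list (map ((!) [a 1, a 2, b 1, b 2]) ks)) =
          vacuum_state (foldr (\<circ>) (map ((!)
            [left_op Inl T1, left_op Inr T2, right_op Inl S1, right_op Inr S2]) ks) id)"
    using assms(3) unfolding bi_free_def fst_conv snd_conv by blast
  interpret bi_free_subordination \<phi> "\<lambda>i. a (n i)" "\<lambda>i. b (n i)" T1 S1 T2 S2 "\<lambda>i. \<omega>a (n i)" "\<lambda>i. \<omega>b (n i)"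
  proof (intro bi_free_subordination.intro bi_free_model.intro bi_free_model_axioms.intro
      bi_free_subordination_axioms.intro)
    show "cstar_state \<phi>" by (rule cstar_state_axioms)
    show "complex_linear T1" "complex_linear S1" "complex_linear T2" "complex_linear S2" by (fact lin)+
    show "\<phi> (prod_list (map ((!) [a (n True), a (n False), b (n True), b (n False)]) ks)) =
          vacuum_state (foldr (\<circ>) (map ((!)
            [left_op Inl T1, left_op Inr T2, right_op Inl S1, right_op Inr S2]) ks) id)"
      if "set ks \<subseteq> {..<4}" for ks
      using mom[rule_format, OF that] unfolding n .
    show "self_adjoint (a (n i))" "self_adjoint (b (n i))" for i
      using assms(2) n(1)[of i] by blast+
    show "subordination_functions \<phi> (a (n True)) (a (n False)) (\<omega>a (n True)) (\<omega>a (n False))"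
      "subordination_functions \<phi> (b (n True)) (b (n False)) (\<omega>b (n True)) (\<omega>b (n False))"
      using assms(6,7) unfolding n .
  qed
  obtain i where i: "j = n i" using j that[of True] that[of False] n(2,3) by auto
  have sa: "self_adjoint (a j)" "self_adjoint (b j)" using assms(2) j by blast+
  have "cauchy_measure (\<eta> j) (\<omega>a j z) (\<omega>b j w) = cauchy2 \<phi> (a j, b j) (\<omega>a j z) (\<omega>b j w)"
    using assms(4) j sa subordination(1)[OF z, of i] subordination(4)[OF w, of i]
    by (intro cauchy_measure_eq) (auto simp: i)
  moreover have "cauchy_measure \<eta>_conv z w = cauchy2 \<phi> (a 1 + a 2, b 1 + b 2) z w"
    using assms(5) sa_sum z w by (intro cauchy_measure_eq) (simp_all add: n)
  ultimately show "Im z * Im w * (cmod (cauchy2 \<phi> (a j, b j) z w))\<^sup>2 \<le> Im (cauchy1 \<phi> (a j) z) * Im (cauchy1 \<phi> (b j) w) \<and>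
      Im z * Im w * (cmod (cauchy_measure \<eta>_conv z w))\<^sup>2
        \<le> Im (\<omega>a j z) * Im (\<omega>b j w) * (cmod (cauchy_measure (\<eta> j) (\<omega>a j z) (\<omega>b j w)))\<^sup>2"
    using cauchy2_bound[OF sa z w] subordination_inequality[OF z w, of i] by (simp add: i n)
qed

end
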